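(* Let $M^n$, $O^{n+1}$ be smooth manifolds and $T>0$. Let $g^O(\tau)$, $\tau\in(0,T]$, be a smooth family of Riemannian metrics on $O^{n+1}$ and $F_\tau:M^n\to O^{n+1}$, $\tau\in(0,T]$, a smooth family of immersions with $M_\tau=F_\tau(M^n)$, solving the mean curvature flow in a backwards Ricci flow background $$\frac{\partial}{\partial \tau}F_\tau=-H\nu,\qquad \frac{\partial}{\partial \tau}g^O=2\,\mathrm{Ric}_{g^O}.$$ Suppose that $g^O(\tau)$ has uniformly bounded curvature and that $M_\tau$ has uniformly bounded second fundamental form. For large $N>0$ let $\hat g=\hat g_N$ be the metric on $O^{n+1}\times(0,T]$ given by $$\hat g=\frac{g^O(\tau)}{\tau}+\left(\frac{N}{2\tau^3}+\frac{R_{g^O}}{\tau}-\frac{n+1}{2\tau^2}\right)d\tau^2,$$ let $\hat f(y,\tau)=\frac{N}{2\tau}$, and let $\hat\Sigma=\{(x,\tau):x\in M_\tau,\ \tau\in(0,T]\}$ be the space-time track of $M_\tau$, viewed as an immersed hypersurface of $(O^{n+1}\times(0,T],\hat g)$. Then $\hat\Sigma$ is an approximate soliton of the mean curvature flow, i.e. the quantity $$\hat E_N=H^{\hat\Sigma}+\nu^{\hat\Sigma}\hat f$$ is such that $N|\hat E_N|$ is bounded uniformly locally on $\hat\Sigma$, independently of $N$. Here $H^{\hat\Sigma}$ and $\nu^{\hat\Sigma}$ are the mean curvature and the unit normal of $\hat\Sigma$ with respect to $\hat g$, and $\nu^{\hat\Sigma}\hat f$ is the derivative of $\hat f$ in direction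 $\nu^{\hat\Sigma}$.
   Context: Conventions. $\nu$ is a smooth choice of unit normal on $M_\tau$ with respect to $g^O(\tau)$; the second fundamental form of $M_\tau$ is $h(X,Y)=-g^O({}^{g^O}\nabla_XY,\nu)$ for tangential $X,Y$, and $H$ is its trace with respect to the induced metric $g$ on $M_\tau$ (so that $\partial_\tau F_\tau=-H\nu$ is the usual mean curvature flow). $\mathrm{Ric}_{g^O}$ and $R_{g^O}$ are the Ricci tensor and scalar curvature of $g^O(\tau)$, with the usual sign (positive on round spheres). The parameter $N$ is always taken large enough that $\hat g_N$ is a Riemannian metric (possible because the curvature is uniformly bounded). The product $O^{n+1}\times(0,T]$ carries no mixed space-time components in $\hat g$. The track $\hat\Sigma$ is the immersion $F^{\hat\Sigma}:M^n\times(0,T]\to O^{n+1}\times(0,T]$, $F^{\hat\Sigma}(x,\tau)=(F_\tau(x),\tau)$. Its unit normal $\nu^{\hat\Sigma}$ is chosen on the same side as $\nu$, i.e. $\hat g(\nu^{\hat\Sigma},\nu)>0$; its second fundamental form is $h^{\hat\Sigma}(X,Y)=-\hat g(\hat\nabla_XY,\nu^{\hat\Sigma})$ with $\hat\nabla$ the Levi-Civita connection of $\hat g$, and $H^{\hat\Sigma}$ is the trace of $h^{\hat\Sigma}$ with respect to the metric induced by $\hat g$. "$N|\hat E_N|$ is bounded uniformly locally on $\hat\Sigma$, independently of $N$" means: there is $N_0>0$ such that for every compact $K\subset M^n\times(0,T]$ there is a constant $C$, not depending on $N$, with $N|\hat E_N|\le C$ on $K$ for all $N\ge N_0$ (functions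 on $\hat\Sigma$ being regarded as functions on $M^n\times(0,T]$). *)

theory Defs
  imports "HOL-Analysis.Analysis"
begin

section \<open>Calculus on open sets and on sets open up to a final time\<close>

text \<open>
  All derivatives are taken within the domain of definition.  The domains that occur are open
  subsets of a Euclidean space \<open>'a\<close>, or relatively open subsets of \<open>U \<times> {0<..T}\<close> with
  \<open>U\<close> open in \<open>'a\<close>.  On these the derivative within the domain is unique; it is the ordinary
  derivative in the interior, and one-sided in time at the final time \<open>T\<close>.
\<close>

definition pd :: "'a::euclidean_space set \<Rightarrow> ('a \<Rightarrow> 'b::real_normed_vector) \<Rightarrow> 'a \<Rightarrow> 'a \<Rightarrow> 'b"
  where "pd S f x v = frechet_derivative f (at x within S) v"

primrec Ck_on :: "nat \<Rightarrow> 'a::euclidean_space set \<Rightarrow> ('a \<Rightarrow> 'b::real_normed_vector) \<Rightarrow> bool"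
  where
    "Ck_on 0 S f \<longleftrightarrow> continuous_on S f"
  | "Ck_on (Suc k) S f \<longleftrightarrow> f differentiable_on S \<and> (\<forall>v. Ck_on k S (\<lambda>x. pd S f x v))"

definition smooth_on :: "'a::euclidean_space set \<Rightarrow> ('a \<Rightarrow> 'b::real_normed_vector) \<Rightarrow> bool"
  where "smooth_on S f \<longleftrightarrow> (\<forall>k. Ck_on k S f)"


section \<open>Pointwise linear algebra\<close>

definition inner_form :: "('a::euclidean_space \<Rightarrow> 'a \<Rightarrow> real) \<Rightarrow> bool"
  where "inner_form g \<longleftrightarrow>
    bilinear g \<and> (\<forall>u v. g u v = g v u) \<and> (\<forall>u. u \<noteq> 0 \<longrightarrow> g u u > 0)"

definition sharp :: "('a::euclidean_space \<Rightarrow> 'a \<Rightarrow> real) \<Rightarrow> ('a \<Rightarrow> real) \<Rightarrow> 'a"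
  where "sharp g l = (THE w. \<forall>v. g w v = l v)"

text \<open>The trace of the bilinear form \<open>B\<close> with respect to \<open>g\<close>, that is, the trace of the
  endomorphism obtained from \<open>B\<close> by raising an index with \<open>g\<close> (in components \<open>g\<^sup>i\<^sup>j B\<^sub>i\<^sub>j\<close>).\<close>

definition metric_trace ::
    "('a::euclidean_space \<Rightarrow> 'a \<Rightarrow> real) \<Rightarrow> ('a \<Rightarrow> 'a \<Rightarrow> real) \<Rightarrow> real"
  where "metric_trace g B = (\<Sum>b\<in>Basis. sharp g (B b) \<bullet> b)"


section \<open>Riemannian geometry in coordinates\<close>

text \<open>
  A metric on a coordinate domain \<open>S\<close> is a function \<open>G\<close> with \<open>G z u v\<close> the product at \<open>z\<close> of the
  coordinate vectors \<open>u\<close> and \<open>v\<close>.  The Christoffel map \<open>christoffel S G z u v\<close> is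
  \<open>\<nabla>\<^sub>u v\<close> for constant vector fields \<open>u\<close>, \<open>v\<close>, given by the Koszul formula
  (in components \<open>\<Gamma>\<^sup>k\<^sub>i\<^sub>j u\<^sup>i v\<^sup>j\<close>).
\<close>

definition christoffel ::
    "'a::euclidean_space set \<Rightarrow> ('a \<Rightarrow> 'a \<Rightarrow> 'a \<Rightarrow> real) \<Rightarrow> 'a \<Rightarrow> 'a \<Rightarrow> 'a \<Rightarrow> 'a"
  where "christoffel S G z u v = sharp (G z) (\<lambda>w.
    (pd S (\<lambda>y. G y v w) z u + pd S (\<lambda>y. G y u w) z v - pd S (\<lambda>y. G y u v) z w) / 2)"

text \<open>\<open>riemann S G z u v w\<close> is \<open>\<nabla>\<^sub>u \<nabla>\<^sub>v w - \<nabla>\<^sub>v \<nabla>\<^sub>u w\<close> for constant vector fields.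
  With this convention \<open>Ric(v, w) = tr (u \<mapsto> R(u, v) w)\<close> is positive on round spheres.\<close>

definition riemann ::
    "'a::euclidean_space set \<Rightarrow> ('a \<Rightarrow> 'a \<Rightarrow> 'a \<Rightarrow> real) \<Rightarrow> 'a \<Rightarrow> 'a \<Rightarrow> 'a \<Rightarrow> 'a \<Rightarrow> 'a"
  where "riemann S G z u v w =
      pd S (\<lambda>y. christoffel S G y v w) z u - pd S (\<lambda>y. christoffel S G y u w) z v
    + christoffel S G z u (christoffel S G z v w)
    - christoffel S G z v (christoffel S G z u w)"

definition ricci ::
    "'a::euclidean_space set \<Rightarrow> ('a \<Rightarrow> 'a \<Rightarrow> 'a \<Rightarrow> real) \<Rightarrow> 'a \<Rightarrow> 'a \<Rightarrow> 'a \<Rightarrow> real"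
  where "ricci S G z v w = (\<Sum>b\<in>Basis. riemann S G z b v w \<bullet> b)"

definition scalar_curv ::
    "'a::euclidean_space set \<Rightarrow> ('a \<Rightarrow> 'a \<Rightarrow> 'a \<Rightarrow> real) \<Rightarrow> 'a \<Rightarrow> real"
  where "scalar_curv S G z = metric_trace (G z) (ricci S G z)"

text \<open>An immersion \<open>f : D \<rightarrow> S\<close> into a coordinate domain \<open>S\<close> with metric \<open>G\<close>.\<close>

definition induced_metric ::
    "'a::euclidean_space set \<Rightarrow> ('a \<Rightarrow> 'b::euclidean_space) \<Rightarrow> ('b \<Rightarrow> 'b \<Rightarrow> 'b \<Rightarrow> real)
      \<Rightarrow> 'a \<Rightarrow> 'a \<Rightarrow> 'a \<Rightarrow> real"
  where "induced_metric D f G x u v = G (f x) (pd D f x u) (pd D f x v)"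

definition is_unit_normal ::
    "'a::euclidean_space set \<Rightarrow> ('a \<Rightarrow> 'b::euclidean_space) \<Rightarrow> ('b \<Rightarrow> 'b \<Rightarrow> 'b \<Rightarrow> real)
      \<Rightarrow> 'a \<Rightarrow> 'b \<Rightarrow> bool"
  where "is_unit_normal D f G x nu \<longleftrightarrow>
    G (f x) nu nu = 1 \<and> (\<forall>u. G (f x) (pd D f x u) nu = 0)"

text \<open>\<open>h(u, v) = - G(\<nabla>\<^sub>u (df v), nu)\<close>, where \<open>\<nabla>\<close> is the Levi-Civita connection of \<open>G\<close>
  pulled back along \<open>f\<close> and \<open>nu\<close> is a normal vector at the point \<open>f x\<close>.\<close>

definition second_ff ::
    "'a::euclidean_space set \<Rightarrow> ('a \<Rightarrow> 'b::euclidean_space) \<Rightarrow> 'b set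
      \<Rightarrow> ('b \<Rightarrow> 'b \<Rightarrow> 'b \<Rightarrow> real) \<Rightarrow> 'b \<Rightarrow> 'a \<Rightarrow> 'a \<Rightarrow> 'a \<Rightarrow> real"
  where "second_ff D f S G nu x u v =
    - G (f x) (pd D (\<lambda>y. pd D f y v) x u
               + christoffel S G (f x) (pd D f x u) (pd D f x v)) nu"

definition mean_curv ::
    "'a::euclidean_space set \<Rightarrow> ('a \<Rightarrow> 'b::euclidean_space) \<Rightarrow> 'b set
      \<Rightarrow> ('b \<Rightarrow> 'b \<Rightarrow> 'b \<Rightarrow> real) \<Rightarrow> 'b \<Rightarrow> 'a \<Rightarrow> real"
  where "mean_curv D f S G nu x =
    metric_trace (induced_metric D f G x) (second_ff D f S G nu x)"


section \<open>Smooth manifolds\<close>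

text \<open>A chart is a pair of its domain and its coordinate map (only the values of the latter on
  the domain are relevant).\<close>

type_synonym ('m, 'a) chart = "'m set \<times> ('m \<Rightarrow> 'a)"

abbreviation cdom :: "('m, 'a) chart \<Rightarrow> 'm set" where "cdom c \<equiv> fst c"
abbreviation cmap :: "('m, 'a) chart \<Rightarrow> 'm \<Rightarrow> 'a" where "cmap c \<equiv> snd c"
abbreviation cimg :: "('m, 'a) chart \<Rightarrow> 'a set" where "cimg c \<equiv> snd c ` fst c"
abbreviation cinv :: "('m, 'a) chart \<Rightarrow> 'a \<Rightarrow> 'm" where "cinv c \<equiv> inv_into (fst c) (snd c)"

abbreviation overlap :: "('m, 'a) chart \<Rightarrow> ('m, 'a) chart \<Rightarrow> 'a set"
  where "overlap c c' \<equiv> cmap c ` (cdom c \<inter> cdom c')"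

abbreviation transition :: "('m, 'a) chart \<Rightarrow> ('m, 'a) chart \<Rightarrow> 'a \<Rightarrow> 'a"
  where "transition c c' \<equiv> (\<lambda>z. cmap c' (cinv c z))"

text \<open>\<open>A\<close> need not be a maximal atlas; it determines a smooth structure on \<open>X\<close> of dimension
  \<open>DIM('a)\<close>.\<close>

definition smooth_manifold :: "'m topology \<Rightarrow> ('m, 'a::euclidean_space) chart set \<Rightarrow> bool"
  where "smooth_manifold X A \<longleftrightarrow>
    Hausdorff_space X \<and> second_countable X \<and>
    (\<forall>c\<in>A. openin X (cdom c) \<and> open (cimg c) \<and>
       homeomorphic_map (subtopology X (cdom c)) (top_of_set (cimg c)) (cmap c)) \<and>
    (\<Union>c\<in>A. cdom c) = topspace X \<and>
    (\<forall>c\<in>A. \<forall>c'\<in>A. smooth_on (overlap c c') (transition c c'))"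

text \<open>Time-dependent tensor fields are given by their components in every chart of the atlas,
  subject to the transformation law.  For a family of metrics, \<open>g d t z u v\<close> is the product at
  time \<open>t\<close> of the coordinate vectors \<open>u\<close>, \<open>v\<close> at the point with coordinates \<open>z\<close> in the
  chart \<open>d\<close>.\<close>

definition smooth_metric_family ::
    "('p, 'b::euclidean_space) chart set \<Rightarrow> real set
      \<Rightarrow> (('p, 'b) chart \<Rightarrow> real \<Rightarrow> 'b \<Rightarrow> 'b \<Rightarrow> 'b \<Rightarrow> real) \<Rightarrow> bool"
  where "smooth_metric_family B I g \<longleftrightarrow>
    (\<forall>d\<in>B. \<forall>t\<in>I. \<forall>z\<in>cimg d. inner_form (g d t z)) \<and>
    (\<forall>d\<in>B. \<forall>u v. smooth_on (cimg d \<times> I) (\<lambda>(z, t). g d t z u v)) \<and>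
    (\<forall>d\<in>B. \<forall>d'\<in>B. \<forall>t\<in>I. \<forall>z\<in>overlap d d'. \<forall>u v.
       g d t z u v = g d' t (transition d d' z)
                       (pd (overlap d d') (transition d d') z u)
                       (pd (overlap d d') (transition d d') z v))"


section \<open>Families of immersions\<close>

definition local_dom ::
    "real set \<Rightarrow> ('m \<Rightarrow> real \<Rightarrow> 'p) \<Rightarrow> ('m, 'a) chart \<Rightarrow> ('p, 'b) chart \<Rightarrow> ('a \<times> real) set"
  where "local_dom I F c d = {(x, t). x \<in> cimg c \<and> t \<in> I \<and> F (cinv c x) t \<in> cdom d}"

definition local_map ::
    "('m \<Rightarrow> real \<Rightarrow> 'p) \<Rightarrow> ('m, 'a) chart \<Rightarrow> ('p, 'b) chart \<Rightarrow> real \<Rightarrow> 'a \<Rightarrow> 'b"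
  where "local_map F c d t x = cmap d (F (cinv c x) t)"

definition slice_dom ::
    "real set \<Rightarrow> ('m \<Rightarrow> real \<Rightarrow> 'p) \<Rightarrow> ('m, 'a) chart \<Rightarrow> ('p, 'b) chart \<Rightarrow> real \<Rightarrow> 'a set"
  where "slice_dom I F c d t = {x. (x, t) \<in> local_dom I F c d}"

definition smooth_immersion_family ::
    "'m topology \<Rightarrow> ('m, 'a::euclidean_space) chart set \<Rightarrow>
     'p topology \<Rightarrow> ('p, 'b::euclidean_space) chart set \<Rightarrow> real set
      \<Rightarrow> ('m \<Rightarrow> real \<Rightarrow> 'p) \<Rightarrow> bool"
  where "smooth_immersion_family X A Y B I F \<longleftrightarrow>
    continuous_map (prod_topology X (top_of_set I)) Y (\<lambda>(p, t). F p t) \<and>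
    (\<forall>c\<in>A. \<forall>d\<in>B. smooth_on (local_dom I F c d) (\<lambda>(x, t). local_map F c d t x)) \<and>
    (\<forall>c\<in>A. \<forall>d\<in>B. \<forall>(x, t)\<in>local_dom I F c d.
       inj (pd (slice_dom I F c d t) (local_map F c d t) x))"

text \<open>\<open>nu d p t\<close> are the components in the chart \<open>d\<close> of a vector at the point \<open>F p t\<close>.\<close>

definition smooth_unit_normal ::
    "('m, 'a::euclidean_space) chart set \<Rightarrow> ('p, 'b::euclidean_space) chart set \<Rightarrow> real set
      \<Rightarrow> (('p, 'b) chart \<Rightarrow> real \<Rightarrow> 'b \<Rightarrow> 'b \<Rightarrow> 'b \<Rightarrow> real) \<Rightarrow> ('m \<Rightarrow> real \<Rightarrow> 'p)
      \<Rightarrow> (('p, 'b) chart \<Rightarrow> 'm \<Rightarrow> real \<Rightarrow> 'b) \<Rightarrow> bool"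
  where "smooth_unit_normal A B I g F nu \<longleftrightarrow>
    (\<forall>c\<in>A. \<forall>d\<in>B. smooth_on (local_dom I F c d) (\<lambda>(x, t). nu d (cinv c x) t)) \<and>
    (\<forall>c\<in>A. \<forall>d\<in>B. \<forall>d'\<in>B. \<forall>(x, t)\<in>local_dom I F c d \<inter> local_dom I F c d'.
       nu d' (cinv c x) t =
         pd (overlap d d') (transition d d') (local_map F c d t x) (nu d (cinv c x) t)) \<and>
    (\<forall>c\<in>A. \<forall>d\<in>B. \<forall>(x, t)\<in>local_dom I F c d.
       is_unit_normal (slice_dom I F c d t) (local_map F c d t) (g d t) x (nu d (cinv c x) t))"

text \<open>The second fundamental form and the mean curvature of \<open>M\<^sub>t\<close> in the background \<open>g(t)\<close>.\<close>

definition slice_sff ::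
    "real set \<Rightarrow> (('p, 'b::euclidean_space) chart \<Rightarrow> real \<Rightarrow> 'b \<Rightarrow> 'b \<Rightarrow> 'b \<Rightarrow> real)
      \<Rightarrow> ('m \<Rightarrow> real \<Rightarrow> 'p) \<Rightarrow> (('p, 'b) chart \<Rightarrow> 'm \<Rightarrow> real \<Rightarrow> 'b)
      \<Rightarrow> ('m, 'a::euclidean_space) chart \<Rightarrow> ('p, 'b) chart \<Rightarrow> real \<Rightarrow> 'a \<Rightarrow> 'a \<Rightarrow> 'a \<Rightarrow> real"
  where "slice_sff I g F nu c d t x =
    second_ff (slice_dom I F c d t) (local_map F c d t) (cimg d) (g d t) (nu d (cinv c x) t) x"

definition slice_mean_curv ::
    "real set \<Rightarrow> (('p, 'b::euclidean_space) chart \<Rightarrow> real \<Rightarrow> 'b \<Rightarrow> 'b \<Rightarrow> 'b \<Rightarrow> real)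
      \<Rightarrow> ('m \<Rightarrow> real \<Rightarrow> 'p) \<Rightarrow> (('p, 'b) chart \<Rightarrow> 'm \<Rightarrow> real \<Rightarrow> 'b)
      \<Rightarrow> ('m, 'a::euclidean_space) chart \<Rightarrow> ('p, 'b) chart \<Rightarrow> real \<Rightarrow> 'a \<Rightarrow> real"
  where "slice_mean_curv I g F nu c d t x =
    mean_curv (slice_dom I F c d t) (local_map F c d t) (cimg d) (g d t) (nu d (cinv c x) t) x"

definition mean_curvature_flow ::
    "('m, 'a::euclidean_space) chart set \<Rightarrow> ('p, 'b::euclidean_space) chart set \<Rightarrow> real set
      \<Rightarrow> (('p, 'b) chart \<Rightarrow> real \<Rightarrow> 'b \<Rightarrow> 'b \<Rightarrow> 'b \<Rightarrow> real) \<Rightarrow> ('m \<Rightarrow> real \<Rightarrow> 'p)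
      \<Rightarrow> (('p, 'b) chart \<Rightarrow> 'm \<Rightarrow> real \<Rightarrow> 'b) \<Rightarrow> bool"
  where "mean_curvature_flow A B I g F nu \<longleftrightarrow>
    (\<forall>c\<in>A. \<forall>d\<in>B. \<forall>(x, t)\<in>local_dom I F c d.
       ((\<lambda>s. local_map F c d s x) has_vector_derivative
          - (slice_mean_curv I g F nu c d t x *\<^sub>R nu d (cinv c x) t)) (at t within I))"

definition backwards_ricci_flow ::
    "('p, 'b::euclidean_space) chart set \<Rightarrow> real set
      \<Rightarrow> (('p, 'b) chart \<Rightarrow> real \<Rightarrow> 'b \<Rightarrow> 'b \<Rightarrow> 'b \<Rightarrow> real) \<Rightarrow> bool"
  where "backwards_ricci_flow B I g \<longleftrightarrow>
    (\<forall>d\<in>B. \<forall>t\<in>I. \<forall>z\<in>cimg d. \<forall>u v.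
       ((\<lambda>s. g d s z u v) has_real_derivative 2 * ricci (cimg d) (g d t) z u v) (at t within I))"

text \<open>Uniform bounds on the norms of the tensors \<open>Rm\<close> and \<open>h\<close> as multilinear forms; the
  constants of comparison with any other tensor norm depend on the dimension only.\<close>

definition bounded_curvature ::
    "('p, 'b::euclidean_space) chart set \<Rightarrow> real set
      \<Rightarrow> (('p, 'b) chart \<Rightarrow> real \<Rightarrow> 'b \<Rightarrow> 'b \<Rightarrow> 'b \<Rightarrow> real) \<Rightarrow> bool"
  where "bounded_curvature B I g \<longleftrightarrow>
    (\<exists>C. \<forall>d\<in>B. \<forall>t\<in>I. \<forall>z\<in>cimg d. \<forall>u v w y.
       \<bar>g d t z (riemann (cimg d) (g d t) z u v w) y\<bar> \<le>
         C * sqrt (g d t z u u) * sqrt (g d t z v v) * sqrt (g d t z w w) * sqrt (g d t z y y))"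

definition bounded_second_ff ::
    "('m, 'a::euclidean_space) chart set \<Rightarrow> ('p, 'b::euclidean_space) chart set \<Rightarrow> real set
      \<Rightarrow> (('p, 'b) chart \<Rightarrow> real \<Rightarrow> 'b \<Rightarrow> 'b \<Rightarrow> 'b \<Rightarrow> real) \<Rightarrow> ('m \<Rightarrow> real \<Rightarrow> 'p)
      \<Rightarrow> (('p, 'b) chart \<Rightarrow> 'm \<Rightarrow> real \<Rightarrow> 'b) \<Rightarrow> bool"
  where "bounded_second_ff A B I g F nu \<longleftrightarrow>
    (\<exists>C. \<forall>c\<in>A. \<forall>d\<in>B. \<forall>(x, t)\<in>local_dom I F c d. \<forall>u v.
       (let q = induced_metric (slice_dom I F c d t) (local_map F c d t) (g d t) x
        in \<bar>slice_sff I g F nu c d t x u v\<bar> \<le> C * sqrt (q u u) * sqrt (q v v)))"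


section \<open>The space-time track\<close>

text \<open>The space-time metric with parameter \<open>N\<close> on the coordinate domain \<open>cimg d \<times> I\<close>; here
  \<open>DIM('b)\<close> is the dimension \<open>n + 1\<close> of the background manifold.\<close>

definition st_metric ::
    "(('p, 'b::euclidean_space) chart \<Rightarrow> real \<Rightarrow> 'b \<Rightarrow> 'b \<Rightarrow> 'b \<Rightarrow> real) \<Rightarrow> real
      \<Rightarrow> ('p, 'b) chart \<Rightarrow> 'b \<times> real \<Rightarrow> 'b \<times> real \<Rightarrow> 'b \<times> real \<Rightarrow> real"
  where "st_metric g N d = (\<lambda>(z, t) (u, a) (v, b).
    g d t z u v / t
    + (N / (2 * t ^ 3) + scalar_curv (cimg d) (g d t) z / t - real DIM('b) / (2 * t ^ 2)) * (a * b))"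

definition st_potential :: "real \<Rightarrow> 'b \<times> real \<Rightarrow> real"
  where "st_potential N = (\<lambda>(z, t). N / (2 * t))"

definition track ::
    "('m \<Rightarrow> real \<Rightarrow> 'p) \<Rightarrow> ('m, 'a) chart \<Rightarrow> ('p, 'b) chart \<Rightarrow> 'a \<times> real \<Rightarrow> 'b \<times> real"
  where "track F c d = (\<lambda>(x, t). (local_map F c d t x, t))"

text \<open>The unit normal of the track on the side of \<open>nu\<close>; it exists and is unique whenever
  \<open>st_metric g N d\<close> is positive definite.\<close>

definition track_normal ::
    "real set \<Rightarrow> (('p, 'b::euclidean_space) chart \<Rightarrow> real \<Rightarrow> 'b \<Rightarrow> 'b \<Rightarrow> 'b \<Rightarrow> real)
      \<Rightarrow> ('m \<Rightarrow> real \<Rightarrow> 'p) \<Rightarrow> (('p, 'b) chart \<Rightarrow> 'm \<Rightarrow> real \<Rightarrow> 'b) \<Rightarrow> real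
      \<Rightarrow> ('m, 'a::euclidean_space) chart \<Rightarrow> ('p, 'b) chart \<Rightarrow> 'a \<times> real \<Rightarrow> 'b \<times> real"
  where "track_normal I g F nu N c d = (\<lambda>(x, t).
    (THE w. is_unit_normal (local_dom I F c d) (track F c d) (st_metric g N d) (x, t) w \<and>
            st_metric g N d (track F c d (x, t)) w (nu d (cinv c x) t, 0) > 0))"

definition track_mean_curv ::
    "real set \<Rightarrow> (('p, 'b::euclidean_space) chart \<Rightarrow> real \<Rightarrow> 'b \<Rightarrow> 'b \<Rightarrow> 'b \<Rightarrow> real)
      \<Rightarrow> ('m \<Rightarrow> real \<Rightarrow> 'p) \<Rightarrow> (('p, 'b) chart \<Rightarrow> 'm \<Rightarrow> real \<Rightarrow> 'b) \<Rightarrow> real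
      \<Rightarrow> ('m, 'a::euclidean_space) chart \<Rightarrow> ('p, 'b) chart \<Rightarrow> 'a \<times> real \<Rightarrow> real"
  where "track_mean_curv I g F nu N c d q =
    mean_curv (local_dom I F c d) (track F c d) (cimg d \<times> I) (st_metric g N d)
      (track_normal I g F nu N c d q) q"

definition soliton_defect ::
    "real set \<Rightarrow> (('p, 'b::euclidean_space) chart \<Rightarrow> real \<Rightarrow> 'b \<Rightarrow> 'b \<Rightarrow> 'b \<Rightarrow> real)
      \<Rightarrow> ('m \<Rightarrow> real \<Rightarrow> 'p) \<Rightarrow> (('p, 'b) chart \<Rightarrow> 'm \<Rightarrow> real \<Rightarrow> 'b) \<Rightarrow> real
      \<Rightarrow> ('m, 'a::euclidean_space) chart \<Rightarrow> ('p, 'b) chart \<Rightarrow> 'a \<times> real \<Rightarrow> real"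
  where "soliton_defect I g F nu N c d q =
    track_mean_curv I g F nu N c d q
    + pd (cimg d \<times> I) (st_potential N) (track F c d q) (track_normal I g F nu N c d q)"

end

theory Submission
  imports Defs
begin

text \<open>
  Let \<open>G\<close> be the space-time metric.  In coordinates the tangent space of the track splits
  \<open>G\<close>-orthogonally into the vectors
  \<open>(dF e, 0)\<close> and \<open>V = (-H\<nu>, 1)\<close>, and its normal is \<open>(\<alpha>\<nu>, \<beta>)\<close> with \<open>\<alpha>\<^sup>2 = \<tau> / (1 + H\<^sup>2/(\<tau>\<Phi>))\<close>
  and \<open>\<beta> = H\<alpha>/(\<tau>\<Phi>)\<close>, where \<open>\<Phi> \<sim> N/(2\<tau>\<^sup>3)\<close> is the time component of \<open>G\<close>.  The spatial
  directions contribute \<open>\<alpha>H + O(1/N)\<close> to the mean curvature, the potential contributes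
  \<open>-\<alpha>H + O(1/N)\<close>, and the second fundamental form of \<open>V\<close> is bounded while \<open>G(V, V)\<close> is of
  order \<open>N\<close>.

  To obtain bounds that hold in all charts at once, the defect is written as an explicit function of
  \<open>N\<close>, \<open>\<tau>\<close>, \<open>H\<close>, \<open>\<partial>\<^sub>\<tau>H\<close>, \<open>Ric(\<nu>, \<nu>)\<close>, \<open>R\<close>, \<open>\<partial>\<^sub>\<nu>R\<close> and \<open>\<partial>\<^sub>\<tau>R\<close>.  These are continuous, and they are
  independent of the charts for cheap reasons: \<open>H\<close> can be read off the flow equation of \<open>F\<close>, and
  \<open>Ric\<close> is half the time derivative of \<open>g\<close>, so no transformation law of Christoffel symbols is
  needed.
\<close>

section \<open>Derivatives within domains with unique derivatives\<close>

text \<open>Why the two leading terms cancel: orthogonality of the normal to V forces \<Phi>\<beta>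
  = H\<alpha>/\<tau>, so \<beta> is O(1/N) and the potential contributes -\<beta>N/(2\<tau>^2) =
  -\<alpha>H (N/(2\<tau>^3)) / \<Phi>. Since \<Phi> differs from N/(2\<tau>^3) only by R/\<tau> -
  (n+1)/(2\<tau>^2), which is free of N, the last quotient is 1 + O(1/N). The time derivative of
  \<Phi> is itself of order N, but it enters multiplied by \<beta> and divided by G(V, V). The
  obstacle is uniformity over charts: a point of the compact set may lie in infinitely many charts,
  and a bound found in one of them says nothing about the coordinate expression of the defect in
  another. Each argument of the explicit function is therefore shown to be continuous in every pair
  of charts and to agree between any two pairs. Reading Ric as a time derivative also yields its
  bilinearity and smoothness. This makes R differentiable, as it must be because R is part of the
  space-time metric.\<close>

definition udom :: "'a::euclidean_space set \<Rightarrow> bool"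
  where "udom S \<longleftrightarrow> (\<forall>x\<in>S. \<forall>b\<in>Basis. \<forall>e>0. \<exists>h. 0 < \<bar>h\<bar> \<and> \<bar>h\<bar> < e \<and> x + h *\<^sub>R b \<in> S)"

text \<open>\<open>pd\<close> is a chosen derivative, so every computation with it rests on
  uniqueness. \<open>udom\<close> is what the uniqueness theorem asks for: nearby points of the set
  along each coordinate axis, on at least one side, which also covers the final time.\<close>

lemma pd_unique:
  assumes "udom S" "x \<in> S" "(f has_derivative f') (at x within S)"
  shows "pd S f x = f'"
proof -
  have "(f has_derivative frechet_derivative f (at x within S)) (at x within S)"
    using assms(3) frechet_derivative_works differentiableI by blast
  then have "frechet_derivative f (at x within S) = f'"
    using assms frechet_derivative_unique_within[of f _ x S f'] unfolding udom_def by blast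
  then show ?thesis by (simp add: pd_def fun_eq_iff)
qed

lemma pd_eta: "pd S f x = frechet_derivative f (at x within S)"
  by (simp add: pd_def fun_eq_iff)

lemma pd_works:
  assumes "f differentiable_on S" "x \<in> S"
  shows "(f has_derivative pd S f x) (at x within S)"
  using assms by (simp add: pd_eta differentiable_on_def frechet_derivative_works)

lemma pd_cong:
  assumes "x \<in> S" "\<And>y. y \<in> S \<Longrightarrow> f y = g y"
  shows "pd S f x = pd S g x"
proof -
  have "(f has_derivative f') (at x within S) \<longleftrightarrow> (g has_derivative f') (at x within S)" for f'
    by (metis assms has_derivative_transform)
  then show ?thesis by (simp add: pd_eta frechet_derivative_def)
qed

section \<open>Closure properties of \<open>Ck_on\<close>\<close>

lemma Ck_on_cong:
  assumes "\<And>y. y \<in> S \<Longrightarrow> f y = g y"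
  shows "Ck_on k S f \<longleftrightarrow> Ck_on k S g"
  using assms
proof (induction k arbitrary: f g)
  case 0 then show ?case by (simp cong: continuous_on_cong)
next
  case (Suc k)
  have "f differentiable_on S \<longleftrightarrow> g differentiable_on S"
    using Suc.prems unfolding differentiable_on_def differentiable_def
    by (metis has_derivative_transform)
  moreover have "Ck_on k S (\<lambda>x. pd S f x v) \<longleftrightarrow> Ck_on k S (\<lambda>x. pd S g x v)" for v
    by (rule Suc.IH) (metis Suc.prems pd_cong)
  ultimately show ?case by simp
qed

lemma Ck_on_Suc_imp: "Ck_on (Suc k) S f \<Longrightarrow> Ck_on k S f"
proof (induction k arbitrary: f)
  case 0 then show ?case by (simp add: differentiable_imp_continuous_on)
next
  case (Suc k)
  then have "f differentiable_on S" "Ck_on (Suc k) S (\<lambda>x. pd S f x v)" for v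
    using Ck_on.simps(2) by blast+
  then show ?case using Suc.IH by (subst Ck_on.simps(2)) blast
qed

lemma Ck_on_const: "udom S \<Longrightarrow> Ck_on k S (\<lambda>x. c)"
proof (induction k arbitrary: c)
  case (Suc k)
  have "pd S (\<lambda>x. c) x v = 0" if "x \<in> S" for x v
    using pd_unique[OF \<open>udom S\<close> that, of "\<lambda>x. c" "\<lambda>x. 0"] by simp
  then have "Ck_on k S (\<lambda>x. pd S (\<lambda>x. c) x v)" for v
    using Ck_on_cong[of S "\<lambda>x. pd S (\<lambda>x. c) x v" "\<lambda>x. 0" k] Suc by simp
  then show ?case by simp
qed simp

lemma Ck_on_add:
  "udom S \<Longrightarrow> Ck_on k S f \<Longrightarrow> Ck_on k S g \<Longrightarrow> Ck_on k S (\<lambda>x. f x + g x)"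
proof (induction k arbitrary: f g)
  case 0 then show ?case by (simp add: continuous_on_add)
next
  case (Suc k)
  then have d: "f differentiable_on S" "g differentiable_on S" by auto
  have "Ck_on k S (\<lambda>x. pd S (\<lambda>x. f x + g x) x v)" for v
  proof (subst Ck_on_cong)
    fix y assume "y \<in> S"
    then show "pd S (\<lambda>x. f x + g x) y v = pd S f y v + pd S g y v"
      using pd_unique[OF \<open>udom S\<close> \<open>y \<in> S\<close>
          has_derivative_add[OF pd_works[OF d(1) \<open>y \<in> S\<close>] pd_works[OF d(2) \<open>y \<in> S\<close>]]] by simp
  qed (use Suc in auto)
  then show ?case using d by (simp add: differentiable_on_def)
qed

lemma Ck_on_sum:
  assumes "udom S" "\<And>i. i \<in> J \<Longrightarrow> Ck_on k S (f i)"
  shows "Ck_on k S (\<lambda>x. \<Sum>i\<in>J. f i x)"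
  using assms(2)
proof (induction J rule: infinite_finite_induct)
  case (insert i J)
  then have "Ck_on k S (\<lambda>x. f i x + (\<Sum>i\<in>J. f i x))" by (intro Ck_on_add assms(1)) auto
  with insert show ?case by simp
qed (auto simp: Ck_on_const assms)

lemma Ck_on_mult:
  fixes f g :: "'a::euclidean_space \<Rightarrow> real"
  shows "udom S \<Longrightarrow> Ck_on k S f \<Longrightarrow> Ck_on k S g \<Longrightarrow> Ck_on k S (\<lambda>x. f x * g x)"
proof (induction k arbitrary: f g)
  case 0 then show ?case by (simp add: continuous_on_mult)
next
  case (Suc k)
  then have d: "f differentiable_on S" "g differentiable_on S" by auto
  have "Ck_on k S (\<lambda>x. pd S (\<lambda>x. f x * g x) x v)" for v
  proof (subst Ck_on_cong)
    fix y assume "y \<in> S"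
    then show "pd S (\<lambda>x. f x * g x) y v = f y * pd S g y v + pd S f y v * g y"
      using pd_unique[OF \<open>udom S\<close> \<open>y \<in> S\<close>
          has_derivative_mult[OF pd_works[OF d(1) \<open>y \<in> S\<close>] pd_works[OF d(2) \<open>y \<in> S\<close>]]] by simp
  next
    show "Ck_on k S (\<lambda>y. f y * pd S g y v + pd S f y v * g y)"
      using Suc.prems Ck_on_Suc_imp[OF Suc.prems(2)] Ck_on_Suc_imp[OF Suc.prems(3)]
      by (intro Ck_on_add Suc.IH) auto
  qed
  then show ?case using d by (simp add: differentiable_on_def)
qed

lemma Ck_on_prod:
  fixes f :: "'i \<Rightarrow> 'a::euclidean_space \<Rightarrow> real"
  assumes "udom S" "\<And>i. i \<in> J \<Longrightarrow> Ck_on k S (f i)"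
  shows "Ck_on k S (\<lambda>x. \<Prod>i\<in>J. f i x)"
  using assms(2)
proof (induction J rule: infinite_finite_induct)
  case (insert i J)
  then have "Ck_on k S (\<lambda>x. f i x * (\<Prod>i\<in>J. f i x))" by (intro Ck_on_mult assms(1)) auto
  with insert show ?case by simp
qed (auto simp: Ck_on_const assms)

text \<open>The derivative of 1/f is a polynomial in 1/f and the derivative of f, so the induction
  closes on the lower regularity of 1/f itself.\<close>

lemma Ck_on_inverse:
  fixes f :: "'a::euclidean_space \<Rightarrow> real"
  shows "udom S \<Longrightarrow> Ck_on k S f \<Longrightarrow> (\<And>x. x \<in> S \<Longrightarrow> f x \<noteq> 0) \<Longrightarrow> Ck_on k S (\<lambda>x. inverse (f x))"
proof (induction k)
  case 0 then show ?case by (simp add: continuous_on_inverse)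
next
  case (Suc k)
  then have d: "f differentiable_on S" by auto
  have hd: "((\<lambda>x. inverse (f x)) has_derivative (\<lambda>h. - (inverse (f y) * pd S f y h * inverse (f y))))
      (at y within S)" if "y \<in> S" for y
    using Deriv.has_derivative_inverse[OF Suc.prems(3)[OF that] pd_works[OF d that]] that by simp
  have inv: "Ck_on k S (\<lambda>x. inverse (f x))" using Suc Ck_on_Suc_imp by blast
  have "Ck_on k S (\<lambda>x. pd S (\<lambda>x. inverse (f x)) x v)" for v
  proof (subst Ck_on_cong)
    fix y assume "y \<in> S"
    then show "pd S (\<lambda>x. inverse (f x)) y v = (- 1) * (inverse (f y) * pd S f y v * inverse (f y))"
      using pd_unique[OF \<open>udom S\<close> \<open>y \<in> S\<close> hd] by simp
  next
    show "Ck_on k S (\<lambda>y. (- 1) * (inverse (f y) * pd S f y v * inverse (f y)))"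
      using Suc inv by (intro Ck_on_mult Ck_on_const) auto
  qed
  then show ?case using hd by (auto simp: differentiable_on_def differentiable_def)
qed

lemma Ck_on_det:
  fixes M :: "'a::euclidean_space \<Rightarrow> real^'n^'n"
  assumes "udom S" "\<And>i j. Ck_on k S (\<lambda>x. M x $ i $ j)"
  shows "Ck_on k S (\<lambda>x. det (M x))"
  unfolding det_def using assms by (intro Ck_on_sum Ck_on_mult Ck_on_const Ck_on_prod)

lemma udom_open:
  assumes "open S" shows "udom S"
  unfolding udom_def
proof (intro ballI allI impI)
  fix x and b :: 'a and e :: real assume "x \<in> S" "b \<in> Basis" "e > 0"
  obtain r where r: "r > 0" "ball x r \<subseteq> S" using assms \<open>x \<in> S\<close> openE by blast
  define h where "h = min r e / 2"
  have "x + h *\<^sub>R b \<in> ball x r" using r \<open>e > 0\<close> \<open>b \<in> Basis\<close> by (simp add: dist_norm h_def)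
  then show "\<exists>h. 0 < \<bar>h\<bar> \<and> \<bar>h\<bar> < e \<and> x + h *\<^sub>R b \<in> S"
    using r \<open>e > 0\<close> by (intro exI[of _ h]) (auto simp: h_def)
qed

section \<open>Domains open up to the final time, their slices and their time lines\<close>

definition relopen :: "real \<Rightarrow> ('a::euclidean_space \<times> real) set \<Rightarrow> bool"
  where "relopen T D \<longleftrightarrow> (\<exists>W. open W \<and> D = W \<inter> UNIV \<times> {0<..T})"

lemma relopen_udom:
  assumes "relopen T D" shows "udom D"
  unfolding udom_def
proof (intro ballI allI impI)
  fix q b :: "'a \<times> real" and e :: real assume q: "q \<in> D" "b \<in> Basis" "e > 0"
  obtain W where W: "open W" "D = W \<inter> UNIV \<times> {0<..T}" using assms relopen_def by blast
  obtain r where r: "r > 0" "ball q r \<subseteq> W" using W q openE by blast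
  have t: "snd q > 0" "snd q \<le> T" using q W by auto
  \<comment> \<open>A negative step goes back in time, which is possible at time \<open>T\<close>
    too; half of \<open>snd q\<close> keeps the time positive.\<close>
  define h where "h = - (min (min r e) (snd q) / 2)"
  have h: "0 < \<bar>h\<bar>" "\<bar>h\<bar> < e" "\<bar>h\<bar> < r" "h < 0" "- h < snd q" using r q t by (auto simp: h_def)
  have "q + h *\<^sub>R b \<in> ball q r" using h q by (simp add: dist_norm)
  moreover have "snd (q + h *\<^sub>R b) \<in> {0<..T}" using h q t by (auto simp: Basis_prod_def)
  ultimately show "\<exists>h. 0 < \<bar>h\<bar> \<and> \<bar>h\<bar> < e \<and> q + h *\<^sub>R b \<in> D"
    using h r W by (intro exI[of _ h]) (auto simp: mem_Times_iff)
qed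

lemma relopen_Times: "open U \<Longrightarrow> relopen T (U \<times> {0<..T})"
  unfolding relopen_def by (intro exI[of _ "U \<times> UNIV"]) (auto simp: open_Times)

lemma open_slice:
  assumes "relopen T D" shows "open {x. (x, t) \<in> D}"
proof -
  obtain W where W: "open W" "D = W \<inter> UNIV \<times> {0<..T}" using assms relopen_def by blast
  have "open ((\<lambda>x. (x, t)) -` W)"
    by (intro open_vimage W continuous_intros)
  moreover have "{x. (x, t) \<in> D} = (if t \<in> {0<..T} then (\<lambda>x. (x, t)) -` W else {})"
    using W by auto
  ultimately show ?thesis by auto
qed

lemma slice_has_derivative:
  assumes "(f has_derivative f') (at (x, t) within D)"
  shows "((\<lambda>y. f (y, t)) has_derivative (\<lambda>u. f' (u, 0))) (at x within {x. (x, t) \<in> D})"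
proof -
  have "((\<lambda>y. (y, t)) has_derivative (\<lambda>u. (u, 0))) (at x within {x. (x, t) \<in> D})"
    by (intro derivative_eq_intros) auto
  from has_derivative_in_compose[OF this has_derivative_subset[OF assms]] show ?thesis
    by auto
qed

text \<open>Bridge between two kinds of derivatives: the hypotheses on the flow differentiate within
  a slice of fixed time, the track within the space-time domain.\<close>

lemma pd_slice:
  assumes "relopen T D" "(x, t) \<in> D" "f differentiable_on D"
  shows "pd {x. (x, t) \<in> D} (\<lambda>y. f (y, t)) x u = pd D f (x, t) (u, 0)"
  using pd_unique[OF udom_open[OF open_slice[OF assms(1)]] _
      slice_has_derivative[OF pd_works[OF assms(3,2)]]] assms(2) by simp

lemma pd_slice_Times:
  fixes T :: real
  assumes "open U" "t \<in> {0<..T}" "x \<in> U" "f differentiable_on U \<times> {0<..T}"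
  shows "pd U (\<lambda>y. f (y, t)) x u = pd (U \<times> {0<..T}) f (x, t) (u, 0)"
proof -
  have "{x. (x, t) \<in> U \<times> {0<..T}} = U" using assms by auto
  moreover have "(x, t) \<in> U \<times> {0<..T}" using assms by auto
  ultimately show ?thesis
    using pd_slice[where T=T and D="U \<times> {0<..T}" and x=x and t=t and f=f and u=u,
        OF relopen_Times[OF assms(1)] _ assms(4)] by simp
qed

lemma Ck_on_slice_Times:
  fixes T :: real
  assumes "open U" "t \<in> {0<..T}"
  shows "Ck_on k (U \<times> {0<..T}) f \<Longrightarrow> Ck_on k U (\<lambda>x. f (x, t))"
proof (induction k arbitrary: f)
  case 0
  have "continuous_on U (\<lambda>x. (x, t))" by (intro continuous_intros)
  then show ?case using continuous_on_compose2[of _ f U "\<lambda>x. (x, t)"] 0 assms(2) by fastforce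
next
  case (Suc k)
  then have d: "f differentiable_on U \<times> {0<..T}" by simp
  have "{x. (x, t) \<in> U \<times> {0<..T}} = U" using assms by auto
  then have "(\<lambda>x. f (x, t)) differentiable_on U"
    using slice_has_derivative[OF pd_works[OF d]] assms(2)
    by (force simp: differentiable_on_def differentiable_def)
  moreover have "Ck_on k U (\<lambda>x. pd U (\<lambda>x. f (x, t)) x v)" for v
  proof (subst Ck_on_cong)
    show "pd U (\<lambda>x. f (x, t)) y v = pd (U \<times> {0<..T}) f (y, t) (v, 0)" if "y \<in> U" for y
      using pd_slice_Times[OF assms that d] .
    have "Ck_on k (U \<times> {0<..T}) (\<lambda>q. pd (U \<times> {0<..T}) f q (v, 0))" using Suc.prems by simp
    from Suc.IH[OF this] show "Ck_on k U (\<lambda>y. pd (U \<times> {0<..T}) f (y, t) (v, 0))" .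
  qed
  ultimately show ?case by simp
qed

lemma relopen_line:
  assumes "relopen T D" "(x, t) \<in> D"
  obtains e where "e > 0" "\<And>s. s \<in> {0<..T} \<Longrightarrow> \<bar>s - t\<bar> < e \<Longrightarrow> (x, s) \<in> D"
proof -
  obtain W where W: "open W" "D = W \<inter> UNIV \<times> {0<..T}" using assms relopen_def by blast
  obtain e where e: "e > 0" "ball (x, t) e \<subseteq> W" using W assms openE by blast
  have "(x, s) \<in> D" if "s \<in> {0<..T}" "\<bar>s - t\<bar> < e" for s
    using that e W by (auto simp: dist_Pair_Pair dist_real_def abs_minus_commute subset_iff)
  with e that show ?thesis by blast
qed

lemma line_has_derivative:
  assumes D: "relopen T D" "(x, t) \<in> D" and f: "(f has_derivative f') (at (x, t) within D)"
  shows "((\<lambda>s. f (x, s)) has_vector_derivative f' (0, 1)) (at t within {0<..T})"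
proof -
  obtain e where e: "e > 0" "\<And>s. s \<in> {0<..T} \<Longrightarrow> \<bar>s - t\<bar> < e \<Longrightarrow> (x, s) \<in> D"
    using relopen_line[OF D] by metis
  let ?S = "{0<..T} \<inter> ball t e"
  have 1: "((\<lambda>s. (x, s)) has_derivative (\<lambda>h. (0, h))) (at t within ?S)"
    by (intro derivative_eq_intros) auto
  have "(f has_derivative f') (at (x, t) within (\<lambda>s. (x, s)) ` ?S)"
    by (rule has_derivative_subset[OF f]) (use e in \<open>auto simp: dist_real_def abs_minus_commute\<close>)
  then have D: "((\<lambda>s. f (x, s)) has_derivative (\<lambda>h. f' (0, h))) (at t within ?S)"
    by (rule has_derivative_in_compose[OF 1])
  have nhd: "at t within ?S = at t within {0<..T}"
    by (rule at_within_nhd[of t "ball t e"]) (use e(1) in simp, simp, blast)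
  have "((\<lambda>s. f (x, s)) has_derivative (\<lambda>h. h *\<^sub>R f' (0, 1))) (at t within {0<..T})"
  proof (rule has_derivative_eq_rhs[OF D[unfolded nhd]], rule ext)
    show "f' (0, h) = h *\<^sub>R f' (0, 1)" for h
      using linear_scale[OF has_derivative_linear[OF f], of h "(0,1)"] by simp
  qed
  then show ?thesis unfolding has_vector_derivative_def .
qed

lemma time_derivative_unique:
  assumes "t \<in> {0<..T::real}" "(f has_vector_derivative a) (at t within {0<..T})"
    "(f has_vector_derivative b) (at t within {0<..T})"
  shows "a = b"
proof (rule vector_derivative_unique_within[OF _ assms(2,3)])
  \<comment> \<open>Approach from the past is available at every time, including
    \<open>T\<close>.\<close>
  have "{0<..<t} \<subseteq> {0<..T}" using assms by auto
  moreover have "t islimpt {0<..<t}" using assms by (simp add: islimpt_greaterThanLessThan2)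
  ultimately show "at t within {0<..T} \<noteq> bot"
    by (metis islimpt_subset trivial_limit_within)
qed

section \<open>Traces and orthonormal sets\<close>

definition orthonormal :: "('a::euclidean_space \<Rightarrow> 'a \<Rightarrow> real) \<Rightarrow> 'a set \<Rightarrow> bool"
  where "orthonormal g S \<longleftrightarrow> finite S \<and> (\<forall>u\<in>S. \<forall>v\<in>S. g u v = (if u = v then 1 else 0))"

lemma inner_formD:
  assumes "inner_form g"
  shows "bilinear g" "g u v = g v u" "u \<noteq> 0 \<Longrightarrow> g u u > 0"
  using assms unfolding inner_form_def by blast+

lemma inner_form_zero: "inner_form g \<Longrightarrow> g u u = 0 \<Longrightarrow> u = 0"
  using inner_formD(3) by fastforce

lemma bilinear_sum_left: "bilinear g \<Longrightarrow> g (\<Sum>s\<in>S. c s *\<^sub>R f s) v = (\<Sum>s\<in>S. c s * g (f s) v)"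
  using linear_sum[of "\<lambda>x. g x v" "\<lambda>s. c s *\<^sub>R f s"] by (simp add: bilinear_def linear_scale[of "\<lambda>x. g x v"])

lemma bilinear_sum_right: "bilinear g \<Longrightarrow> g v (\<Sum>s\<in>S. c s *\<^sub>R f s) = (\<Sum>s\<in>S. c s * g v (f s))"
  unfolding bilinear_def by (simp add: linear_sum linear_scale)

lemma orthonormal_sum:
  assumes "bilinear g" "orthonormal g S" "w \<in> S"
  shows "g (\<Sum>s\<in>S. c s *\<^sub>R s) w = c w"
proof -
  have "g (\<Sum>s\<in>S. c s *\<^sub>R s) w = (\<Sum>s\<in>S. c s * (if s = w then 1 else 0))"
    unfolding bilinear_sum_left[OF assms(1), where f="\<lambda>s. s"]
    using assms by (intro sum.cong) (auto simp: orthonormal_def)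
  also have "\<dots> = c w" using assms by (simp add: orthonormal_def if_distrib cong: if_cong)
  finally show ?thesis .
qed

lemma orthonormal_independent:
  assumes "bilinear g" "orthonormal g S"
  shows "independent S"
proof
  assume "dependent S"
  then obtain c v where "v \<in> S" "c v \<noteq> 0" "(\<Sum>s\<in>S. c s *\<^sub>R s) = 0"
    using assms by (auto simp: dependent_finite orthonormal_def)
  then show False using orthonormal_sum[OF assms, of v c] bilinear_lzero[OF assms(1)] by simp
qed

lemma orthonormal_extend:
  assumes g: "inner_form g" and S: "orthonormal g S" and y: "y \<noteq> 0" "\<And>s. s \<in> S \<Longrightarrow> g y s = 0"
  obtains x where "x \<notin> S" "orthonormal g (insert x S)"
proof
  define x where "x = (1 / sqrt (g y y)) *\<^sub>R y"
  note b = inner_formD(1)[OF g]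
  have p: "g y y > 0" using inner_formD(3)[OF g] y by blast
  have "g x x = (1 / sqrt (g y y)) * (1 / sqrt (g y y)) * g y y"
    by (simp add: x_def bilinear_lmul[OF b] bilinear_rmul[OF b])
  also have "\<dots> = 1" using p by (simp add: field_simps)
  finally have xx: "g x x = 1" .
  have xs: "g x s = 0" "g s x = 0" if "s \<in> S" for s
  proof -
    show "g x s = 0" using y(2) that by (simp add: x_def bilinear_lmul[OF b])
    then show "g s x = 0" using inner_formD(2)[OF g] by simp
  qed
  show "x \<notin> S" using xx xs by force
  then show "orthonormal g (insert x S)" using S xx xs by (auto simp: orthonormal_def)
qed

lemma orthonormal_remainder:
  assumes "inner_form g" "orthonormal g S" "s \<in> S"
  shows "g (v - (\<Sum>s\<in>S. g v s *\<^sub>R s)) s = 0"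
  using orthonormal_sum[OF inner_formD(1) assms(2,3)] assms(1)
  by (simp add: bilinear_lsub inner_formD(1))

text \<open>A nonzero remainder, normalised, would enlarge \<open>S\<close> to an independent set
  with more elements than the dimension.\<close>

lemma orthonormal_expand:
  fixes g :: "'a::euclidean_space \<Rightarrow> 'a \<Rightarrow> real"
  assumes g: "inner_form g" and S: "orthonormal g S" "card S = DIM('a)"
  shows "(\<Sum>s\<in>S. g v s *\<^sub>R s) = v"
proof (rule ccontr)
  assume "(\<Sum>s\<in>S. g v s *\<^sub>R s) \<noteq> v"
  then have "v - (\<Sum>s\<in>S. g v s *\<^sub>R s) \<noteq> 0" by simp
  from orthonormal_extend[OF g S(1) this orthonormal_remainder[OF g S(1)]]
  obtain x where x: "x \<notin> S" "orthonormal g (insert x S)" .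
  then have "card (insert x S) \<le> DIM('a)"
    using orthonormal_independent[OF inner_formD(1)[OF g]] independent_bound by blast
  then show False using x S by (simp add: orthonormal_def)
qed

lemma orthonormal_exists:
  fixes g :: "'a::euclidean_space \<Rightarrow> 'a \<Rightarrow> real"
  assumes g: "inner_form g"
  obtains S where "orthonormal g S" "card S = DIM('a)"
proof -
  have "m \<le> DIM('a) \<Longrightarrow> \<exists>S. orthonormal g S \<and> card S = m" for m
  proof (induction m)
    case 0 show ?case by (rule exI[of _ "{}"]) (simp add: orthonormal_def)
  next
    case (Suc m)
    then obtain S where S: "orthonormal g S" "card S = m" by auto
    have "span S \<noteq> UNIV"
    proof
      assume "span S = UNIV"
      then have "DIM('a) = dim S" using dim_span[of S] by (simp add: dim_UNIV)
      moreover have "dim S \<le> card S" using S by (intro dim_le_card') (simp add: orthonormal_def)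
      ultimately show False using Suc.prems S by simp
    qed
    then obtain v where v: "v \<notin> span S" by blast
    have "(\<Sum>s\<in>S. g v s *\<^sub>R s) \<in> span S" by (intro span_sum span_scale span_base)
    then have "v - (\<Sum>s\<in>S. g v s *\<^sub>R s) \<noteq> 0" using v by auto
    from orthonormal_extend[OF g S(1) this orthonormal_remainder[OF g S(1)]]
    obtain x where "x \<notin> S" "orthonormal g (insert x S)" .
    then show ?case using S by (intro exI[of _ "insert x S"]) (simp add: orthonormal_def)
  qed
  then show thesis using that by blast
qed

text \<open>\<open>sharp\<close> is a definite description: the expansion of \<open>l\<close> in an
  orthonormal basis supplies the witness, definiteness of \<open>g\<close> its uniqueness.\<close>

lemma sharp_works:
  assumes g: "inner_form g" and l: "linear l"
  shows "g (sharp g l) v = l v"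
proof -
  obtain S where S: "orthonormal g S" "card S = DIM('a)" using orthonormal_exists[OF g] .
  note b = inner_formD(1)[OF g]
  have "g (\<Sum>s\<in>S. l s *\<^sub>R s) v = l v" for v
  proof -
    have "l v = (\<Sum>s\<in>S. g v s * l s)"
      using arg_cong[OF orthonormal_expand[OF g S, of v], of l]
      by (simp add: linear_sum[OF l] linear_scale[OF l])
    then show ?thesis by (simp add: bilinear_sum_left[OF b] inner_formD(2)[OF g, of v] mult.commute)
  qed
  moreover have "w = w'" if "\<forall>v. g w v = l v" "\<forall>v. g w' v = l v" for w w'
    using inner_form_zero[OF g, of "w - w'"] that by (simp add: bilinear_lsub[OF b])
  ultimately have "\<exists>!w. \<forall>v. g w v = l v" by blast
  from theI'[OF this] show ?thesis unfolding sharp_def by blast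
qed

text \<open>Traces are defined with the standard \<open>Basis\<close>, while the geometry supplies
  bases adapted to the hypersurface. Expanding \<open>L b\<close> in \<open>S\<close> and exchanging
  the sums passes from one to the other.\<close>

lemma trace_orthonormal:
  fixes g :: "'a::euclidean_space \<Rightarrow> 'a \<Rightarrow> real"
  assumes g: "inner_form g" and S: "orthonormal g S" "card S = DIM('a)" and L: "linear L"
  shows "(\<Sum>b\<in>Basis. L b \<bullet> b) = (\<Sum>s\<in>S. g (L s) s)"
proof -
  note b = inner_formD(1)[OF g]
  have "(\<Sum>b\<in>Basis. L b \<bullet> b) = (\<Sum>b\<in>Basis. (\<Sum>s\<in>S. g (L b) s *\<^sub>R s) \<bullet> b)"
    by (simp add: orthonormal_expand[OF g S])
  also have "\<dots> = (\<Sum>b\<in>Basis. \<Sum>s\<in>S. (s \<bullet> b) * g (L b) s)"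
    by (simp add: inner_sum_left mult.commute)
  also have "\<dots> = (\<Sum>s\<in>S. \<Sum>b\<in>Basis. (s \<bullet> b) * g (L b) s)" by (rule sum.swap)
  also have "\<dots> = (\<Sum>s\<in>S. g (L (\<Sum>b\<in>Basis. (s \<bullet> b) *\<^sub>R b)) s)"
    by (simp add: linear_sum[OF L] linear_scale[OF L] bilinear_sum_left[OF b])
  finally show ?thesis by (simp add: euclidean_representation)
qed

lemma metric_trace_orthonormal:
  fixes g :: "'a::euclidean_space \<Rightarrow> 'a \<Rightarrow> real"
  assumes g: "inner_form g" and B: "bilinear B" and S: "orthonormal g S" "card S = DIM('a)"
  shows "metric_trace g B = (\<Sum>s\<in>S. B s s)"
proof -
  have B': "linear (B u)" for u using B by (simp add: bilinear_def)
  have "sharp g (B u) = (\<Sum>s\<in>S. B u s *\<^sub>R s)" for u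
    using orthonormal_expand[OF g S, of "sharp g (B u)"] by (simp add: sharp_works[OF g B'])
  moreover have "linear (\<lambda>u. \<Sum>s\<in>S. B u s *\<^sub>R s)"
    by (intro linearI) (simp_all add: bilinear_ladd[OF B] bilinear_lmul[OF B] scaleR_left_distrib
        sum.distrib scaleR_sum_right)
  ultimately have "linear (\<lambda>u. sharp g (B u))" by simp
  then show ?thesis
    using trace_orthonormal[OF g S] by (simp add: metric_trace_def sharp_works[OF g B'])
qed

lemma orthonormal_image:
  assumes "orthonormal g S" "\<And>u v. u \<in> S \<Longrightarrow> v \<in> S \<Longrightarrow> g' (L u) (L v) = g u v"
  shows "orthonormal g' (L ` S)" "inj_on L S"
proof -
  show i: "inj_on L S"
  proof (rule inj_onI)
    fix u v assume "u \<in> S" "v \<in> S" "L u = L v"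
    then have "g u v = g v v" using assms(2) by metis
    then show "u = v" using assms(1) \<open>u \<in> S\<close> \<open>v \<in> S\<close> by (auto simp: orthonormal_def split: if_splits)
  qed
  show "orthonormal g' (L ` S)"
    using assms inj_onD[OF i] by (auto simp: orthonormal_def)
qed

text \<open>\<open>L\<close> carries an orthonormal basis of \<open>g\<close> to one of
  \<open>g'\<close>, injectivity on it being forced by the isometry relation, so both traces are the
  same sum. This serves for changes of charts.\<close>

lemma metric_trace_pullback:
  fixes g g' :: "'a::euclidean_space \<Rightarrow> 'a \<Rightarrow> real"
  assumes g: "inner_form g" "inner_form g'" and B: "bilinear B" "bilinear B'"
    and L: "\<And>u v. g u v = g' (L u) (L v)" "\<And>u v. B u v = B' (L u) (L v)"
  shows "metric_trace g B = metric_trace g' B'"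
proof -
  obtain S where S: "orthonormal g S" "card S = DIM('a)" using orthonormal_exists[OF g(1)] .
  note i = orthonormal_image[OF S(1), of g' L, OF L(1)[symmetric]]
  have "metric_trace g' B' = (\<Sum>s\<in>L ` S. B' s s)"
    using i S by (intro metric_trace_orthonormal g B) (auto simp: card_image)
  also have "\<dots> = (\<Sum>s\<in>S. B s s)" using i by (simp add: sum.reindex L)
  finally show ?thesis using metric_trace_orthonormal[OF g(1) B(1) S] by simp
qed

text \<open>A quotient of determinants replaces the description of \<open>sharp\<close>, so that
  smooth dependence on a parameter can be read off. The system is nonsingular because a kernel
  vector satisfies \<open>g x x = 0\<close>.\<close>

lemma sharp_cramer:
  fixes g :: "real^'k \<Rightarrow> real^'k \<Rightarrow> real"
  assumes g: "inner_form g" and l: "linear l"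
  defines "M \<equiv> (\<chi> i j. g (axis j 1) (axis i 1)) :: real^'k^'k"
  shows "det M \<noteq> 0"
    and "sharp g l $ m = det (\<chi> i j. if j = m then l (axis i 1) else M $ i $ j) / det M"
proof -
  note b = inner_formD(1)[OF g]
  have M: "(M *v x) $ i = g x (axis i 1)" for x i
  proof -
    have "g x (axis i 1) = g (\<Sum>j\<in>UNIV. x $ j *\<^sub>R axis j 1) (axis i 1)"
      by (simp add: basis_expansion scalar_mult_eq_scaleR[symmetric])
    then show ?thesis
      by (simp add: bilinear_sum_left[OF b] M_def matrix_vector_mult_def mult.commute)
  qed
  have "x = 0" if "M *v x = 0" for x
  proof -
    have z: "g x (axis i 1) = 0" for i using that M by (metis zero_index)
    have "g x x = g x (\<Sum>j\<in>UNIV. x $ j *\<^sub>R axis j 1)"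
      by (simp add: basis_expansion scalar_mult_eq_scaleR[symmetric])
    also have "\<dots> = 0" by (simp add: bilinear_sum_right[OF b] z)
    finally show ?thesis using inner_form_zero[OF g] by blast
  qed
  then show d: "det M \<noteq> 0"
    by (metis invertible_det_nz invertible_left_inverse matrix_left_invertible_ker)
  have "M *v sharp g l = (\<chi> i. l (axis i 1))"
    by (simp add: vec_eq_iff M sharp_works[OF g l])
  then show "sharp g l $ m = det (\<chi> i j. if j = m then l (axis i 1) else M $ i $ j) / det M"
    using cramer[OF d, of "sharp g l" "\<chi> i. l (axis i 1)"] by (simp add: vec_eq_iff cong: if_cong)
qed

lemma Ck_on_sharp:
  fixes G :: "'a::euclidean_space \<Rightarrow> real^'k \<Rightarrow> real^'k \<Rightarrow> real"
  assumes S: "udom S" and G: "\<And>y. y \<in> S \<Longrightarrow> inner_form (G y)" "\<And>u v. Ck_on k S (\<lambda>y. G y u v)"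
    and l: "\<And>y. y \<in> S \<Longrightarrow> linear (l y)" "\<And>v. Ck_on k S (\<lambda>y. l y v)"
  shows "Ck_on k S (\<lambda>y. sharp (G y) (l y) $ m)"
proof (subst Ck_on_cong)
  fix y assume "y \<in> S"
  show "sharp (G y) (l y) $ m =
    det (\<chi> i j. if j = m then l y (axis i 1) else G y (axis j 1) (axis i 1))
      * inverse (det (\<chi> i j. G y (axis j 1) (axis i 1)))"
    by (subst sharp_cramer(2)[OF G(1)[OF \<open>y \<in> S\<close>] l(1)[OF \<open>y \<in> S\<close>]])
      (simp add: divide_inverse cong: if_cong)
next
  have "Ck_on k S (\<lambda>y. if j = m then l y (axis i 1) else G y (axis j 1) (axis i 1))" for i j
    using G l by (cases "j = m") auto
  then show "Ck_on k S (\<lambda>y. det (\<chi> i j. if j = m then l y (axis i 1) else G y (axis j 1) (axis i 1))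
      * inverse (det (\<chi> i j. G y (axis j 1) (axis i 1))))"
    using S G sharp_cramer(1)[OF G(1) l(1)]
    by (intro Ck_on_mult Ck_on_inverse Ck_on_det) auto
qed

lemma Ck_on_metric_trace:
  fixes G :: "'a::euclidean_space \<Rightarrow> real^'k \<Rightarrow> real^'k \<Rightarrow> real"
  assumes S: "udom S" and G: "\<And>y. y \<in> S \<Longrightarrow> inner_form (G y)" "\<And>u v. Ck_on k S (\<lambda>y. G y u v)"
    and B: "\<And>y. y \<in> S \<Longrightarrow> bilinear (B y)" "\<And>u v. Ck_on k S (\<lambda>y. B y u v)"
  shows "Ck_on k S (\<lambda>y. metric_trace (G y) (B y))"
proof -
  have "Ck_on k S (\<lambda>y. sharp (G y) (B y b) \<bullet> b)" if b: "b \<in> Basis" for b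
  proof -
    obtain i where "b = axis i 1" using b by (auto simp: Basis_vec_def)
    moreover have "Ck_on k S (\<lambda>y. sharp (G y) (B y b) $ i)"
      using B by (intro Ck_on_sharp S G) (auto simp: bilinear_def)
    ultimately show ?thesis by (simp add: inner_axis)
  qed
  then show ?thesis unfolding metric_trace_def by (intro Ck_on_sum S)
qed

section \<open>Connections and curvature\<close>

definition dmetric :: "'a::euclidean_space set \<Rightarrow> ('a \<Rightarrow> 'a \<Rightarrow> 'a \<Rightarrow> real) \<Rightarrow> bool"
  where "dmetric S G \<longleftrightarrow> udom S \<and> (\<forall>y\<in>S. inner_form (G y)) \<and>
    (\<forall>u v. (\<lambda>y. G y u v) differentiable_on S)"

text \<open>The Christoffel symbols with lowered index. A second fundamental form pairs the
  connection with a normal only, so in this form the metric need not be inverted.\<close>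

definition koszul ::
    "'a::euclidean_space set \<Rightarrow> ('a \<Rightarrow> 'a \<Rightarrow> 'a \<Rightarrow> real) \<Rightarrow> 'a \<Rightarrow> 'a \<Rightarrow> 'a \<Rightarrow> 'a \<Rightarrow> real"
  where "koszul S G z u v w =
    (pd S (\<lambda>y. G y v w) z u + pd S (\<lambda>y. G y u w) z v - pd S (\<lambda>y. G y u v) z w) / 2"

lemma pd_linear:
  assumes "f differentiable_on S" "x \<in> S"
  shows "linear (pd S f x)"
  using has_derivative_linear[OF pd_works[OF assms]] .

lemma pd_linear_family:
  assumes S: "udom S" "x \<in> S" and f: "\<And>y. y \<in> S \<Longrightarrow> linear (f y)"
    and d: "\<And>v. (\<lambda>y. f y v) differentiable_on S"
  shows "linear (\<lambda>v. pd S (\<lambda>y. f y v) x u)"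
proof (rule linearI)
  fix v w
  have "pd S (\<lambda>y. f y (v + w)) x = pd S (\<lambda>y. f y v + f y w) x"
    using S f by (intro pd_cong) (auto simp: linear_add)
  also have "\<dots> = (\<lambda>u. pd S (\<lambda>y. f y v) x u + pd S (\<lambda>y. f y w) x u)"
    using S by (intro pd_unique has_derivative_add pd_works d)
  finally show "pd S (\<lambda>y. f y (v + w)) x u = pd S (\<lambda>y. f y v) x u + pd S (\<lambda>y. f y w) x u" by simp
next
  fix c v
  have "pd S (\<lambda>y. f y (c *\<^sub>R v)) x = pd S (\<lambda>y. c *\<^sub>R f y v) x"
    using S f by (intro pd_cong) (auto simp: linear_scale)
  also have "\<dots> = (\<lambda>u. c *\<^sub>R pd S (\<lambda>y. f y v) x u)"
    using S by (intro pd_unique has_derivative_scaleR_right pd_works d)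
  finally show "pd S (\<lambda>y. f y (c *\<^sub>R v)) x u = c *\<^sub>R pd S (\<lambda>y. f y v) x u" by simp
qed

lemma pd_bilinear_family:
  assumes S: "udom S" "x \<in> S" and f: "\<And>y. y \<in> S \<Longrightarrow> bilinear (f y)"
    and d: "\<And>u v. (\<lambda>y. f y u v) differentiable_on S"
  shows "bilinear (\<lambda>u v. pd S (\<lambda>y. f y u v) x w)"
  unfolding bilinear_def
  using f pd_linear_family[OF S, of "\<lambda>y. f y a" w for a, OF _ d]
    pd_linear_family[OF S, of "\<lambda>y b. f y b a" w for a, OF _ d]
  by (auto simp: bilinear_def)

lemma koszul_linear:
  assumes G: "dmetric S G" "z \<in> S"
  shows "linear (\<lambda>u. koszul S G z u v w)" "linear (\<lambda>v. koszul S G z u v w)" "linear (\<lambda>w. koszul S G z u v w)"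
proof -
  have b: "bilinear (\<lambda>u v. pd S (\<lambda>y. G y u v) z w)" for w
    using G by (intro pd_bilinear_family) (auto simp: dmetric_def inner_form_def)
  have l: "linear (pd S (\<lambda>y. G y u v) z)" for u v
    using G by (intro pd_linear) (auto simp: dmetric_def)
  show "linear (\<lambda>u. koszul S G z u v w)" "linear (\<lambda>v. koszul S G z u v w)" "linear (\<lambda>w. koszul S G z u v w)"
    unfolding koszul_def by (intro linearI; simp add: bilinear_ladd[OF b] bilinear_radd[OF b]
        bilinear_lmul[OF b] bilinear_rmul[OF b] linear_add[OF l] linear_scale[OF l] field_simps)+
qed

lemma christoffel_works:
  assumes "dmetric S G" "z \<in> S"
  shows "G z (christoffel S G z u v) w = koszul S G z u v w"
  using sharp_works[OF _ koszul_linear(3)[OF assms]] assms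
  unfolding christoffel_def koszul_def[symmetric] by (simp add: dmetric_def)

lemma inner_form_eqI:
  assumes "inner_form g" "\<And>w. g a w = g b w"
  shows "a = b"
  using inner_form_zero[OF assms(1), of "a - b"] assms(2) bilinear_lsub[OF inner_formD(1)[OF assms(1)]]
  by simp

lemma christoffel_bilinear:
  assumes G: "dmetric S G" "z \<in> S"
  shows "bilinear (christoffel S G z)"
proof -
  have g: "inner_form (G z)" using G by (simp add: dmetric_def)
  note b = inner_formD(1)[OF g]
  note k = koszul_linear[OF G]
  show ?thesis
    unfolding bilinear_def
    by (intro conjI allI linearI; rule inner_form_eqI[OF g];
        simp add: bilinear_ladd[OF b] bilinear_lmul[OF b] christoffel_works[OF G]
        linear_add[OF k(1)] linear_add[OF k(2)] linear_scale[OF k(1)] linear_scale[OF k(2)])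
qed

lemma second_ff_koszul:
  assumes "dmetric S G" "f x \<in> S"
  shows "second_ff D f S G nu x u v =
    - (G (f x) (pd D (\<lambda>y. pd D f y v) x u) nu + koszul S G (f x) (pd D f x u) (pd D f x v) nu)"
proof -
  have "bilinear (G (f x))" using assms by (simp add: dmetric_def inner_form_def)
  then show ?thesis by (simp add: second_ff_def bilinear_ladd christoffel_works[OF assms])
qed

lemma second_ff_bilinear:
  assumes G: "dmetric S G" "f x \<in> S" and D: "udom D" "x \<in> D"
    and f: "f differentiable_on D" "\<And>v. (\<lambda>y. pd D f y v) differentiable_on D"
  shows "bilinear (second_ff D f S G nu x)"
proof -
  have b: "bilinear (G (f x))" using G by (simp add: dmetric_def inner_form_def)
  note k = koszul_linear[OF G]
  note p = pd_linear[OF f(1) D(2)] pd_linear[OF f(2) D(2)]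
    pd_linear_family[OF D pd_linear[OF f(1)] f(2)]
  have "linear (second_ff D f S G nu x u)" for u
    unfolding second_ff_koszul[where f=f and x=x, OF G]
    by (intro linearI) (simp_all add: linear_add[OF p(1)] linear_scale[OF p(1)]
        linear_add[OF p(3)] linear_scale[OF p(3)] linear_add[OF k(2)] linear_scale[OF k(2)]
        bilinear_ladd[OF b] bilinear_lmul[OF b] algebra_simps)
  moreover have "linear (\<lambda>u. second_ff D f S G nu x u v)" for v
    unfolding second_ff_koszul[where f=f and x=x, OF G]
    by (intro linearI) (simp_all add: linear_add[OF p(1)] linear_scale[OF p(1)]
        linear_add[OF p(2)] linear_scale[OF p(2)] linear_add[OF k(1)] linear_scale[OF k(1)]
        bilinear_ladd[OF b] bilinear_lmul[OF b] algebra_simps)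
  ultimately show ?thesis unfolding bilinear_def by blast
qed

text \<open>The Koszul coefficients of a C^2 metric are C^1, and raising the index by Cramer's rule
  stays within C^1.\<close>

lemma christoffel_differentiable:
  fixes G :: "real^'k \<Rightarrow> real^'k \<Rightarrow> real^'k \<Rightarrow> real"
  assumes G: "dmetric S G" and C: "\<And>u v. Ck_on 2 S (\<lambda>y. G y u v)"
  shows "(\<lambda>y. christoffel S G y u v) differentiable_on S"
proof -
  have S: "udom S" using G by (simp add: dmetric_def)
  have C1: "Ck_on 1 S (\<lambda>y. pd S (\<lambda>y. G y u v) y w)" for u v w
    using C[of u v] by (simp add: numeral_2_eq_2)
  have "Ck_on 1 S (\<lambda>y. (1/2) * (pd S (\<lambda>y. G y v w) y u
      + (pd S (\<lambda>y. G y u w) y v + (- 1) * pd S (\<lambda>y. G y u v) y w)))" for w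
    by (intro Ck_on_mult Ck_on_add Ck_on_const S C1)
  then have k: "Ck_on 1 S (\<lambda>y. koszul S G y u v w)" for w
    by (simp add: koszul_def field_simps)
  have "Ck_on 1 S (\<lambda>y. christoffel S G y u v $ m)" for m
    unfolding christoffel_def koszul_def[symmetric]
    using G koszul_linear(3)[OF G] k Ck_on_Suc_imp[OF C[unfolded numeral_2_eq_2]]
    by (intro Ck_on_sharp S) (auto simp: dmetric_def)
  then have "(\<lambda>y. christoffel S G y u v \<bullet> b) differentiable_on S" if "b \<in> Basis" for b
    using that by (auto simp: Basis_vec_def inner_axis)
  then show ?thesis
    unfolding differentiable_on_def using differentiable_componentwise_within by blast
qed

lemma riemann_linear:
  fixes G :: "real^'k \<Rightarrow> real^'k \<Rightarrow> real^'k \<Rightarrow> real"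
  assumes G: "dmetric S G" "z \<in> S" and C: "\<And>u v. Ck_on 2 S (\<lambda>y. G y u v)"
  shows "linear (\<lambda>u. riemann S G z u v w)"
proof -
  note b = christoffel_bilinear[OF G(1)] and bz = christoffel_bilinear[OF G]
  note d = christoffel_differentiable[OF G(1) C]
  have "linear (\<lambda>u. pd S (\<lambda>y. christoffel S G y u w) z v)"
    using G b d by (intro pd_linear_family) (auto simp: dmetric_def bilinear_def)
  note l = this pd_linear[OF d G(2)]
  show ?thesis
    unfolding riemann_def
    by (intro linearI) (simp_all add: linear_add[OF l(1)] linear_scale[OF l(1)]
        linear_add[OF l(2)] linear_scale[OF l(2)] bilinear_ladd[OF bz]
        bilinear_lmul[OF bz] bilinear_radd[OF bz] bilinear_rmul[OF bz] algebra_simps)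
qed

text \<open>R is a double trace of the curvature tensor; on an orthonormal basis the four square
  roots equal 1, so each of the \<open>CARD('k)\<close> squared summands is at most
  \<open>C\<close>. Bilinearity of \<open>ricci\<close> is an input because it will be drawn from
  the flow equation.\<close>

lemma scalar_curv_bound:
  fixes G :: "real^'k \<Rightarrow> real^'k \<Rightarrow> real^'k \<Rightarrow> real"
  assumes G: "dmetric U G" "z \<in> U" and C2: "\<And>u v. Ck_on 2 U (\<lambda>y. G y u v)"
    and b: "bilinear (ricci U G z)"
    and C: "\<And>u v w y. \<bar>G z (riemann U G z u v w) y\<bar> \<le>
         C * sqrt (G z u u) * sqrt (G z v v) * sqrt (G z w w) * sqrt (G z y y)"
  shows "\<bar>scalar_curv U G z\<bar> \<le> real CARD('k) * real CARD('k) * C"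
proof -
  have g: "inner_form (G z)" using G by (simp add: dmetric_def)
  obtain S where S: "orthonormal (G z) S" "card S = DIM(real^'k)" using orthonormal_exists[OF g] .
  have 1: "G z s s = 1" if "s \<in> S" for s using S that by (simp add: orthonormal_def)
  have "\<bar>ricci U G z r r\<bar> \<le> real CARD('k) * C" if "r \<in> S" for r
  proof -
    have "ricci U G z r r = (\<Sum>s\<in>S. G z (riemann U G z s r r) s)"
      unfolding ricci_def by (rule trace_orthonormal[OF g S riemann_linear[OF G C2]])
    then have "\<bar>ricci U G z r r\<bar> \<le> (\<Sum>s\<in>S. \<bar>G z (riemann U G z s r r) s\<bar>)" by simp
    also have "\<dots> \<le> (\<Sum>s\<in>S. C)" 
    proof (rule sum_mono)
      show "\<bar>G z (riemann U G z s r r) s\<bar> \<le> C" if "s \<in> S" for s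
        using C[of s r r s] 1 that \<open>r \<in> S\<close> by simp
    qed
    finally show ?thesis using S by simp
  qed
  then have "(\<Sum>r\<in>S. \<bar>ricci U G z r r\<bar>) \<le> (\<Sum>r\<in>S. real CARD('k) * C)" by (rule sum_mono)
  moreover have "\<bar>scalar_curv U G z\<bar> \<le> (\<Sum>r\<in>S. \<bar>ricci U G z r r\<bar>)"
    unfolding scalar_curv_def metric_trace_orthonormal[OF g b S] by simp
  ultimately show ?thesis using S by simp
qed

section \<open>Bilinear forms that vary with the base point\<close>

lemma bilinear_expand:
  fixes g :: "'a::euclidean_space \<Rightarrow> 'a \<Rightarrow> real"
  assumes "bilinear g"
  shows "g u v = (\<Sum>i\<in>Basis. \<Sum>j\<in>Basis. (u \<bullet> i) * ((v \<bullet> j) * g i j))"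
proof -
  have "g u v = g (\<Sum>i\<in>Basis. (u \<bullet> i) *\<^sub>R i) (\<Sum>j\<in>Basis. (v \<bullet> j) *\<^sub>R j)"
    by (simp add: euclidean_representation)
  also have "\<dots> = (\<Sum>i\<in>Basis. (u \<bullet> i) * (\<Sum>j\<in>Basis. (v \<bullet> j) * g i j))"
    by (subst bilinear_sum_left[OF assms]) (simp add: bilinear_sum_right[OF assms, where f="\<lambda>s. s"])
  finally show ?thesis by (simp only: sum_distrib_left)
qed

lemma linear_expand:
  fixes L :: "'a::euclidean_space \<Rightarrow> real"
  assumes "linear L"
  shows "L v = (\<Sum>b\<in>Basis. (v \<bullet> b) * L b)"
  using arg_cong[OF euclidean_representation[of v], of L]
  by (simp add: linear_sum[OF assms] linear_scale[OF assms])

text \<open>Product rule for a moving form with moving arguments. Expansion in coordinates reduces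
  it to scalar products; bilinearity of the differentiated coefficients reassembles the
  result.\<close>

lemma form_has_derivative:
  fixes gg :: "'e::euclidean_space \<Rightarrow> 'b::euclidean_space \<Rightarrow> 'b \<Rightarrow> real"
    and s :: "'d::euclidean_space \<Rightarrow> 'e"
  assumes E: "udom E" and bl: "\<And>y. y \<in> E \<Longrightarrow> bilinear (gg y)"
    and d: "\<And>u v. (\<lambda>y. gg y u v) differentiable_on E"
    and s: "(s has_derivative s') (at q within D)" "s ` D \<subseteq> E" and q: "q \<in> D"
    and a: "(a has_derivative a') (at q within D)" and b: "(b has_derivative b') (at q within D)"
  shows "((\<lambda>y. gg (s y) (a y) (b y)) has_derivative
     (\<lambda>h. pd E (\<lambda>y. gg y (a q) (b q)) (s q) (s' h) + gg (s q) (a' h) (b q) + gg (s q) (a q) (b' h)))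
     (at q within D)"
proof -
  have sq: "s q \<in> E" using s q by auto
  have g: "((\<lambda>y. gg (s y) i j) has_derivative (\<lambda>h. pd E (\<lambda>y. gg y i j) (s q) (s' h))) (at q within D)"
    for i j
    using has_derivative_in_compose[OF s(1)] has_derivative_subset[OF pd_works[OF d sq] s(2)] by blast
  have ai: "((\<lambda>y. a y \<bullet> i) has_derivative (\<lambda>h. a' h \<bullet> i)) (at q within D)" for i
    using has_derivative_inner_left[OF a] .
  have bj: "((\<lambda>y. b y \<bullet> j) has_derivative (\<lambda>h. b' h \<bullet> j)) (at q within D)" for j
    using has_derivative_inner_left[OF b] .
  have "((\<lambda>y. \<Sum>i\<in>Basis. \<Sum>j\<in>Basis. (a y \<bullet> i) * ((b y \<bullet> j) * gg (s y) i j)) has_derivative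
     (\<lambda>h. \<Sum>i\<in>Basis. \<Sum>j\<in>Basis. (a q \<bullet> i) * ((b q \<bullet> j) * pd E (\<lambda>y. gg y i j) (s q) (s' h)
         + (b' h \<bullet> j) * gg (s q) i j) + (a' h \<bullet> i) * ((b q \<bullet> j) * gg (s q) i j))) (at q within D)"
    by (intro has_derivative_sum has_derivative_mult ai bj g)
  moreover have "(\<Sum>i\<in>Basis. \<Sum>j\<in>Basis. (a q \<bullet> i) * ((b q \<bullet> j) * pd E (\<lambda>y. gg y i j) (s q) (s' h)
         + (b' h \<bullet> j) * gg (s q) i j) + (a' h \<bullet> i) * ((b q \<bullet> j) * gg (s q) i j))
     = pd E (\<lambda>y. gg y (a q) (b q)) (s q) (s' h) + gg (s q) (a' h) (b q) + gg (s q) (a q) (b' h)" for h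
    using bilinear_expand[OF pd_bilinear_family[OF E sq bl d], of "a q" "b q" "s' h"]
      bilinear_expand[OF bl[OF sq], of "a' h" "b q"] bilinear_expand[OF bl[OF sq], of "a q" "b' h"]
    by (simp add: distrib_left sum.distrib)
  ultimately have "((\<lambda>y. \<Sum>i\<in>Basis. \<Sum>j\<in>Basis. (a y \<bullet> i) * ((b y \<bullet> j) * gg (s y) i j)) has_derivative
     (\<lambda>h. pd E (\<lambda>y. gg y (a q) (b q)) (s q) (s' h) + gg (s q) (a' h) (b q) + gg (s q) (a q) (b' h)))
     (at q within D)" by (simp only:)
  then show ?thesis
  proof (rule has_derivative_transform[OF q, rotated])
    fix y assume "y \<in> D"
    then have "s y \<in> E" using s by auto
    from bilinear_expand[OF bl[OF this]]
    show "gg (s y) (a y) (b y) = (\<Sum>i\<in>Basis. \<Sum>j\<in>Basis. (a y \<bullet> i) * ((b y \<bullet> j) * gg (s y) i j))" .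
  qed
qed

lemma form_continuous:
  fixes gg :: "'e::euclidean_space \<Rightarrow> 'b::euclidean_space \<Rightarrow> 'b \<Rightarrow> real"
    and s :: "'d::euclidean_space \<Rightarrow> 'e"
  assumes bl: "\<And>y. y \<in> E \<Longrightarrow> bilinear (gg y)" and d: "\<And>u v. continuous_on E (\<lambda>y. gg y u v)"
    and s: "continuous_on D s" "s ` D \<subseteq> E" and ab: "continuous_on D a" "continuous_on D b"
  shows "continuous_on D (\<lambda>q. gg (s q) (a q) (b q))"
proof -
  have "continuous_on D (\<lambda>q. gg (s q) i j)" for i j
    using continuous_on_compose2[OF d s] .
  then have "continuous_on D (\<lambda>y. \<Sum>i\<in>Basis. \<Sum>j\<in>Basis. (a y \<bullet> i) * ((b y \<bullet> j) * gg (s y) i j))"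
    by (intro continuous_intros ab)
  moreover have "gg (s y) (a y) (b y) = (\<Sum>i\<in>Basis. \<Sum>j\<in>Basis. (a y \<bullet> i) * ((b y \<bullet> j) * gg (s y) i j))"
    if "y \<in> D" for y
    using bilinear_expand[OF bl] that s by blast
  ultimately show ?thesis by (simp cong: continuous_on_cong)
qed

section \<open>The flow in a pair of charts\<close>

locale local_flow =
  fixes U :: "(real^'k) set" and T :: real and D :: "('a::euclidean_space \<times> real) set"
    and G :: "real \<Rightarrow> real^'k \<Rightarrow> real^'k \<Rightarrow> real^'k \<Rightarrow> real"
    and phi :: "real \<Rightarrow> 'a \<Rightarrow> real^'k" and nu :: "'a \<Rightarrow> real \<Rightarrow> real^'k"
  assumes T: "T > 0" and open_U: "open U" and relopen_D: "relopen T D"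
    and phi_U: "\<And>x t. (x, t) \<in> D \<Longrightarrow> phi t x \<in> U"
    and dim: "CARD('k) = DIM('a) + 1"
    and G_form: "\<And>t z. t \<in> {0<..T} \<Longrightarrow> z \<in> U \<Longrightarrow> inner_form (G t z)"
    and G_smooth: "\<And>u v. smooth_on (U \<times> {0<..T}) (\<lambda>(z, t). G t z u v)"
    and phi_smooth: "smooth_on D (\<lambda>(x, t). phi t x)"
    and nu_smooth: "smooth_on D (\<lambda>(x, t). nu x t)"
    and immersion: "\<And>x t. (x, t) \<in> D \<Longrightarrow> inj (pd {x. (x, t) \<in> D} (phi t) x)"
    and normal: "\<And>x t. (x, t) \<in> D \<Longrightarrow> is_unit_normal {x. (x, t) \<in> D} (phi t) (G t) x (nu x t)"
    and mcf: "\<And>x t. (x, t) \<in> D \<Longrightarrow> ((\<lambda>s. phi s x) has_vector_derivative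
          - (mean_curv {x. (x, t) \<in> D} (phi t) U (G t) (nu x t) x *\<^sub>R nu x t)) (at t within {0<..T})"
    and rflow: "\<And>t z u v. t \<in> {0<..T} \<Longrightarrow> z \<in> U \<Longrightarrow>
       ((\<lambda>s. G s z u v) has_real_derivative 2 * ricci U (G t) z u v) (at t within {0<..T})"
begin

text \<open>All quantities are regarded as functions of one space-time variable, \<open>q = (x, t)\<close> in \<open>D\<close> or
  \<open>y = (z, t)\<close> in \<open>E\<close>.  The track is \<open>st\<close>, and \<open>dG y w u v\<close> is the derivative in direction \<open>w\<close> of
  the component \<open>(u, v)\<close> of the metric.\<close>

definition "E = U \<times> {0<..T}"
definition "gg q = G (snd q) (fst q)"
definition "pp q = phi (snd q) (fst q)"
definition "nn q = nu (fst q) (snd q)"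
definition "st q = (pp q, snd q)"
definition "HH q = mean_curv {x. (x, snd q) \<in> D} (phi (snd q)) U (G (snd q)) (nn q) (fst q)"
definition "Ric q = ricci U (G (snd q)) (fst q)"
definition "Rs q = scalar_curv U (G (snd q)) (fst q)"
definition "dG q w u v = pd E (\<lambda>y. gg y u v) q w"

lemma D_time: "q \<in> D \<Longrightarrow> snd q \<in> {0<..T}"
  using relopen_D by (auto simp: relopen_def)

lemma udom_D: "udom D" using relopen_udom[OF relopen_D] .

lemma relopen_E: "relopen T E" unfolding E_def using relopen_Times[OF open_U] .

lemma udom_E: "udom E" using relopen_udom[OF relopen_E] .

lemma st_E: "q \<in> D \<Longrightarrow> st q \<in> E"
  using phi_U[of "fst q" "snd q"] D_time[of q] by (simp add: E_def st_def pp_def)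

lemma gg_form: "y \<in> E \<Longrightarrow> inner_form (gg y)"
  using G_form by (auto simp: E_def gg_def)

lemma gg_bl: "y \<in> E \<Longrightarrow> bilinear (gg y)" using gg_form inner_formD(1) by blast

lemma gg_Ck: "Ck_on k E (\<lambda>y. gg y u v)"
  using G_smooth[of u v] by (simp add: smooth_on_def E_def gg_def case_prod_unfold)

lemma gg_diff: "(\<lambda>y. gg y u v) differentiable_on E"
  using gg_Ck[of "Suc 0"] by simp

lemma gg_cont: "continuous_on E (\<lambda>y. gg y u v)"
  using gg_Ck[of 0] by simp

lemma dG_Ck: "Ck_on k E (\<lambda>y. dG y w u v)"
  using gg_Ck[of "Suc k" u v] unfolding dG_def by (cases w) simp

lemma dG_bl: "y \<in> E \<Longrightarrow> bilinear (dG y w)"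
  using pd_bilinear_family[OF udom_E _ gg_bl gg_diff, of y w] by (simp add: dG_def[abs_def])

lemma dG_linear: "y \<in> E \<Longrightarrow> linear (\<lambda>w. dG y w u v)"
  using pd_linear[OF gg_diff, of y u v] by (simp add: dG_def[abs_def])

text \<open>The definition of \<open>ricci\<close> contains second derivatives and an inverse of the
  metric, whereas a time derivative of the metric is visibly bilinear and smooth. The equality is
  uniqueness of the derivative along a time line.\<close>

lemma Ric_dG:
  assumes "y \<in> E" shows "Ric y u v = dG y (0, 1) u v / 2"
proof -
  obtain z t where y: "y = (z, t)" by (cases y)
  then have zt: "z \<in> U" "t \<in> {0<..T}" using assms by (auto simp: E_def)
  have "((\<lambda>s. gg (z, s) u v) has_vector_derivative dG (z, t) (0, 1) u v) (at t within {0<..T})"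
    using line_has_derivative[OF relopen_E _ pd_works[OF gg_diff]] assms y by (simp add: dG_def)
  moreover have "((\<lambda>s. gg (z, s) u v) has_vector_derivative 2 * Ric y u v) (at t within {0<..T})"
    using rflow[OF zt(2,1), of u v] y
    by (simp add: has_real_derivative_iff_has_vector_derivative gg_def Ric_def)
  ultimately show ?thesis using time_derivative_unique[OF zt(2)] y by fastforce
qed

lemma Ric_bl: "y \<in> E \<Longrightarrow> bilinear (Ric y)"
  using dG_bl[of y "(0, 1)"] unfolding bilinear_def linear_iff by (simp add: Ric_dG add_divide_distrib)

lemma Ric_Ck: "Ck_on k E (\<lambda>y. Ric y u v)"
proof (subst Ck_on_cong)
  show "Ric y u v = (1/2) * dG y (0, 1) u v" if "y \<in> E" for y using Ric_dG[OF that] by simp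
qed (intro Ck_on_mult Ck_on_const udom_E dG_Ck)

text \<open>R sits in the time component of the space-time metric, so its first derivatives occur in
  the connection of that metric.\<close>

lemma Rs_Ck: "Ck_on k E Rs"
proof -
  have "Ck_on k E (\<lambda>y. metric_trace (gg y) (Ric y))"
    by (intro Ck_on_metric_trace udom_E gg_form gg_Ck Ric_bl Ric_Ck)
  then show ?thesis
    by (simp add: Rs_def[abs_def] scalar_curv_def gg_def Ric_def[abs_def])
qed

lemma Rs_diff: "Rs differentiable_on E"
  using Rs_Ck[of "Suc 0"] by simp

lemma pp_Ck: "Ck_on k D pp"
  using phi_smooth by (simp add: smooth_on_def pp_def[abs_def] case_prod_unfold)

lemma pp_diff: "pp differentiable_on D" "(\<lambda>q. pd D pp q v) differentiable_on D"
  using pp_Ck[of 2] by (simp_all add: numeral_2_eq_2 del: split_paired_All)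

lemma pp_cont: "continuous_on D pp" "continuous_on D (\<lambda>q. pd D pp q v)"
    "continuous_on D (\<lambda>q. pd D (\<lambda>y. pd D pp y v) q w)"
  using pp_Ck[of 0] pp_Ck[of 1] pp_Ck[of 2] by (simp_all add: numeral_2_eq_2 del: split_paired_All)

lemma nn_Ck: "Ck_on k D nn"
  using nu_smooth by (simp add: smooth_on_def nn_def[abs_def] case_prod_unfold)

lemma nn_diff: "nn differentiable_on D"
  using nn_Ck[of "Suc 0"] by simp

lemma st_deriv:
  assumes "q \<in> D" shows "(st has_derivative (\<lambda>h. (pd D pp q h, snd h))) (at q within D)"
  unfolding st_def[abs_def]
  by (intro has_derivative_Pair pd_works[OF pp_diff(1) assms] has_derivative_snd has_derivative_ident)

lemma st_pd: "q \<in> D \<Longrightarrow> pd D st q h = (pd D pp q h, snd h)"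
  using pd_unique[OF udom_D _ st_deriv] by simp

lemma st_diff: "st differentiable_on D"
  using st_deriv unfolding differentiable_on_def differentiable_def by blast

lemma st_cont: "continuous_on D st"
  using st_diff differentiable_imp_continuous_on by blast

lemma st_image: "st ` D \<subseteq> E" using st_E by blast

lemma pp_slice:
  assumes "q \<in> D" shows "pd {x. (x, snd q) \<in> D} (phi (snd q)) (fst q) u = pd D pp q (u, 0)"
  using pd_slice[OF relopen_D, of "fst q" "snd q" pp u] assms pp_diff by (simp add: pp_def)

lemma pp_slice2:
  assumes "q \<in> D"
  shows "pd {x. (x, snd q) \<in> D} (\<lambda>y. pd {x. (x, snd q) \<in> D} (phi (snd q)) y v) (fst q) u
    = pd D (\<lambda>y. pd D pp y (v, 0)) q (u, 0)"
proof -
  have "pd {x. (x, snd q) \<in> D} (\<lambda>y. pd {x. (x, snd q) \<in> D} (phi (snd q)) y v) (fst q)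
      = pd {x. (x, snd q) \<in> D} (\<lambda>y. pd D pp (y, snd q) (v, 0)) (fst q)"
    by (rule pd_cong) (use assms pp_slice[of "(y, snd q)" v for y] in auto)
  then show ?thesis
    using pd_slice[OF relopen_D, of "fst q" "snd q" "\<lambda>y. pd D pp y (v, 0)" u] assms pp_diff by simp
qed

lemma pp_time: 
  assumes "q \<in> D" shows "pd D pp q (0, 1) = - (HH q *\<^sub>R nn q)"
proof -
  obtain x t where q: "q = (x, t)" by (cases q)
  have "((\<lambda>s. pp (x, s)) has_vector_derivative pd D pp q (0, 1)) (at t within {0<..T})"
    using line_has_derivative[OF relopen_D _ pd_works[OF pp_diff(1)]] assms q by simp
  moreover have "((\<lambda>s. pp (x, s)) has_vector_derivative - (HH q *\<^sub>R nn q)) (at t within {0<..T})"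
    using mcf[of x t] assms q by (simp add: pp_def nn_def HH_def)
  moreover have "t \<in> {0<..T}" using D_time assms q by fastforce
  ultimately show ?thesis using time_derivative_unique by blast
qed

lemma pp_pd:
  assumes "q \<in> D" shows "pd D pp q (u, a) = pd D pp q (u, 0) - (a * HH q) *\<^sub>R nn q"
proof -
  note l = pd_linear[OF pp_diff(1) assms]
  have "pd D pp q (u, a) = pd D pp q (u, 0) + a *\<^sub>R pd D pp q (0, 1)"
    using linear_add[OF l, of "(u, 0)" "a *\<^sub>R (0, 1)"] linear_scale[OF l, of a "(0, 1)"] by simp
  then show ?thesis using pp_time[OF assms] by simp
qed

lemma nn_unit: "q \<in> D \<Longrightarrow> gg (st q) (nn q) (nn q) = 1"
  and nn_normal: "q \<in> D \<Longrightarrow> gg (st q) (pd D pp q (u, 0)) (nn q) = 0"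
  using normal[of "fst q" "snd q"] pp_slice[of q]
  by (simp_all add: is_unit_normal_def gg_def st_def pp_def nn_def)

text \<open>Pairing the flow equation with the unit normal replaces a trace over the induced metric
  by a single product, which can be differentiated directly.\<close>

lemma HH_formula: 
  assumes "q \<in> D" shows "HH q = - gg (st q) (pd D pp q (0, 1)) (nn q)"
  using bilinear_lneg[OF gg_bl[OF st_E[OF assms]]] bilinear_lmul[OF gg_bl[OF st_E[OF assms]]]
  by (simp add: pp_time assms nn_unit)

lemma form_deriv:
  assumes q: "q \<in> D" and a: "(a has_derivative a') (at q within D)" and b: "(b has_derivative b') (at q within D)"
  shows "((\<lambda>y. gg (st y) (a y) (b y)) has_derivative
     (\<lambda>h. dG (st q) (pd D pp q h, snd h) (a q) (b q) + gg (st q) (a' h) (b q) + gg (st q) (a q) (b' h)))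
     (at q within D)"
  using form_has_derivative[OF udom_E gg_bl gg_diff st_deriv[OF q] st_image q a b]
  by (simp add: dG_def)

text \<open>The time derivative of \<open>H\<close>, obtained by differentiating \<open>H = - g(\<partial>\<^sub>t\<phi>, \<nu>)\<close> and \<open>g(\<nu>, \<nu>) = 1\<close>; the
  derivative of \<open>\<nu>\<close> drops out.\<close>

definition hdot where "hdot q = HH q * dG (st q) (- (HH q *\<^sub>R nn q), 1) (nn q) (nn q) / 2
  - gg (st q) (pd D (\<lambda>y. pd D pp y (0, 1)) q (0, 1)) (nn q)"

lemma HH_deriv:
  assumes q: "q \<in> D"
  shows "\<exists>H'. (HH has_derivative H') (at q within D) \<and> H' (0, 1) = hdot q"
proof -
  note st = st_E[OF q]
  note b = gg_bl[OF st]
  let ?a' = "pd D (\<lambda>y. pd D pp y (0, 1)) q" and ?n' = "pd D nn q" and ?s' = "\<lambda>h. (pd D pp q h, snd h)"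
  have n: "(nn has_derivative ?n') (at q within D)" using pd_works[OF nn_diff q] .
  have d1: "((\<lambda>y. gg (st y) (nn y) (nn y)) has_derivative
     (\<lambda>h. dG (st q) (?s' h) (nn q) (nn q) + gg (st q) (?n' h) (nn q) + gg (st q) (nn q) (?n' h)))
     (at q within D)"
    using form_deriv[OF q n n] .
  have d2: "((\<lambda>y. gg (st y) (nn y) (nn y)) has_derivative (\<lambda>h. 0)) (at q within D)"
    by (rule has_derivative_transform[OF q _ has_derivative_const]) (simp add: nn_unit)
  have "(\<lambda>h. dG (st q) (?s' h) (nn q) (nn q) + gg (st q) (?n' h) (nn q) + gg (st q) (nn q) (?n' h))
      = (\<lambda>h. 0)"
    by (rule trans[OF pd_unique[OF udom_D q d1, symmetric] pd_unique[OF udom_D q d2]])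
  from fun_cong[OF this, of "(0, 1)"]
  have 1: "gg (st q) (nn q) (?n' (0, 1)) = - dG (st q) (?s' (0, 1)) (nn q) (nn q) / 2"
    using inner_formD(2)[OF gg_form[OF st], of "nn q" "?n' (0, 1)"] by simp
  let ?H' = "\<lambda>h. - (dG (st q) (?s' h) (pd D pp q (0, 1)) (nn q) + gg (st q) (?a' h) (nn q)
      + gg (st q) (pd D pp q (0, 1)) (?n' h))"
  have "((\<lambda>y. - gg (st y) (pd D pp y (0, 1)) (nn y)) has_derivative ?H') (at q within D)"
    by (intro has_derivative_minus form_deriv q n pd_works[OF pp_diff(2)])
  then have "(HH has_derivative ?H') (at q within D)"
    by (rule has_derivative_transform[OF q, rotated]) (rule HH_formula)
  moreover have "?H' (0, 1) = hdot q"
    using 1 by (simp add: hdot_def pp_time[OF q] bilinear_lneg[OF b] bilinear_lmul[OF b]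
        bilinear_lneg[OF dG_bl[OF st]] bilinear_lmul[OF dG_bl[OF st]])
  ultimately show ?thesis by blast
qed

lemma HH_time_deriv:
  assumes "(x, t) \<in> D"
  shows "((\<lambda>s. HH (x, s)) has_vector_derivative hdot (x, t)) (at t within {0<..T})"
proof -
  obtain H' where "(HH has_derivative H') (at (x, t) within D)" "H' (0, 1) = hdot (x, t)"
    using HH_deriv[OF assms] by blast
  then show ?thesis using line_has_derivative[OF relopen_D assms, of HH H'] by simp
qed

end

lemma inner_form_product:
  fixes g :: "'a::euclidean_space \<Rightarrow> 'a \<Rightarrow> real"
  assumes g: "inner_form g" and c: "c > 0" and p: "p > 0"
  shows "inner_form (\<lambda>X Y :: 'a \<times> real. g (fst X) (fst Y) / c + p * (snd X * snd Y))"
    (is "inner_form ?h")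
  unfolding inner_form_def
proof (intro conjI allI impI)
  note b = inner_formD(1)[OF g]
  show "bilinear ?h"
    unfolding bilinear_def
    by (intro conjI allI linearI) (simp_all add: bilinear_ladd[OF b] bilinear_lmul[OF b]
        bilinear_radd[OF b] bilinear_rmul[OF b] add_divide_distrib algebra_simps)
  show "?h X Y = ?h Y X" for X Y
    using inner_formD(2)[OF g, of "fst X" "fst Y"] by simp
  fix X :: "'a \<times> real" assume "X \<noteq> 0"
  then consider "fst X \<noteq> 0" | "fst X = 0" "snd X \<noteq> 0" by (metis prod_eq_iff fst_zero snd_zero)
  then show "?h X X > 0"
  proof cases
    case 1
    then have "g (fst X) (fst X) / c > 0" using inner_formD(3)[OF g 1] c by simp
    moreover have "p * (snd X * snd X) \<ge> 0" using p by simp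
    ultimately show ?thesis by linarith
  next
    case 2
    have "snd X * snd X > 0" using 2 by (auto simp: zero_less_mult_iff)
    then show ?thesis using p 2 bilinear_lzero[OF b] by simp
  qed
qed

lemma orthonormal_product:
  fixes g :: "'a::euclidean_space \<Rightarrow> 'a \<Rightarrow> real"
  assumes g: "inner_form g" and c: "c > 0" and p: "p > 0" and S: "orthonormal g S"
  defines "S' \<equiv> insert (0, 1 / sqrt p) ((\<lambda>e. (sqrt c *\<^sub>R e, 0)) ` S)"
  shows "orthonormal (\<lambda>X Y :: 'a \<times> real. g (fst X) (fst Y) / c + p * (snd X * snd Y)) S'"
    and "card S' = card S + 1"
    and "(\<Sum>s\<in>S'. f s) = f (0, 1 / sqrt p) + (\<Sum>e\<in>S. f (sqrt c *\<^sub>R e, 0))"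
proof -
  note b = inner_formD(1)[OF g]
  have fin: "finite S" using S by (simp add: orthonormal_def)
  have i: "inj_on (\<lambda>e. (sqrt c *\<^sub>R e, 0::real)) S" using c by (auto simp: inj_on_def)
  have n: "(0, 1 / sqrt p) \<notin> (\<lambda>e. (sqrt c *\<^sub>R e, 0)) ` S" using p by auto
  have sc: "sqrt c * (sqrt c * a) / c = a" for a
    using c by (simp add: mult.assoc[symmetric])
  have sp: "p * (1 / sqrt p * (1 / sqrt p)) = 1" using p by (simp add: field_simps)
  show "orthonormal (\<lambda>X Y :: 'a \<times> real. g (fst X) (fst Y) / c + p * (snd X * snd Y)) S'"
    unfolding orthonormal_def S'_def
    using S c p sp fin
    by (auto simp: orthonormal_def bilinear_lzero[OF b] bilinear_rzero[OF b] bilinear_lmul[OF b]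
        bilinear_rmul[OF b] sc)
  show "card S' = card S + 1" using n i fin by (simp add: S'_def card_image)
  show "(\<Sum>s\<in>S'. f s) = f (0, 1 / sqrt p) + (\<Sum>e\<in>S. f (sqrt c *\<^sub>R e, 0))"
    using n i fin by (simp add: S'_def sum.reindex)
qed

text \<open>Rescaling an orthonormal basis by \<open>sqrt c\<close> and the time vector by
  \<open>1 / sqrt p\<close> produces the weights \<open>c\<close> and \<open>1 / p\<close>. The
  metric induced on the track has this block form, with \<open>c\<close> the time and
  \<open>p\<close> the squared length of V.\<close>

lemma metric_trace_product:
  fixes g :: "'a::euclidean_space \<Rightarrow> 'a \<Rightarrow> real"
  assumes g: "inner_form g" and c: "c > 0" and p: "p > 0" and S: "orthonormal g S" "card S = DIM('a)"
    and B: "bilinear B"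
  shows "metric_trace (\<lambda>X Y :: 'a \<times> real. g (fst X) (fst Y) / c + p * (snd X * snd Y)) B
    = c * (\<Sum>e\<in>S. B (e, 0) (e, 0)) + B (0, 1) (0, 1) / p"
proof -
  have 1: "B (sqrt c *\<^sub>R e, 0) (sqrt c *\<^sub>R e, 0) = c * B (e, 0) (e, 0)" for e
    using bilinear_lmul[OF B, of "sqrt c" "(e, 0)"] bilinear_rmul[OF B, of _ "sqrt c" "(e, 0)"] c
    by (simp add: mult.assoc[symmetric])
  have 2: "B (0, 1 / sqrt p) (0, 1 / sqrt p) = B (0, 1) (0, 1) / p"
  proof -
    have e: "(0, 1 / sqrt p) = (1 / sqrt p) *\<^sub>R (0, 1)" by simp
    have "B (0, 1 / sqrt p) (0, 1 / sqrt p) = (1 / sqrt p) * ((1 / sqrt p) * B (0, 1) (0, 1))"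
      by (simp only: e bilinear_lmul[OF B] bilinear_rmul[OF B] real_scaleR_def)
    then show ?thesis using p by (simp add: mult.assoc[symmetric])
  qed
  show ?thesis
    by (subst metric_trace_orthonormal[OF inner_form_product[OF g c p] B orthonormal_product(1)[OF g c p S(1)]])
      (simp_all add: orthonormal_product(2,3)[OF g c p S(1)] S(2) 1 2 sum_distrib_left)
qed

section \<open>The space-time metric\<close>

context local_flow
begin

definition "Phi N y = N / (2 * snd y ^ 3) + Rs y / snd y - real DIM(real^'k) / (2 * snd y ^ 2)"

definition gh :: "real \<Rightarrow> (real^'k) \<times> real \<Rightarrow> (real^'k) \<times> real \<Rightarrow> (real^'k) \<times> real \<Rightarrow> real"
  where "gh N y X Y = gg y (fst X) (fst Y) / snd y + Phi N y * (snd X * snd Y)"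

definition "dPhi N y W = - 3 * N * snd W / (2 * snd y ^ 4) + pd E Rs y W / snd y
   - Rs y * snd W / snd y ^ 2 + real DIM(real^'k) * snd W / snd y ^ 3"

lemma E_time: "y \<in> E \<Longrightarrow> snd y > 0"
  by (auto simp: E_def)

lemma inverse_time_deriv:
  assumes "y \<in> E"
  shows "((\<lambda>y. inverse (snd y)) has_derivative (\<lambda>W. - (inverse (snd y) * snd W * inverse (snd y))))
    (at y within E)"
  by (rule Deriv.has_derivative_inverse)
    (use E_time[OF assms] in simp, intro has_derivative_snd has_derivative_ident)

lemma Phi_deriv:
  assumes "y \<in> E" shows "(Phi N has_derivative dPhi N y) (at y within E)"
proof -
  note t = E_time[OF assms] and i = inverse_time_deriv[OF assms]
  have R: "(Rs has_derivative pd E Rs y) (at y within E)" by (rule pd_works[OF Rs_diff assms])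
  \<comment> \<open>Powers of 1/t are written as products of one function, so that the product rule
    is enough.\<close>
  let ?i = "\<lambda>y :: (real^'k) \<times> real. inverse (snd y)"
  let ?F = "\<lambda>y. (N / 2) * (?i y * (?i y * ?i y)) + Rs y * ?i y - (real DIM(real^'k) / 2) * (?i y * ?i y)"
  let ?i' = "\<lambda>W. - (?i y * snd W * ?i y)"
  have "(?F has_derivative (\<lambda>W. (N / 2) * (?i y * (?i y * ?i' W + ?i' W * ?i y) + ?i' W * (?i y * ?i y))
      + (Rs y * ?i' W + pd E Rs y W * ?i y)
      - (real DIM(real^'k) / 2) * (?i y * ?i' W + ?i' W * ?i y))) (at y within E)"
    by (intro has_derivative_add has_derivative_diff has_derivative_mult has_derivative_mult_right i R)
  moreover have "(\<lambda>W. (N / 2) * (?i y * (?i y * ?i' W + ?i' W * ?i y) + ?i' W * (?i y * ?i y))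
      + (Rs y * ?i' W + pd E Rs y W * ?i y)
      - (real DIM(real^'k) / 2) * (?i y * ?i' W + ?i' W * ?i y)) = dPhi N y"
  proof
    fix W
    show "(N / 2) * (?i y * (?i y * ?i' W + ?i' W * ?i y) + ?i' W * (?i y * ?i y))
      + (Rs y * ?i' W + pd E Rs y W * ?i y)
      - (real DIM(real^'k) / 2) * (?i y * ?i' W + ?i' W * ?i y) = dPhi N y W"
      using t unfolding dPhi_def by (simp add: field_simps eval_nat_numeral)
  qed
  ultimately have F: "(?F has_derivative dPhi N y) (at y within E)" by (rule has_derivative_eq_rhs)
  show ?thesis
  proof (rule has_derivative_transform[OF assms _ F])
    show "Phi N z = ?F z" if "z \<in> E" for z
      using E_time[OF that] unfolding Phi_def by (simp add: field_simps eval_nat_numeral)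
  qed
qed

lemma gh_deriv:
  assumes "y \<in> E"
  shows "((\<lambda>y. gh N y X Y) has_derivative (\<lambda>W. dG y W (fst X) (fst Y) / snd y
      - snd W * gg y (fst X) (fst Y) / snd y ^ 2 + snd X * snd Y * dPhi N y W)) (at y within E)"
proof -
  note t = E_time[OF assms] and i = inverse_time_deriv[OF assms]
  have g: "((\<lambda>y. gg y u v) has_derivative (\<lambda>W. dG y W u v)) (at y within E)" for u v
    unfolding dG_def by (rule pd_works[OF gg_diff assms])
  let ?i = "\<lambda>y :: (real^'k) \<times> real. inverse (snd y)"
  have "((\<lambda>y. gg y (fst X) (fst Y) * ?i y + Phi N y * (snd X * snd Y)) has_derivative
      (\<lambda>W. gg y (fst X) (fst Y) * - (?i y * snd W * ?i y) + dG y W (fst X) (fst Y) * ?i y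
        + dPhi N y W * (snd X * snd Y))) (at y within E)"
    by (intro has_derivative_add has_derivative_mult has_derivative_mult_left i g Phi_deriv assms)
  moreover have "(\<lambda>W. gg y (fst X) (fst Y) * - (?i y * snd W * ?i y) + dG y W (fst X) (fst Y) * ?i y
        + dPhi N y W * (snd X * snd Y)) = (\<lambda>W. dG y W (fst X) (fst Y) / snd y
      - snd W * gg y (fst X) (fst Y) / snd y ^ 2 + snd X * snd Y * dPhi N y W)"
    using t by (simp add: fun_eq_iff field_simps eval_nat_numeral)
  ultimately show ?thesis unfolding gh_def divide_inverse by (simp only:)
qed

lemma gh_pd:
  assumes "y \<in> E"
  shows "pd E (\<lambda>y. gh N y X Y) y W = dG y W (fst X) (fst Y) / snd y
      - snd W * gg y (fst X) (fst Y) / snd y ^ 2 + snd X * snd Y * dPhi N y W"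
  using pd_unique[OF udom_E assms gh_deriv[OF assms]] by simp

lemma gh_form:
  assumes y: "y \<in> E" and p: "Phi N y > 0"
  shows "inner_form (gh N y)"
  using inner_form_product[OF gg_form[OF y] E_time[OF y] p] by (simp add: gh_def[abs_def])

lemma gh_dmetric: "(\<And>y. y \<in> E \<Longrightarrow> Phi N y > 0) \<Longrightarrow> dmetric E (gh N)"
  unfolding dmetric_def differentiable_on_def differentiable_def
  using udom_E gh_form gh_deriv by blast

lemma slice_dmetric: "t \<in> {0<..T} \<Longrightarrow> dmetric U (G t)"
  unfolding dmetric_def
proof (intro conjI allI ballI)
  assume t: "t \<in> {0<..T}"
  show "udom U" by (rule udom_open[OF open_U])
  show "inner_form (G t y)" if "y \<in> U" for y using G_form[OF t that] .
  show "(\<lambda>y. G t y u v) differentiable_on U" for u v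
    using Ck_on_slice_Times[OF open_U t, of "Suc 0" "\<lambda>y. gg y u v"] gg_Ck[of "Suc 0" u v]
    by (simp add: E_def gg_def)
qed

lemma slice_Ck: "t \<in> {0<..T} \<Longrightarrow> Ck_on k U (\<lambda>y. G t y u v)"
  using Ck_on_slice_Times[OF open_U, of t T k "\<lambda>y. gg y u v"] gg_Ck[of k u v]
  by (simp add: E_def gg_def)

lemma slice_koszul:
  assumes "y \<in> E"
  shows "koszul U (G (snd y)) (fst y) u v w
    = (dG y (u, 0) v w + dG y (v, 0) u w - dG y (w, 0) u v) / 2"
proof -
  have "pd U (\<lambda>z. G (snd y) z u v) (fst y) w = dG y (w, 0) u v" for u v w
    using pd_slice_Times[OF open_U, of "snd y" T "fst y" "\<lambda>y. gg y u v" w] gg_diff assms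
    by (auto simp: E_def gg_def dG_def)
  then show ?thesis by (simp add: koszul_def)
qed

text \<open>\<open>hs\<close>, \<open>A\<close> and \<open>ind\<close> are the second fundamental form, the differential of the immersion and
  the induced metric of the time slice.\<close>

definition "hs q = second_ff {x. (x, snd q) \<in> D} (phi (snd q)) U (G (snd q)) (nn q) (fst q)"

definition "A q u = pd D pp q (u, 0)"

text \<open>Slice quantities are rewritten with the space-time derivatives \<open>dG\<close> and
  \<open>pd D pp\<close>, the form in which they reappear in the second fundamental form of the
  track.\<close>

lemma hs_formula:
  assumes "q \<in> D"
  shows "hs q u v = - (gg (st q) (pd D (\<lambda>y. pd D pp y (v, 0)) q (u, 0)) (nn q)
    + (dG (st q) (A q u, 0) (A q v) (nn q) + dG (st q) (A q v, 0) (A q u) (nn q)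
       - dG (st q) (nn q, 0) (A q u) (A q v)) / 2)"
proof -
  have t: "snd q \<in> {0<..T}" and y: "phi (snd q) (fst q) \<in> U"
    using D_time[OF assms] phi_U[of "fst q" "snd q"] assms by auto
  show ?thesis
    unfolding hs_def
    by (subst second_ff_koszul[where f="phi (snd q)" and x="fst q", OF slice_dmetric[OF t] y])
      (use slice_koszul[OF st_E[OF assms]] in
        \<open>simp add: pp_slice[OF assms] pp_slice2[OF assms] A_def st_def pp_def gg_def\<close>)
qed

lemma A_linear: "q \<in> D \<Longrightarrow> linear (A q)"
  using linear_add[OF pd_linear[OF pp_diff(1), of q], of "(u, 0)" "(v, 0)" for u v]
    linear_scale[OF pd_linear[OF pp_diff(1), of q], of c "(u, 0)" for c u]
  by (intro linearI) (simp_all add: A_def)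

lemma A_inj: "q \<in> D \<Longrightarrow> inj (A q)"
  using immersion[of "fst q" "snd q"] pp_slice[of q] by (simp add: A_def[abs_def] inj_def)

definition "ind q u v = gg (st q) (A q u) (A q v)"

lemma ind_form:
  assumes "q \<in> D" shows "inner_form (ind q)"
proof -
  note b = gg_bl[OF st_E[OF assms]] and g = gg_form[OF st_E[OF assms]] and l = A_linear[OF assms]
  have "A q u \<noteq> 0" if "u \<noteq> 0" for u
    using A_inj[OF assms] that linear_0[OF l] by (metis injD)
  then show ?thesis
    unfolding inner_form_def bilinear_def ind_def
    using inner_formD(2,3)[OF g]
    by (auto intro!: linearI simp: linear_add[OF l] linear_scale[OF l] bilinear_ladd[OF b]
        bilinear_lmul[OF b] bilinear_radd[OF b] bilinear_rmul[OF b])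
qed

text \<open>Read off from \<open>hs_formula\<close>, whose space-time derivatives are already known
  to be linear in each slot.\<close>

lemma hs_bilinear:
  assumes "q \<in> D" shows "bilinear (hs q)"
proof -
  note b = gg_bl[OF st_E[OF assms]] and db = dG_bl[OF st_E[OF assms]] 
  note dl = dG_linear[OF st_E[OF assms]] and l = A_linear[OF assms]
  have l0: "(a + b, 0::real) = (a, 0) + (b, 0)" "(c *\<^sub>R a, 0::real) = c *\<^sub>R (a, 0)" for a b :: 'a and c
    by simp_all
  have l0': "(a + b, 0::real) = (a, 0) + (b, 0)" "(c *\<^sub>R a, 0::real) = c *\<^sub>R (a, 0)" for a b :: "real^'k" and c
    by simp_all
  note p = pd_linear[OF pp_diff(2) assms] pd_linear_family[OF udom_D assms pd_linear[OF pp_diff(1)] pp_diff(2)]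
  have "linear (hs q u)" for u
    unfolding hs_formula[OF assms]
    by (intro linearI) (simp_all only: linear_add[OF l] linear_scale[OF l] l0 l0' linear_add[OF p(1)]
        linear_scale[OF p(1)] linear_add[OF p(2)] linear_scale[OF p(2)] bilinear_ladd[OF b]
        bilinear_lmul[OF b] bilinear_ladd[OF db] bilinear_lmul[OF db] bilinear_radd[OF db]
        bilinear_rmul[OF db] linear_add[OF dl] linear_scale[OF dl], simp_all add: algebra_simps add_divide_distrib diff_divide_distrib)
  moreover have "linear (\<lambda>u. hs q u v)" for v
    unfolding hs_formula[OF assms]
    by (intro linearI) (simp_all only: linear_add[OF l] linear_scale[OF l] l0 l0' linear_add[OF p(1)]
        linear_scale[OF p(1)] linear_add[OF p(2)] linear_scale[OF p(2)] bilinear_ladd[OF b]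
        bilinear_lmul[OF b] bilinear_ladd[OF db] bilinear_lmul[OF db] bilinear_radd[OF db]
        bilinear_rmul[OF db] linear_add[OF dl] linear_scale[OF dl], simp_all add: algebra_simps add_divide_distrib diff_divide_distrib)
  ultimately show ?thesis unfolding bilinear_def by blast
qed

lemma HH_trace:
  assumes q: "q \<in> D" and S: "orthonormal (ind q) S" "card S = DIM('a)"
  shows "HH q = (\<Sum>e\<in>S. hs q e e)"
proof -
  have "induced_metric {x. (x, snd q) \<in> D} (phi (snd q)) (G (snd q)) (fst q) = ind q"
    by (simp add: fun_eq_iff induced_metric_def ind_def pp_slice[OF q] A_def gg_def st_def pp_def)
  then have "HH q = metric_trace (ind q) (hs q)" by (simp add: HH_def mean_curv_def hs_def)
  then show ?thesis using metric_trace_orthonormal[OF ind_form[OF q] hs_bilinear[OF q] S] by simp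
qed

text \<open>Adding the normal to the image of a tangent orthonormal basis gives an orthonormal basis
  of the background, by counting dimensions. It turns the tangential trace of Ric into R -
  Ric(\<nu>, \<nu>).\<close>

lemma Rs_trace:
  assumes q: "q \<in> D" and S: "orthonormal (ind q) S" "card S = DIM('a)"
  shows "Rs (st q) = (\<Sum>e\<in>S. Ric (st q) (A q e) (A q e)) + Ric (st q) (nn q) (nn q)"
proof -
  note y = st_E[OF q]
  note i = orthonormal_image[OF S(1), of "gg (st q)" "A q", OF ind_def[symmetric]]
  have n: "gg (st q) (A q u) (nn q) = 0" "gg (st q) (nn q) (A q u) = 0" for u
    using nn_normal[OF q, of u] inner_formD(2)[OF gg_form[OF y]] by (simp_all add: A_def)
  have nS: "nn q \<notin> A q ` S" using n(1) nn_unit[OF q] by force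
  have o: "orthonormal (gg (st q)) (insert (nn q) (A q ` S))"
    using i(1) n nn_unit[OF q] nS by (fastforce simp: orthonormal_def)
  have fS: "finite S" using S by (simp add: orthonormal_def)
  have "card (insert (nn q) (A q ` S)) = DIM(real^'k)"
    using nS i(2) S fS dim by (simp add: card_image)
  from metric_trace_orthonormal[OF gg_form[OF y] Ric_bl[OF y] o this]
  have "Rs (st q) = (\<Sum>e\<in>insert (nn q) (A q ` S). Ric (st q) e e)"
    by (simp add: Rs_def scalar_curv_def gg_def Ric_def)
  then show ?thesis using nS fS i(2) by (simp add: sum.reindex)
qed

end

section \<open>The track\<close>

text \<open>\<open>m\<close> stands for \<open>n + 1\<close>; \<open>Hd\<close>, \<open>Rv\<close> and \<open>Rt\<close> for the derivatives of \<open>H\<close> in time and of \<open>R\<close> along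
  the normal and in time; \<open>P\<close> is the time component of the space-time metric, \<open>Pt\<close> its time
  derivative, and \<open>(a \<nu>, b)\<close> the normal of the track.\<close>

definition defect_fn ::
    "real \<Rightarrow> real \<Rightarrow> real \<Rightarrow> real \<Rightarrow> real \<Rightarrow> real \<Rightarrow> real \<Rightarrow> real \<Rightarrow> real \<Rightarrow> real"
  where "defect_fn N m t H Hd Rnn R Rv Rt =
    (let P = N / (2 * t ^ 3) + R / t - m / (2 * t ^ 2);
         a = sqrt (t / (1 + H ^ 2 / (t * P)));
         b = H * a / (t * P);
         Pt = - 3 * N / (2 * t ^ 4) + Rt / t - R / t ^ 2 + m / t ^ 3
     in a * H + b * (R - Rnn - (m - 1) / (2 * t)) - b * N / (2 * t ^ 2)
        + (a * Hd / t + a * H * Rnn / t - a * H / t ^ 2 + b * H * Rv / t - b * Pt / 2 + a * Rv / (2 * t)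
           + b * H ^ 2 * Rnn / t - b * H ^ 2 / (2 * t ^ 2)) / (P + H ^ 2 / t))"

text \<open>With the time component \<open>H * a / (t * P)\<close>, the squared length is
  \<open>a ^ 2 / t\<close> times \<open>1 + H ^ 2 / (t * P)\<close>; this is where the value of
  \<open>a\<close> comes from.\<close>

lemma normal_length:
  fixes t P H :: real
  assumes t: "t > 0" and P: "P > 0"
  defines "a \<equiv> sqrt (t / (1 + H ^ 2 / (t * P)))"
  shows "a ^ 2 / t + P * (H * a / (t * P)) ^ 2 = 1"
proof -
  have s: "1 + H ^ 2 / (t * P) > 0" using t P by (simp add: add_pos_nonneg)
  then have a: "a ^ 2 = t / (1 + H ^ 2 / (t * P))" using t by (simp add: a_def)
  have "P * (H * a / (t * P)) ^ 2 = a ^ 2 / t * (H ^ 2 / (t * P))"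
    using t P by (simp add: power2_eq_square)
  then have "a ^ 2 / t + P * (H * a / (t * P)) ^ 2 = a ^ 2 / t * (1 + H ^ 2 / (t * P))"
    by (simp add: distrib_left)
  also have "\<dots> = 1" unfolding a using t s by simp
  finally show ?thesis .
qed

locale track_flow = local_flow U T D G phi nu
  for U :: "(real^'k) set" and T :: real and D :: "('a::euclidean_space \<times> real) set"
    and G :: "real \<Rightarrow> real^'k \<Rightarrow> real^'k \<Rightarrow> real^'k \<Rightarrow> real"
    and phi :: "real \<Rightarrow> 'a \<Rightarrow> real^'k" and nu :: "'a \<Rightarrow> real \<Rightarrow> real^'k" +
  fixes N :: real
  assumes Phi_pos: "\<And>y. y \<in> E \<Longrightarrow> Phi N y > 0"
begin

definition "al q = sqrt (snd q / (1 + HH q ^ 2 / (snd q * Phi N (st q))))"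
definition "be q = HH q * al q / (snd q * Phi N (st q))"
definition "ww q = (al q *\<^sub>R nn q, be q)"
text \<open>G(V, V) for V = (-H\<nu>, 1), the time entry of the metric induced on the track.\<close>

definition "Psi q = Phi N (st q) + HH q ^ 2 / snd q"

lemma st_snd [simp]: "snd (st q) = snd q" by (simp add: st_def)

lemma D_pos: "q \<in> D \<Longrightarrow> snd q > 0" using D_time[of q] by simp

lemma P_pos: "q \<in> D \<Longrightarrow> Phi N (st q) > 0" by (rule Phi_pos[OF st_E])

lemma Psi_pos: "q \<in> D \<Longrightarrow> Psi q > 0"
  using P_pos[of q] D_pos[of q] unfolding Psi_def by (simp add: add_pos_nonneg)

lemma al_pos: "q \<in> D \<Longrightarrow> al q > 0"
  using P_pos[of q] D_pos[of q] unfolding al_def by (simp add: add_pos_nonneg)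

lemma al_be: "q \<in> D \<Longrightarrow> al q ^ 2 / snd q + Phi N (st q) * be q ^ 2 = 1"
  unfolding al_def be_def by (rule normal_length[OF D_pos P_pos])

lemma be_al: "q \<in> D \<Longrightarrow> Phi N (st q) * be q = HH q * al q / snd q"
  using P_pos[of q] unfolding be_def by simp

lemma st_pd_pair:
  assumes "q \<in> D"
  shows "pd D st q (u, a) = (A q u - (a * HH q) *\<^sub>R nn q, a)"
  unfolding st_pd[OF assms] pp_pd[OF assms, of u a] A_def by simp

lemma A_nn:
  assumes "q \<in> D"
  shows "gg (st q) (A q u) (nn q) = 0" "gg (st q) (nn q) (A q u) = 0"
  using nn_normal[OF assms, of u] inner_formD(2)[OF gg_form[OF st_E[OF assms]]] by (simp_all add: A_def)

text \<open>Cross terms vanish because \<open>A q u\<close> is orthogonal to the normal; the part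
  -H\<nu> of the velocity adds \<open>HH q ^ 2 / snd q\<close> to the time entry.\<close>

lemma gh_tangent:
  assumes q: "q \<in> D"
  shows "gh N (st q) (pd D st q X) (pd D st q Y)
    = ind q (fst X) (fst Y) / snd q + Psi q * (snd X * snd Y)"
proof -
  note b = gg_bl[OF st_E[OF q]]
  obtain u a v c where XY: "X = (u, a)" "Y = (v, c)" by (cases X, cases Y) auto
  have "gg (st q) (A q u - (a * HH q) *\<^sub>R nn q) (A q v - (c * HH q) *\<^sub>R nn q)
      = ind q u v + a * HH q * (c * HH q)"
    by (simp add: ind_def bilinear_lsub[OF b] bilinear_rsub[OF b]
        bilinear_lmul[OF b] bilinear_rmul[OF b] A_nn[OF q] nn_unit[OF q])
  then show ?thesis
    by (simp add: XY st_pd_pair[OF q] gh_def Psi_def add_divide_distrib distrib_right distrib_left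
        power2_eq_square mult_ac)
qed

text \<open>On V the spatial pairing -H\<alpha>/\<tau> is balanced by \<Phi>\<beta>; this condition
  determines \<open>be\<close>.\<close>

lemma gh_ww_tangent:
  assumes q: "q \<in> D"
  shows "gh N (st q) (pd D st q X) (ww q) = 0"
proof -
  note b = gg_bl[OF st_E[OF q]]
  obtain u a where X: "X = (u, a)" by (cases X)
  have "Phi N (st q) * (a * be q) = a * (HH q * al q / snd q)"
    using be_al[OF q] by (simp add: mult.left_commute)
  then show ?thesis
    by (simp add: X st_pd_pair[OF q] gh_def ww_def bilinear_lsub[OF b]
        bilinear_lmul[OF b] bilinear_rmul[OF b] A_nn[OF q] nn_unit[OF q])
qed

lemma gh_ww: 
  assumes q: "q \<in> D" shows "gh N (st q) (ww q) (ww q) = 1"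
proof -
  note b = gg_bl[OF st_E[OF q]]
  show ?thesis using al_be[OF q]
    by (simp add: gh_def ww_def bilinear_lmul[OF b] bilinear_rmul[OF b] nn_unit[OF q] power2_eq_square)
qed

lemma gh_ww_side: 
  assumes q: "q \<in> D" shows "gh N (st q) (ww q) (nn q, 0) = al q / snd q"
  using bilinear_lmul[OF gg_bl[OF st_E[OF q]]] by (simp add: gh_def ww_def nn_unit[OF q])

text \<open>\<open>ww q\<close> and an orthonormal basis of the tangent space of the track together
  span everything, so a normal vector is a multiple of \<open>ww q\<close>. Unit length leaves the
  factors 1 and -1, and the side condition selects 1.\<close>

lemma ww_unique:
  assumes q: "q \<in> D" and w: "is_unit_normal D st (gh N) q w" "gh N (st q) w (nn q, 0) > 0"
  shows "w = ww q"
proof -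
  note f = gh_form[OF st_E[OF q] P_pos[OF q]]
  note b = inner_formD(1)[OF f]
  obtain S where S: "orthonormal (ind q) S" "card S = DIM('a)"
    using orthonormal_exists[OF ind_form[OF q]] .
  note o = orthonormal_product[OF ind_form[OF q] D_pos[OF q] Psi_pos[OF q] S(1)]
  define S' :: "('a \<times> real) set"
    where "S' = insert (0, 1 / sqrt (Psi q)) ((\<lambda>e. (sqrt (snd q) *\<^sub>R e, 0)) ` S)"
  note i = orthonormal_image[OF o(1), of "gh N (st q)" "pd D st q", OF gh_tangent[OF q], folded S'_def]
  have fin: "finite S'" using S by (simp add: S'_def orthonormal_def)
  have z: "gh N (st q) (ww q) (pd D st q X) = 0" for X
    using gh_ww_tangent[OF q] inner_formD(2)[OF f] by simp
  have n: "ww q \<notin> pd D st q ` S'"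
  proof
    assume "ww q \<in> pd D st q ` S'"
    then obtain X where "ww q = pd D st q X" by blast
    then show False using gh_ww_tangent[OF q, of X] gh_ww[OF q] by simp
  qed
  have o': "orthonormal (gh N (st q)) (insert (ww q) (pd D st q ` S'))"
    unfolding orthonormal_def
  proof (intro conjI ballI)
    show "finite (insert (ww q) (pd D st q ` S'))" using fin by simp
    fix u v assume "u \<in> insert (ww q) (pd D st q ` S')" "v \<in> insert (ww q) (pd D st q ` S')"
    then consider "u = ww q" "v = ww q" | "u = ww q" "v \<in> pd D st q ` S'"
      | "u \<in> pd D st q ` S'" "v = ww q" | "u \<in> pd D st q ` S'" "v \<in> pd D st q ` S'" by blast
    then show "gh N (st q) u v = (if u = v then 1 else 0)"
    proof cases
      case 1 then show ?thesis using gh_ww[OF q] by simp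
    next
      case 2 then have "u \<noteq> v" using n by metis
      with 2 show ?thesis using z by auto
    next
      case 3 then have "u \<noteq> v" using n by metis
      with 3 show ?thesis using gh_ww_tangent[OF q] by auto
    next
      case 4 then show ?thesis using i(1) unfolding orthonormal_def by blast
    qed
  qed
  \<comment> \<open>n slice directions, the direction V and the normal make n + 2, the dimension of
    the space-time.\<close>
  have c: "card (insert (ww q) (pd D st q ` S')) = DIM((real^'k) \<times> real)"
    using n i(2) fin o(2) S(2) dim by (simp add: card_image S'_def[symmetric])
  have w0: "gh N (st q) w (pd D st q X) = 0" for X
    using w(1) inner_formD(2)[OF f] by (simp add: is_unit_normal_def del: split_paired_All)
  have "w = (\<Sum>s\<in>insert (ww q) (pd D st q ` S'). gh N (st q) w s *\<^sub>R s)"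
    by (rule orthonormal_expand[OF f o' c, symmetric])
  also have "\<dots> = gh N (st q) w (ww q) *\<^sub>R ww q"
    using n fin w0 by (simp add: sum.neutral)
  finally obtain r where r: "w = r *\<^sub>R ww q" by blast
  have "r * r = 1"
    using w(1) gh_ww[OF q] by (simp add: r is_unit_normal_def bilinear_lmul[OF b] bilinear_rmul[OF b])
  moreover have "r * (al q / snd q) > 0"
    using w(2) gh_ww_side[OF q] by (simp add: r bilinear_lmul[OF b])
  then have "r > 0" using al_pos[OF q] D_pos[OF q] by (simp add: zero_less_mult_iff zero_less_divide_iff)
  ultimately have "r = 1" by (simp add: square_eq_1_iff)
  then show ?thesis using r by simp
qed

lemma track_normal_ww:
  assumes q: "q \<in> D"
  shows "(THE w. is_unit_normal D st (gh N) q w \<and> gh N (st q) w (nn q, 0) > 0) = ww q"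
proof (rule the_equality)
  show "is_unit_normal D st (gh N) q (ww q) \<and> gh N (st q) (ww q) (nn q, 0) > 0"
    using gh_ww[OF q] gh_ww_tangent[OF q] gh_ww_side[OF q] al_pos[OF q] D_pos[OF q]
    by (simp add: is_unit_normal_def)
qed (use ww_unique[OF q] in blast)

text \<open>The time coordinate of the track is linear, so its second derivatives vanish and the
  acceleration is purely spatial.\<close>

lemma st_diff2: "(\<lambda>q. pd D st q Y) differentiable_on D"
  and st_pd2: "q \<in> D \<Longrightarrow> pd D (\<lambda>y. pd D st y Y) q X = (pd D (\<lambda>y. pd D pp y Y) q X, 0)"
proof -
  have h: "((\<lambda>y. pd D st y Y) has_derivative (\<lambda>X. (pd D (\<lambda>y. pd D pp y Y) q X, 0))) (at q within D)"
    if "q \<in> D" for q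
  proof (rule has_derivative_transform[OF that])
    show "pd D st y Y = (pd D pp y Y, snd Y)" if "y \<in> D" for y using st_pd[OF that] .
    show "((\<lambda>y. (pd D pp y Y, snd Y)) has_derivative (\<lambda>X. (pd D (\<lambda>y. pd D pp y Y) q X, 0))) (at q within D)"
      by (intro has_derivative_Pair pd_works[OF pp_diff(2) that] has_derivative_const)
  qed
  then show "(\<lambda>q. pd D st q Y) differentiable_on D"
    unfolding differentiable_on_def differentiable_def by blast
  show "pd D (\<lambda>y. pd D st y Y) q X = (pd D (\<lambda>y. pd D pp y Y) q X, 0)" if "q \<in> D"
    using pd_unique[OF udom_D that h[OF that]] by simp
qed

lemma gh_dmetric_E: "dmetric E (gh N)"
  by (rule gh_dmetric) (rule Phi_pos)

definition "ht q = second_ff D st E (gh N) (ww q) q"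

lemma ht_bilinear: "q \<in> D \<Longrightarrow> bilinear (ht q)"
  unfolding ht_def
  by (intro second_ff_bilinear gh_dmetric_E st_E udom_D st_diff st_diff2)

lemma ht_formula:
  assumes q: "q \<in> D"
  shows "ht q X Y = - (al q * gg (st q) (pd D (\<lambda>y. pd D pp y Y) q X) (nn q) / snd q
    + koszul E (gh N) (st q) (pd D st q X) (pd D st q Y) (ww q))"
  unfolding ht_def second_ff_koszul[where f=st, OF gh_dmetric_E st_E[OF q]]
  using bilinear_rmul[OF gg_bl[OF st_E[OF q]]] by (simp add: st_pd2[OF q] gh_def ww_def)

lemma dG_split:
  assumes "y \<in> E" shows "dG y (c *\<^sub>R v, s) a b = c * dG y (v, 0) a b + 2 * s * Ric y a b"
proof -
  note l = dG_linear[OF assms]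
  have "dG y (c *\<^sub>R v, s) a b = c * dG y (v, 0) a b + s * dG y (0, 1) a b"
    using linear_add[OF l, of "c *\<^sub>R (v, 0)" "s *\<^sub>R (0, 1)"] linear_scale[OF l, of c "(v, 0)"]
      linear_scale[OF l, of s "(0, 1)"] by simp
  then show ?thesis by (simp add: Ric_dG[OF assms])
qed

lemma dPhi_split:
  assumes "y \<in> E"
  shows "dPhi N y (c *\<^sub>R v, s) = c * pd E Rs y (v, 0) / snd y + s * (- 3 * N / (2 * snd y ^ 4)
   + pd E Rs y (0, 1) / snd y - Rs y / snd y ^ 2 + real DIM(real^'k) / snd y ^ 3)"
proof -
  note l = pd_linear[OF Rs_diff assms]
  have "pd E Rs y (c *\<^sub>R v, s) = c * pd E Rs y (v, 0) + s * pd E Rs y (0, 1)"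
    using linear_add[OF l, of "c *\<^sub>R (v, 0)" "s *\<^sub>R (0, 1)"] linear_scale[OF l, of c "(v, 0)"]
      linear_scale[OF l, of s "(0, 1)"] by simp
  then show ?thesis by (simp add: dPhi_def add_divide_distrib algebra_simps)
qed

text \<open>Against the spatial part of the normal, the connection of g/\<tau> returns the slice
  form \<open>hs\<close> with weight \<alpha>/\<tau>. Against the time part, only half the time
  derivative of g/\<tau> survives, namely Ric/\<tau> - g/(2\<tau>^2).\<close>

lemma ht_space:
  assumes q: "q \<in> D"
  shows "ht q (e, 0) (e, 0) = al q / snd q * hs q e e
    + be q * (Ric (st q) (A q e) (A q e) / snd q - ind q e e / (2 * snd q ^ 2))"
proof -
  note y = st_E[OF q] and t = D_pos[OF q]
  note db = dG_bl[OF y] and s = dG_split[OF y]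
  have k: "koszul E (gh N) (st q) (A q e, 0) (A q e, 0) (ww q)
    = al q / snd q * (dG (st q) (A q e, 0) (A q e) (nn q)
       - dG (st q) (nn q, 0) (A q e) (A q e) / 2)
     - be q * (Ric (st q) (A q e) (A q e) / snd q - ind q e e / (2 * snd q ^ 2))"
    using t by (simp add: koszul_def gh_pd[OF y] ww_def bilinear_rmul[OF db] s ind_def field_simps
        power2_eq_square)
  show ?thesis
    unfolding ht_formula[OF q] st_pd_pair[OF q] hs_formula[OF q]
    using t by (simp add: k field_simps)
qed

text \<open>The acceleration, expressed through \<open>hdot\<close>, contributes a term cubic in \<open>H\<close> with the
  chart-dependent factor \<open>P0\<close>; it cancels against the Koszul terms.\<close>

lemma ht_time:
  fixes q defines "m \<equiv> real DIM(real^'k)" and "t \<equiv> snd q" and "R \<equiv> Rs (st q)"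
  defines "Rnn \<equiv> Ric (st q) (nn q) (nn q)" and "Rv \<equiv> pd E Rs (st q) (nn q, 0)"
    and "Rt \<equiv> pd E Rs (st q) (0, 1)"
  assumes q: "q \<in> D"
  shows "ht q (0, 1) (0, 1) = al q * hdot q / t + al q * HH q * Rnn / t - al q * HH q / t ^ 2
     + be q * HH q * Rv / t - be q * (- 3 * N / (2 * t ^ 4) + Rt / t - R / t ^ 2 + m / t ^ 3) / 2
     + al q * Rv / (2 * t) + be q * HH q ^ 2 * Rnn / t - be q * HH q ^ 2 / (2 * t ^ 2)"
proof -
  note y = st_E[OF q] and t = D_pos[OF q]
  note db = dG_bl[OF y] and b = gg_bl[OF y] and s = dG_split[OF y] and ps = dPhi_split[OF y]
  have V: "pd D st q (0, 1) = ((- HH q) *\<^sub>R nn q, 1)"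
    using linear_0[OF A_linear[OF q]] by (simp add: st_pd_pair[OF q])
  define P0 where "P0 = dG (st q) (nn q, 0) (nn q) (nn q)"
  define Pt where "Pt = - 3 * N / (2 * t ^ 4) + Rt / t - R / t ^ 2 + m / t ^ 3"
  have ps': "dPhi N (st q) (c *\<^sub>R nn q, r) = c * Rv / t + r * Pt" for c r
    using ps[of c "nn q" r] by (simp add: Pt_def Rv_def Rt_def R_def m_def t_def)
  have s': "dG (st q) (c *\<^sub>R nn q, r) (nn q) (nn q) = c * P0 + 2 * r * Rnn" for c r
    using s[of c "nn q" r] by (simp add: P0_def Rnn_def)
  have acc: "gg (st q) (pd D (\<lambda>y. pd D pp y (0, 1)) q (0, 1)) (nn q)
      = HH q * (- HH q * P0 + 2 * Rnn) / 2 - hdot q"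
    unfolding hdot_def scaleR_minus_left[symmetric] s' by simp
  have k: "koszul E (gh N) (st q) ((- HH q) *\<^sub>R nn q, 1) ((- HH q) *\<^sub>R nn q, 1) (ww q)
    = (- HH q * al q * (- HH q * P0 + 2 * Rnn) / t + HH q * al q / t ^ 2 + be q * (- HH q * Rv / t + Pt))
     - (HH q ^ 2 * (al q * P0 + 2 * be q * Rnn) / t - be q * HH q ^ 2 / t ^ 2 + al q * Rv / t + be q * Pt) / 2"
    unfolding koszul_def gh_pd[OF y] ww_def
    by (simp add: bilinear_lmul[OF db] bilinear_rmul[OF db] bilinear_lmul[OF b] bilinear_rmul[OF b]
        s' ps' nn_unit[OF q] power2_eq_square del: scaleR_minus_left) (use t in \<open>simp add: t_def field_simps\<close>)
  show ?thesis
    unfolding ht_formula[OF q] V k acc Pt_def[symmetric]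
    using t by (simp add: t_def[symmetric] field_simps power2_eq_square)
qed

lemma potential_deriv:
  assumes q: "q \<in> D"
  shows "pd E (st_potential N) (st q) (ww q) = - be q * N / (2 * snd q ^ 2)"
proof -
  note y = st_E[OF q] and t = D_pos[OF q]
  have e: "st_potential N = (\<lambda>y :: (real^'k) \<times> real. (N / 2) * inverse (snd y))"
    by (auto simp: st_potential_def fun_eq_iff field_simps)
  have d: "(st_potential N has_derivative
      (\<lambda>W. (N / 2) * - (inverse (snd (st q)) * snd W * inverse (snd (st q))))) (at (st q) within E)"
    unfolding e by (intro has_derivative_mult_right inverse_time_deriv y)
  show ?thesis
    unfolding pd_unique[OF udom_E y d] using t by (simp add: ww_def field_simps power2_eq_square)
qed

text \<open>The factor \<tau> of the tangential trace cancels the 1/\<tau> in front of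
  \<open>hs\<close>, leaving \<alpha>H. The remaining tangential trace involves R - Ric(\<nu>,
  \<nu>) and the trace n of the induced metric, which appears as m - 1.\<close>

theorem defect_formula:
  assumes q: "q \<in> D"
  shows "mean_curv D st E (gh N) (ww q) q + pd E (st_potential N) (st q) (ww q)
    = defect_fn N (real DIM(real^'k)) (snd q) (HH q) (hdot q) (Ric (st q) (nn q) (nn q)) (Rs (st q))
        (pd E Rs (st q) (nn q, 0)) (pd E Rs (st q) (0, 1))"
proof -
  note t = D_pos[OF q]
  obtain S where S: "orthonormal (ind q) S" "card S = DIM('a)"
    using orthonormal_exists[OF ind_form[OF q]] .
  have i: "induced_metric D st (gh N) q
      = (\<lambda>X Y. ind q (fst X) (fst Y) / snd q + Psi q * (snd X * snd Y))"
    by (simp add: fun_eq_iff induced_metric_def gh_tangent[OF q])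
  have ind1: "(\<Sum>e\<in>S. ind q e e) = real DIM(real^'k) - 1"
  proof -
    have "(\<Sum>e\<in>S. ind q e e) = (\<Sum>e\<in>S. 1)" using S by (intro sum.cong) (auto simp: orthonormal_def)
    then show ?thesis using S dim by simp
  qed
  have "mean_curv D st E (gh N) (ww q) q
      = snd q * (\<Sum>e\<in>S. ht q (e, 0) (e, 0)) + ht q (0, 1) (0, 1) / Psi q"
    unfolding mean_curv_def i ht_def[symmetric]
    by (rule metric_trace_product[OF ind_form[OF q] t Psi_pos[OF q] S ht_bilinear[OF q]])
  also have "(\<Sum>e\<in>S. ht q (e, 0) (e, 0)) = al q / snd q * (\<Sum>e\<in>S. hs q e e)
      + be q * ((\<Sum>e\<in>S. Ric (st q) (A q e) (A q e)) / snd q - (\<Sum>e\<in>S. ind q e e) / (2 * snd q ^ 2))"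
    by (simp add: ht_space[OF q] sum.distrib sum_distrib_left[symmetric] sum_subtractf
        sum_divide_distrib[symmetric])
  also have "snd q * \<dots> = al q * HH q + be q * (Rs (st q) - Ric (st q) (nn q) (nn q)
      - (real DIM(real^'k) - 1) / (2 * snd q))"
    unfolding ind1 HH_trace[OF q S, symmetric] Rs_trace[OF q S]
    using t by (simp add: field_simps power2_eq_square)
  finally show ?thesis
    unfolding potential_deriv[OF q] ht_time[OF q] defect_fn_def Let_def Psi_def be_def al_def Phi_def
    by simp
qed

end

section \<open>The defect is of order 1/N\<close>

text \<open>The index set will consist of pairs of a parameter N and a space-time point, so that
  uniformity in N is part of the notion.\<close>

definition bdd_on :: "'j set \<Rightarrow> ('j \<Rightarrow> real) \<Rightarrow> bool"
  where "bdd_on J f \<longleftrightarrow> (\<exists>C. \<forall>j\<in>J. \<bar>f j\<bar> \<le> C)"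

lemma bdd_onI: "(\<And>j. j \<in> J \<Longrightarrow> \<bar>f j\<bar> \<le> C) \<Longrightarrow> bdd_on J f"
  unfolding bdd_on_def by blast

lemma bdd_on_const: "bdd_on J (\<lambda>j. c)"
  by (rule bdd_onI[of _ _ "\<bar>c\<bar>"]) simp

lemma bdd_on_mono: "bdd_on J g \<Longrightarrow> (\<And>j. j \<in> J \<Longrightarrow> \<bar>f j\<bar> \<le> \<bar>g j\<bar>) \<Longrightarrow> bdd_on J f"
  unfolding bdd_on_def by (meson order_trans)

lemma bdd_on_add: "bdd_on J f \<Longrightarrow> bdd_on J g \<Longrightarrow> bdd_on J (\<lambda>j. f j + g j)"
proof -
  assume "bdd_on J f" "bdd_on J g"
  then obtain C D where "\<forall>j\<in>J. \<bar>f j\<bar> \<le> C" "\<forall>j\<in>J. \<bar>g j\<bar> \<le> D" unfolding bdd_on_def by blast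
  then show ?thesis by (intro bdd_onI[of _ _ "C + D"]) (meson abs_triangle_ineq add_mono order_trans)
qed

lemma bdd_on_mult: "bdd_on J f \<Longrightarrow> bdd_on J g \<Longrightarrow> bdd_on J (\<lambda>j. f j * g j)"
proof -
  assume "bdd_on J f" "bdd_on J g"
  then obtain C D where "\<forall>j\<in>J. \<bar>f j\<bar> \<le> C" "\<forall>j\<in>J. \<bar>g j\<bar> \<le> D" unfolding bdd_on_def by blast
  then show ?thesis
    by (intro bdd_onI[of _ _ "C * D"]) (simp add: abs_mult, meson abs_ge_zero mult_mono order_trans)
qed

lemma bdd_on_diff: "bdd_on J f \<Longrightarrow> bdd_on J g \<Longrightarrow> bdd_on J (\<lambda>j. f j - g j)"
  using bdd_on_add[OF _ bdd_on_mult[OF bdd_on_const[of J "- 1"]], of f g] by simp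

text \<open>\<alpha> is at most the root of t; the cruder bound t + 1 is polynomial and thus follows
  from boundedness of t.\<close>

lemma normal_factor_le:
  fixes t P H :: real
  assumes "t > 0" "P > 0"
  shows "\<bar>sqrt (t / (1 + H ^ 2 / (t * P)))\<bar> \<le> t + 1"
proof -
  have "H ^ 2 / (t * P) \<ge> 0" using assms by simp
  then have "t / (1 + H ^ 2 / (t * P)) \<le> t / 1" using assms
    by (intro divide_left_mono) (auto intro: add_pos_nonneg)
  also have "\<dots> \<le> (t + 1) ^ 2" using assms by (simp add: power2_eq_square algebra_simps)
  finally have "sqrt (t / (1 + H ^ 2 / (t * P))) \<le> sqrt ((t + 1) ^ 2)" by (rule real_sqrt_le_mono)
  then show ?thesis using assms \<open>H ^ 2 / (t * P) \<ge> 0\<close> by simp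
qed

text \<open>After multiplication by N every summand carries a factor N/P, N b or N/Q, each bounded.
  The rest is a polynomial in bounded quantities, with \<open>i\<close> for 1/t, so that sums and
  products of bounded functions suffice.\<close>

lemma defect_split:
  fixes N m t H Hd Rnn R Rv Rt :: real
  defines "P \<equiv> N / (2 * t ^ 3) + R / t - m / (2 * t ^ 2)"
  defines "a \<equiv> sqrt (t / (1 + H ^ 2 / (t * P)))"
  defines "b \<equiv> H * a / (t * P)"
  defines "Q \<equiv> P + H ^ 2 / t" and "i \<equiv> 1 / t"
  assumes t: "t > 0" and P: "P > 0"
  shows "N * defect_fn N m t H Hd Rnn R Rv Rt =
    (N / P) * (a * H * (R * i - m / 2 * (i * i))) + (N * b) * (R - Rnn - (m - 1) / 2 * i)
    + (N / Q) * (a * Hd * i + a * H * Rnn * i - a * H * (i * i) + b * H * Rv * i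
        - 1 / 2 * (- 3 / 2 * ((N * b) * (i * i * i * i)) + b * (Rt * i - R * (i * i) + m * (i * i * i)))
        + 1 / 2 * (a * Rv * i) + b * H * H * Rnn * i - 1 / 2 * (b * H * H * (i * i)))"
proof -
  \<comment> \<open>The cancellation of the leading terms: N/(2t^3) equals P minus a remainder free
    of N.\<close>
  have main: "a * H - b * N / (2 * t ^ 2) = (a * H * (R * i - m / 2 * (i * i))) / P"
  proof -
    have "b * N / (2 * t ^ 2) = a * H * (N / (2 * t ^ 3)) / P"
      unfolding b_def using t P by (simp add: field_simps eval_nat_numeral)
    moreover have "N / (2 * t ^ 3) = P - (R * i - m / 2 * (i * i))"
      by (simp add: P_def i_def power2_eq_square)
    ultimately show ?thesis using P by (simp add: diff_divide_distrib right_diff_distrib)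
  qed
  have K: "a * Hd / t + a * H * Rnn / t - a * H / t ^ 2 + b * H * Rv / t
       - b * (- 3 * N / (2 * t ^ 4) + Rt / t - R / t ^ 2 + m / t ^ 3) / 2 + a * Rv / (2 * t)
           + b * H ^ 2 * Rnn / t - b * H ^ 2 / (2 * t ^ 2)
     = a * Hd * i + a * H * Rnn * i - a * H * (i * i) + b * H * Rv * i
        - 1 / 2 * (- 3 / 2 * ((N * b) * (i * i * i * i)) + b * (Rt * i - R * (i * i) + m * (i * i * i)))
        + 1 / 2 * (a * Rv * i) + b * H * H * Rnn * i - 1 / 2 * (b * H * H * (i * i))"
    unfolding i_def using t by (simp add: field_simps eval_nat_numeral)
  have "defect_fn N m t H Hd Rnn R Rv Rt = (a * H - b * N / (2 * t ^ 2))
     + b * (R - Rnn - (m - 1) / 2 * i)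
     + (a * Hd / t + a * H * Rnn / t - a * H / t ^ 2 + b * H * Rv / t
       - b * (- 3 * N / (2 * t ^ 4) + Rt / t - R / t ^ 2 + m / t ^ 3) / 2 + a * Rv / (2 * t)
           + b * H ^ 2 * Rnn / t - b * H ^ 2 / (2 * t ^ 2)) / Q"
    unfolding defect_fn_def Let_def P_def[symmetric] a_def[symmetric] b_def[symmetric] Q_def[symmetric]
    by (simp add: i_def)
  then show ?thesis unfolding main K by (simp add: distrib_left)
qed

text \<open>The lower bound on P gives N/P at most 4t^3; then N/Q is smaller still, and N b is N/P
  times H a/t. The only explicit N inside the bracket comes from the time derivative of P and is
  absorbed into N b.\<close>

lemma defect_bounded:
  fixes N t H Hd Rnn R Rv Rt :: "'j \<Rightarrow> real" and m :: real
  assumes bd: "bdd_on J t" "bdd_on J (\<lambda>j. 1 / t j)" "bdd_on J H" "bdd_on J Hd" "bdd_on J Rnn"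
      "bdd_on J R" "bdd_on J Rv" "bdd_on J Rt"
    and t: "\<And>j. j \<in> J \<Longrightarrow> t j > 0" and N: "\<And>j. j \<in> J \<Longrightarrow> N j \<ge> 1"
    and P: "\<And>j. j \<in> J \<Longrightarrow>
      N j / (2 * t j ^ 3) + R j / t j - m / (2 * t j ^ 2) \<ge> N j / (4 * t j ^ 3)"
  shows "bdd_on J (\<lambda>j. N j * defect_fn (N j) m (t j) (H j) (Hd j) (Rnn j) (R j) (Rv j) (Rt j))"
proof -
  define i where "i j = 1 / t j" for j
  define p where "p j = N j / (2 * t j ^ 3) + R j / t j - m / (2 * t j ^ 2)" for j
  define a where "a j = sqrt (t j / (1 + H j ^ 2 / (t j * p j)))" for j
  define b where "b j = H j * a j / (t j * p j)" for j
  define q where "q j = p j + H j ^ 2 / t j" for j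
  have p: "p j > 0" "p j \<ge> N j / (4 * t j ^ 3)" if "j \<in> J" for j
  proof -
    show 1: "p j \<ge> N j / (4 * t j ^ 3)" using P[OF that] by (simp add: p_def)
    have "N j / (4 * t j ^ 3) > 0" using t[OF that] N[OF that] by simp
    then show "p j > 0" using 1 by linarith
  qed
  have q: "q j \<ge> p j" if "j \<in> J" for j using t[OF that] by (simp add: q_def)
  have i: "bdd_on J i" using bd(2) by (simp add: i_def[abs_def])
  have a: "bdd_on J a"
  proof (rule bdd_on_mono[OF bdd_on_add[OF bd(1) bdd_on_const[of J 1]]])
    show "\<bar>a j\<bar> \<le> \<bar>t j + 1\<bar>" if "j \<in> J" for j
      using normal_factor_le[OF t[OF that] p(1)[OF that], of "H j"] t[OF that] by (simp add: a_def)
  qed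
  have t3: "bdd_on J (\<lambda>j. 4 * (t j * (t j * t j)))" by (intro bdd_on_mult bdd_on_const bd)
  have Np_le: "N j / p j \<le> 4 * (t j * (t j * t j))" if "j \<in> J" for j
    using p[OF that] t[OF that] by (simp add: field_simps eval_nat_numeral)
  have Np: "bdd_on J (\<lambda>j. N j / p j)"
  proof (rule bdd_on_mono[OF t3])
    show "\<bar>N j / p j\<bar> \<le> \<bar>4 * (t j * (t j * t j))\<bar>" if "j \<in> J" for j
      using Np_le[OF that] p(1)[OF that] N[OF that] t[OF that] by simp
  qed
  have Nq: "bdd_on J (\<lambda>j. N j / q j)"
  proof (rule bdd_on_mono[OF Np])
    show "\<bar>N j / q j\<bar> \<le> \<bar>N j / p j\<bar>" if "j \<in> J" for j
      using q[OF that] p(1)[OF that] N[OF that] by (simp add: frac_le)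
  qed
  have Nb: "bdd_on J (\<lambda>j. N j * b j)"
  proof (rule bdd_on_mono)
    show "bdd_on J (\<lambda>j. (N j / p j) * (H j * a j * i j))" by (intro bdd_on_mult Np bd a i)
    show "\<bar>N j * b j\<bar> \<le> \<bar>(N j / p j) * (H j * a j * i j)\<bar>" for j
      by (simp add: b_def i_def field_simps)
  qed
  \<comment> \<open>The condition N at least 1 is used here: it makes b no larger than N b.\<close>
  have b: "bdd_on J b"
  proof (rule bdd_on_mono[OF Nb])
    show "\<bar>b j\<bar> \<le> \<bar>N j * b j\<bar>" if "j \<in> J" for j
      using mult_right_mono[OF N[OF that], of "\<bar>b j\<bar>"] N[OF that] by (simp add: abs_mult)
  qed
  let ?f = "\<lambda>j. (N j / p j) * (a j * H j * (R j * i j - m / 2 * (i j * i j)))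
    + (N j * b j) * (R j - Rnn j - (m - 1) / 2 * i j)
    + (N j / q j) * (a j * Hd j * i j + a j * H j * Rnn j * i j - a j * H j * (i j * i j)
        + b j * H j * Rv j * i j
        - 1 / 2 * (- 3 / 2 * ((N j * b j) * (i j * i j * i j * i j))
            + b j * (Rt j * i j - R j * (i j * i j) + m * (i j * i j * i j)))
        + 1 / 2 * (a j * Rv j * i j) + b j * H j * H j * Rnn j * i j
        - 1 / 2 * (b j * H j * H j * (i j * i j)))"
  have "bdd_on J ?f"
    by (intro bdd_on_add bdd_on_diff bdd_on_mult[OF Np] bdd_on_mult[OF Nb] bdd_on_mult[OF Nq]
        bdd_on_mult bdd_on_const bd(3-) a b i Nb)
  then show ?thesis
  proof (rule bdd_on_mono)
    fix j assume "j \<in> J"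
    have "N j * defect_fn (N j) m (t j) (H j) (Hd j) (Rnn j) (R j) (Rv j) (Rt j) = ?f j"
      using defect_split[OF t[OF \<open>j \<in> J\<close>], of "N j" "R j" m "H j" "Hd j" "Rnn j" "Rv j" "Rt j"]
        p(1)[OF \<open>j \<in> J\<close>]
      unfolding p_def[symmetric] a_def[symmetric] b_def[symmetric] q_def[symmetric] i_def[symmetric]
      by blast
    then show "\<bar>N j * defect_fn (N j) m (t j) (H j) (Hd j) (Rnn j) (R j) (Rv j) (Rt j)\<bar> \<le> \<bar>?f j\<bar>"
      by simp
  qed
qed

section \<open>Continuity of the geometric data along the track\<close>

context local_flow
begin

lemma nn_cont: "continuous_on D nn"
  using nn_diff differentiable_imp_continuous_on by blast

lemma HH_cont: "continuous_on D HH"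
proof -
  have "continuous_on D (\<lambda>q. - gg (st q) (pd D pp q (0, 1)) (nn q))"
    by (intro continuous_on_minus form_continuous[OF gg_bl gg_cont st_cont st_image] pp_cont nn_cont)
  then show ?thesis using HH_formula by (simp cong: continuous_on_cong)
qed

lemma Ric_cont: "continuous_on D (\<lambda>q. Ric (st q) (nn q) (nn q))"
  by (rule form_continuous[where gg=Ric and E=E and D=D, OF Ric_bl _ st_cont st_image nn_cont nn_cont])
    (use Ric_Ck[of 0] in simp_all)

lemma Rs_cont: "continuous_on D (\<lambda>q. Rs (st q))"
  using continuous_on_compose2[OF _ st_cont st_image, of Rs] Rs_Ck[of 0] by simp

text \<open>Linearity in the direction reduces a moving direction to finitely many fixed
  ones.\<close>

lemma dRs_cont:
  assumes "continuous_on D w" shows "continuous_on D (\<lambda>q. pd E Rs (st q) (w q))"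
proof -
  have "continuous_on E (\<lambda>y. pd E Rs y b)" for b
    using Rs_Ck[of "Suc 0"] by (cases b) simp
  then have "continuous_on D (\<lambda>q. pd E Rs (st q) b)" for b
    using continuous_on_compose2[OF _ st_cont st_image] by blast
  then have "continuous_on D (\<lambda>q. \<Sum>b\<in>Basis. (w q \<bullet> b) * pd E Rs (st q) b)"
    by (intro continuous_intros assms)
  then show ?thesis
    using linear_expand[OF pd_linear[OF Rs_diff st_E]] by (simp cong: continuous_on_cong)
qed

lemma dG_cont:
  assumes w: "continuous_on D w" and u: "continuous_on D u" and v: "continuous_on D v"
  shows "continuous_on D (\<lambda>q. dG (st q) (w q) (u q) (v q))"
proof -
  have "continuous_on E (\<lambda>y. dG y b i j)" for b i j using dG_Ck[of 0] by simp
  then have "continuous_on D (\<lambda>q. dG (st q) b (u q) (v q))" for b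
    using form_continuous[where gg="\<lambda>y. dG y b" and E=E and D=D, OF dG_bl _ st_cont st_image u v]
    by blast
  then have "continuous_on D (\<lambda>q. \<Sum>b\<in>Basis. (w q \<bullet> b) * dG (st q) b (u q) (v q))"
    by (intro continuous_intros w)
  then show ?thesis
    using linear_expand[OF dG_linear[OF st_E]] by (simp cong: continuous_on_cong)
qed

lemma hdot_cont: "continuous_on D hdot"
  unfolding hdot_def[abs_def]
  by (intro continuous_intros HH_cont nn_cont pp_cont dG_cont
      form_continuous[OF gg_bl gg_cont st_cont st_image]) auto

end

section \<open>Charts\<close>

lemma chart_facts:
  assumes X: "smooth_manifold X A" and c: "c \<in> A"
  shows "openin X (cdom c)" "open (cimg c)" "inj_on (cmap c) (cdom c)" "cdom c \<subseteq> topspace X"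
    "continuous_map (subtopology X (cdom c)) euclidean (cmap c)"
    "continuous_map (top_of_set (cimg c)) X (cinv c)"
proof -
  show o: "openin X (cdom c)" and "open (cimg c)"
    using X c by (auto simp: smooth_manifold_def)
  have h: "homeomorphic_map (subtopology X (cdom c)) (top_of_set (cimg c)) (cmap c)"
    using X c by (auto simp: smooth_manifold_def)
  show s: "cdom c \<subseteq> topspace X" using o openin_subset by blast
  have t: "topspace (subtopology X (cdom c)) = cdom c" using s by auto
  show i: "inj_on (cmap c) (cdom c)"
    using homeomorphic_imp_injective_map[OF h] by (simp only: t)
  show "continuous_map (subtopology X (cdom c)) euclidean (cmap c)"
    using homeomorphic_imp_continuous_map[OF h] continuous_map_in_subtopology by blast
  obtain k where k: "homeomorphic_maps (subtopology X (cdom c)) (top_of_set (cimg c)) (cmap c) k"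
    using h homeomorphic_map_maps by blast
  then have kc: "continuous_map (top_of_set (cimg c)) (subtopology X (cdom c)) k"
    and ki: "\<And>p. p \<in> cdom c \<Longrightarrow> k (cmap c p) = p"
    unfolding homeomorphic_maps_def t by blast+
  \<comment> \<open>The homeomorphism provides some inverse \<open>k\<close>; \<open>cinv\<close> is
    a choice made by \<open>inv_into\<close>, and the two must be matched on the image of the
    chart.\<close>
  have "k x = cinv c x" if x: "x \<in> cimg c" for x
  proof -
    obtain p where "p \<in> cdom c" "x = cmap c p" using x by blast
    then show ?thesis using ki i by simp
  qed
  then have "continuous_map (top_of_set (cimg c)) (subtopology X (cdom c)) (cinv c)"
    using continuous_map_eq[OF kc] by simp
  then show "continuous_map (top_of_set (cimg c)) X (cinv c)"
    using continuous_map_in_subtopology by blast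
qed

lemma open_overlap:
  assumes X: "smooth_manifold X A" and c: "c \<in> A" "c' \<in> A"
  shows "open (overlap c c')"
proof -
  note f = chart_facts[OF X c(1)]
  have "openin (top_of_set (cimg c)) {x \<in> topspace (top_of_set (cimg c)). cinv c x \<in> cdom c'}"
    by (rule openin_continuous_map_preimage[OF f(6) chart_facts(1)[OF X c(2)]])
  moreover have "{x \<in> topspace (top_of_set (cimg c)). cinv c x \<in> cdom c'} = overlap c c'"
    using f(3) by auto
  ultimately show ?thesis using f(2) openin_open_trans by simp
qed

text \<open>Only local boundedness is asked: the functions to be bounded evaluate chart expressions
  in an arbitrarily chosen chart at each point.\<close>

lemma compactin_bdd_on:
  assumes K: "compactin Z K" and V: "\<And>z. z \<in> topspace Z \<Longrightarrow> \<exists>V. openin Z V \<and> z \<in> V \<and> bdd_on V f"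
  shows "bdd_on K f"
proof -
  let ?U = "{V. openin Z V \<and> bdd_on V f}"
  have "K \<subseteq> \<Union>?U" using V compactin_subset_topspace[OF K] by blast
  then obtain FF where FF: "finite FF" "FF \<subseteq> ?U" "K \<subseteq> \<Union>FF"
    using K unfolding compactin_def by (metis (no_types, lifting) mem_Collect_eq)
  have "bdd_on (\<Union>FF) f" using FF(1,2)
  proof (induction FF)
    case empty show ?case by (simp add: bdd_on_def)
  next
    case (insert V FF)
    then obtain C D where "\<forall>j\<in>V. \<bar>f j\<bar> \<le> C" "\<forall>j\<in>\<Union>FF. \<bar>f j\<bar> \<le> D" by (auto simp: bdd_on_def)
    then show ?case by (intro bdd_onI[of _ _ "max C D"]) (auto simp: le_max_iff_disj)
  qed
  then show ?thesis using FF(3) unfolding bdd_on_def by blast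
qed

section \<open>Independence of the charts\<close>

locale ricci_mcf =
  fixes X :: "'m topology" and A :: "('m, real^'n) chart set"
    and Y :: "'p topology" and B :: "('p, real^'k) chart set"
    and T :: real
    and g :: "('p, real^'k) chart \<Rightarrow> real \<Rightarrow> real^'k \<Rightarrow> real^'k \<Rightarrow> real^'k \<Rightarrow> real"
    and F :: "'m \<Rightarrow> real \<Rightarrow> 'p"
    and nu :: "('p, real^'k) chart \<Rightarrow> 'm \<Rightarrow> real \<Rightarrow> real^'k"
  assumes X: "smooth_manifold X A" and Y: "smooth_manifold Y B"
    and dim: "CARD('k) = CARD('n) + 1"
    and T: "T > 0"
    and gfam: "smooth_metric_family B {0<..T} g"
    and imm: "smooth_immersion_family X A Y B {0<..T} F"
    and nrm: "smooth_unit_normal A B {0<..T} g F nu"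
    and mcf: "mean_curvature_flow A B {0<..T} g F nu"
    and rf: "backwards_ricci_flow B {0<..T} g"
begin

abbreviation "Z \<equiv> prod_topology X (top_of_set {0<..T})"
abbreviation "ld c d \<equiv> local_dom {0<..T} F c d"

lemma F_continuous: "continuous_map Z Y (\<lambda>(p, t). F p t)"
  using imm by (simp add: smooth_immersion_family_def)

text \<open>The domain is the preimage of an open chart domain under the flow written in the
  coordinates of \<open>c\<close>, which is continuous on \<open>cimg c\<close> times the time
  interval.\<close>

lemma relopen_ld:
  assumes c: "c \<in> A" and d: "d \<in> B"
  shows "relopen T (ld c d)"
proof -
  note f = chart_facts[OF X c]
  let ?S = "top_of_set (cimg c \<times> {0<..T})"
  have "continuous_map ?S (top_of_set (cimg c)) fst"
    by (auto simp: continuous_map_in_subtopology intro: continuous_on_fst continuous_on_id)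
  then have "continuous_map ?S X (cinv c \<circ> fst)" using f(6) continuous_map_compose by blast
  moreover have "continuous_map ?S (top_of_set {0<..T}) snd"
    by (auto simp: continuous_map_in_subtopology intro: continuous_on_snd continuous_on_id)
  ultimately have "continuous_map ?S Z (\<lambda>q. (cinv c (fst q), snd q))"
    by (simp add: continuous_map_pairwise o_def)
  then have "continuous_map ?S Y ((\<lambda>(p, t). F p t) \<circ> (\<lambda>q. (cinv c (fst q), snd q)))"
    using F_continuous continuous_map_compose by blast
  from openin_continuous_map_preimage[OF this chart_facts(1)[OF Y d]]
  have "openin ?S {q \<in> topspace ?S. ((\<lambda>(p, t). F p t) \<circ> (\<lambda>q. (cinv c (fst q), snd q))) q \<in> cdom d}" .
  moreover have "{q \<in> topspace ?S. ((\<lambda>(p, t). F p t) \<circ> (\<lambda>q. (cinv c (fst q), snd q))) q \<in> cdom d} = ld c d"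
    by (auto simp: local_dom_def)
  ultimately obtain W where W: "open W" "ld c d = (cimg c \<times> {0<..T}) \<inter> W"
    by (auto simp: openin_open)
  have "open (cimg c \<times> UNIV \<inter> W)" using W f(2) by (intro open_Int open_Times) auto
  moreover have "ld c d = (cimg c \<times> UNIV \<inter> W) \<inter> UNIV \<times> {0<..T}" using W(2) by auto
  ultimately show ?thesis unfolding relopen_def by blast
qed

text \<open>With the empty domain only the facts about the background remain; they are needed even if
  \<open>A\<close> is empty.\<close>

lemma local_flow_empty:
  assumes "d \<in> B"
  shows "local_flow (cimg d) T ({} :: ((real^'n) \<times> real) set) (g d) (\<lambda>_ _. 0) (\<lambda>_ _. 0)"
proof -
  have "Ck_on k ({} :: ((real^'n) \<times> real) set) f" for k and f :: "(real^'n) \<times> real \<Rightarrow> real^'k"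
    by (induction k arbitrary: f) (auto simp: differentiable_on_def)
  then have s: "smooth_on ({} :: ((real^'n) \<times> real) set) (\<lambda>(x, t). 0 :: real^'k)"
    by (simp add: smooth_on_def)
  have r: "relopen T ({} :: ((real^'n) \<times> real) set)" by (auto simp: relopen_def)
  have G: "inner_form (g d t z)" if "t \<in> {0<..T}" "z \<in> cimg d" for t z
    using gfam assms that unfolding smooth_metric_family_def by blast
  have G2: "smooth_on (cimg d \<times> {0<..T}) (\<lambda>(z, t). g d t z u v)" for u v
    using gfam assms unfolding smooth_metric_family_def by blast
  have R: "((\<lambda>s. g d s z u v) has_real_derivative 2 * ricci (cimg d) (g d t) z u v) (at t within {0<..T})"
    if "t \<in> {0<..T}" "z \<in> cimg d" for t z u v
    using rf assms that unfolding backwards_ricci_flow_def by blast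
  show ?thesis
  proof (rule local_flow.intro)
    show "((\<lambda>s. g d s z u v) has_real_derivative 2 * ricci (cimg d) (g d t) z u v) (at t within {0<..T})"
      if "t \<in> {0<..T}" "z \<in> cimg d" for t z u v using R[OF that] .
    show "inner_form (g d t z)" if "t \<in> {0<..T}" "z \<in> cimg d" for t z using G[OF that] .
  qed (use T dim chart_facts(2)[OF Y assms] s r G2 in simp_all)
qed

lemma local_flow_charts:
  assumes c: "c \<in> A" and d: "d \<in> B"
  shows "local_flow (cimg d) T (ld c d) (g d) (local_map F c d) (\<lambda>x t. nu d (cinv c x) t)"
proof -
  interpret L0: local_flow "cimg d" T "{} :: ((real^'n) \<times> real) set" "g d" "\<lambda>_ _. 0" "\<lambda>_ _. 0"
    by (rule local_flow_empty[OF d])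
  show ?thesis
  proof
    show "relopen T (ld c d)" by (rule relopen_ld[OF c d])
    show "local_map F c d t x \<in> cimg d" if "(x, t) \<in> ld c d" for x t
      using that by (auto simp: local_dom_def local_map_def)
    show "smooth_on (ld c d) (\<lambda>(x, t). local_map F c d t x)"
      using imm c d by (auto simp: smooth_immersion_family_def)
    show "smooth_on (ld c d) (\<lambda>(x, t). nu d (cinv c x) t)"
      using nrm c d by (auto simp: smooth_unit_normal_def)
    show "inj (pd {x. (x, t) \<in> ld c d} (local_map F c d t) x)" if "(x, t) \<in> ld c d" for x t
    proof -
      have "\<forall>(x, t)\<in>ld c d. inj (pd {x. (x, t) \<in> ld c d} (local_map F c d t) x)"
        using imm c d unfolding smooth_immersion_family_def slice_dom_def by blast
      from bspec[OF this that] show ?thesis by simp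
    qed
    show "is_unit_normal {x. (x, t) \<in> ld c d} (local_map F c d t) (g d t) x (nu d (cinv c x) t)"
      if "(x, t) \<in> ld c d" for x t
    proof -
      have "\<forall>(x, t)\<in>ld c d. is_unit_normal {x. (x, t) \<in> ld c d} (local_map F c d t) (g d t) x
          (nu d (cinv c x) t)"
        using nrm c d unfolding smooth_unit_normal_def slice_dom_def by blast
      from bspec[OF this that] show ?thesis by simp
    qed
    show "((\<lambda>s. local_map F c d s x) has_vector_derivative
          - (mean_curv {x. (x, t) \<in> ld c d} (local_map F c d t) (cimg d) (g d t) (nu d (cinv c x) t) x
              *\<^sub>R nu d (cinv c x) t)) (at t within {0<..T})"
      if "(x, t) \<in> ld c d" for x t
    proof -
      have "\<forall>(x, t)\<in>ld c d. ((\<lambda>s. local_map F c d s x) has_vector_derivative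
          - (mean_curv {x. (x, t) \<in> ld c d} (local_map F c d t) (cimg d) (g d t) (nu d (cinv c x) t) x
              *\<^sub>R nu d (cinv c x) t)) (at t within {0<..T})"
        using mcf c d unfolding mean_curvature_flow_def slice_dom_def slice_mean_curv_def by blast
      from bspec[OF this that] show ?thesis by simp
    qed
  qed (use L0.T L0.open_U L0.dim L0.G_form L0.G_smooth L0.rflow in auto)
qed

definition "Hc c d p t = slice_mean_curv {0<..T} g F nu c d t (cmap c p)"
text \<open>Introduced as a derivative instead of by the coordinate expression \<open>hdot\<close>:
  chart independence is then inherited from \<open>Hc\<close>, and continuity comes from identifying
  the two.\<close>

definition "Hd c d p t = (THE r. ((\<lambda>s. Hc c d p s) has_vector_derivative r) (at t within {0<..T}))"
definition "Rc d y = scalar_curv (cimg d) (g d (snd y)) (fst y)"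
definition "Rcn d p t = ricci (cimg d) (g d t) (cmap d (F p t)) (nu d p t) (nu d p t)"
definition "dRc d y w = pd (cimg d \<times> {0<..T}) (Rc d) y w"

definition "at_charts c d p t \<longleftrightarrow>
  c \<in> A \<and> d \<in> B \<and> p \<in> cdom c \<and> t \<in> {0<..T} \<and> F p t \<in> cdom d"

lemma at_charts_ld: "at_charts c d p t \<Longrightarrow> (cmap c p, t) \<in> ld c d"
  using chart_facts(3)[OF X, of c] by (auto simp: at_charts_def local_dom_def)

lemma at_charts_cinv: "at_charts c d p t \<Longrightarrow> cinv c (cmap c p) = p"
  using chart_facts(3)[OF X, of c] by (auto simp: at_charts_def)

text \<open>Comparing time derivatives in two pairs of charts requires both pairs to remain valid at
  nearby times.\<close>

lemma at_charts_nearby: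
  assumes "at_charts c d p t"
  obtains e where "e > 0" "\<And>s. s \<in> {0<..T} \<Longrightarrow> \<bar>s - t\<bar> < e \<Longrightarrow> at_charts c d p s"
proof -
  have cd: "c \<in> A" "d \<in> B" using assms by (auto simp: at_charts_def)
  obtain e where e: "e > 0" "\<And>s. s \<in> {0<..T} \<Longrightarrow> \<bar>s - t\<bar> < e \<Longrightarrow> (cmap c p, s) \<in> ld c d"
    using relopen_line[OF relopen_ld[OF cd] at_charts_ld[OF assms]] by blast
  have "at_charts c d p s" if "s \<in> {0<..T}" "\<bar>s - t\<bar> < e" for s
    using e(2)[OF that] assms at_charts_cinv[OF assms] by (auto simp: at_charts_def local_dom_def)
  with e(1) that show ?thesis by blast
qed

lemma Hc_deriv:
  assumes a: "at_charts c d p t"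
  shows "((\<lambda>s. Hc c d p s) has_vector_derivative Hd c d p t) (at t within {0<..T})"
proof -
  have cd: "c \<in> A" "d \<in> B" and t: "t \<in> {0<..T}" using a by (auto simp: at_charts_def)
  interpret L: local_flow "cimg d" T "ld c d" "g d" "local_map F c d" "\<lambda>x t. nu d (cinv c x) t"
    by (rule local_flow_charts[OF cd])
  have "((\<lambda>s. L.HH (cmap c p, s)) has_vector_derivative L.hdot (cmap c p, t)) (at t within {0<..T})"
    by (rule L.HH_time_deriv[OF at_charts_ld[OF a]])
  moreover have "L.HH (cmap c p, s) = Hc c d p s" for s
    by (simp add: L.HH_def L.nn_def Hc_def slice_mean_curv_def slice_dom_def)
  ultimately have "((\<lambda>s. Hc c d p s) has_vector_derivative L.hdot (cmap c p, t)) (at t within {0<..T})"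
    by simp
  then have "\<exists>!r. ((\<lambda>s. Hc c d p s) has_vector_derivative r) (at t within {0<..T})"
    using time_derivative_unique[OF t] by blast
  from theI'[OF this] show ?thesis unfolding Hd_def .
qed

lemma transition_facts:
  assumes d: "d \<in> B" "d' \<in> B"
  shows "open (overlap d d')" "transition d d' differentiable_on overlap d d'"
  using open_overlap[OF Y d] Y d Ck_on.simps(2)[of 0 "overlap d d'" "transition d d'"]
  by (auto simp: smooth_manifold_def smooth_on_def simp del: Ck_on.simps)

lemma nu_transition:
  assumes a: "at_charts c d p t" "at_charts c d' p t"
  shows "nu d' p t = pd (overlap d d') (transition d d') (cmap d (F p t)) (nu d p t)"
proof -
  have m: "(cmap c p, t) \<in> ld c d \<inter> ld c d'" using at_charts_ld a by blast
  have "c \<in> A" "d \<in> B" "d' \<in> B" using a by (auto simp: at_charts_def)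
  then have "\<forall>(x, t)\<in>ld c d \<inter> ld c d'. nu d' (cinv c x) t =
      pd (overlap d d') (transition d d') (local_map F c d t x) (nu d (cinv c x) t)"
    using nrm unfolding smooth_unit_normal_def by blast
  from bspec[OF this m] show ?thesis by (simp add: local_map_def at_charts_cinv[OF a(1)])
qed

text \<open>Transition maps do not depend on time, so the transformation law of the metric can be
  differentiated in time with its arguments fixed.\<close>

lemma ricci_transition:
  assumes d: "d \<in> B" "d' \<in> B" and t: "t \<in> {0<..T}" and z: "z \<in> overlap d d'"
  shows "ricci (cimg d) (g d t) z u v
    = ricci (cimg d') (g d' t) (transition d d' z)
        (pd (overlap d d') (transition d d') z u) (pd (overlap d d') (transition d d') z v)"
    (is "_ = ricci _ _ ?z (?L u) (?L v)")
proof -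
  have gt: "g d s z u v = g d' s ?z (?L u) (?L v)" if "s \<in> {0<..T}" for s
    using gfam d z that unfolding smooth_metric_family_def by blast
  have z1: "z \<in> cimg d" using z by blast
  have z2: "?z \<in> cimg d'" using z chart_facts(3)[OF Y d(1)] by auto
  have "((\<lambda>s. g d' s ?z (?L u) (?L v)) has_real_derivative 2 * ricci (cimg d') (g d' t) ?z (?L u) (?L v))
      (at t within {0<..T})"
    using rf d t z2 unfolding backwards_ricci_flow_def by blast
  then have "((\<lambda>s. g d s z u v) has_real_derivative 2 * ricci (cimg d') (g d' t) ?z (?L u) (?L v))
      (at t within {0<..T})"
    unfolding has_field_derivative_def by (rule has_derivative_transform[OF t gt, rotated])
  moreover have "((\<lambda>s. g d s z u v) has_real_derivative 2 * ricci (cimg d) (g d t) z u v)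
      (at t within {0<..T})"
    using rf d t z1 unfolding backwards_ricci_flow_def by blast
  ultimately show ?thesis
    using time_derivative_unique[OF t] unfolding has_real_derivative_iff_has_vector_derivative by fastforce
qed

lemma ricci_bilinear:
  assumes d: "d \<in> B" "t \<in> {0<..T}" "z \<in> cimg d"
  shows "inner_form (g d t z)" "bilinear (ricci (cimg d) (g d t) z)"
proof -
  interpret L0: local_flow "cimg d" T "{} :: ((real^'n) \<times> real) set" "g d" "\<lambda>_ _. 0" "\<lambda>_ _. 0"
    by (rule local_flow_empty[OF d(1)])
  have E: "(z, t) \<in> L0.E" using d by (simp add: L0.E_def)
  show "inner_form (g d t z)" "bilinear (ricci (cimg d) (g d t) z)"
    using L0.gg_form[OF E] L0.Ric_bl[OF E] by (simp_all add: L0.gg_def L0.Ric_def)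
qed

lemma Rc_transition:
  assumes d: "d \<in> B" "d' \<in> B" and t: "t \<in> {0<..T}" and z: "z \<in> overlap d d'"
  shows "Rc d (z, t) = Rc d' (transition d d' z, t)"
proof -
  have z1: "z \<in> cimg d" using z by blast
  have z2: "transition d d' z \<in> cimg d'" using z chart_facts(3)[OF Y d(1)] by auto
  have "metric_trace (g d t z) (ricci (cimg d) (g d t) z) =
      metric_trace (g d' t (transition d d' z)) (ricci (cimg d') (g d' t) (transition d d' z))"
  proof (rule metric_trace_pullback)
    show "g d t z u v = g d' t (transition d d' z)
        (pd (overlap d d') (transition d d') z u) (pd (overlap d d') (transition d d') z v)" for u v
      using gfam d z t unfolding smooth_metric_family_def by blast
  qed (use ricci_bilinear d t z1 z2 ricci_transition[OF d t z] in auto)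
  then show ?thesis by (simp add: Rc_def scalar_curv_def)
qed

lemma Rc_differentiable: "d \<in> B \<Longrightarrow> Rc d differentiable_on cimg d \<times> {0<..T}"
proof -
  assume d: "d \<in> B"
  interpret L0: local_flow "cimg d" T "{} :: ((real^'n) \<times> real) set" "g d" "\<lambda>_ _. 0" "\<lambda>_ _. 0"
    by (rule local_flow_empty[OF d])
  show ?thesis using L0.Rs_diff by (simp add: L0.Rs_def[abs_def] Rc_def[abs_def] L0.E_def)
qed

lemma Rc_has_derivative:
  assumes "d \<in> B" "y \<in> cimg d \<times> {0<..T}"
  shows "(Rc d has_derivative dRc d y) (at y within cimg d \<times> {0<..T})"
  using pd_works[OF Rc_differentiable[OF assms(1)] assms(2)] unfolding dRc_def[abs_def] .

text \<open>Chain rule for the scalar curvatures, related by the map that is the transition in space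
  and the identity in time; the time component of the direction is thus kept.\<close>

lemma dRc_transition:
  assumes d: "d \<in> B" "d' \<in> B" and t: "t \<in> {0<..T}" and z: "z \<in> overlap d d'"
  shows "dRc d (z, t) (v, a)
    = dRc d' (transition d d' z, t) (pd (overlap d d') (transition d d') z v, a)"
proof -
  let ?O = "overlap d d' \<times> {0<..T}" and ?h = "\<lambda>q. (transition d d' (fst q), snd q)"
  note tf = transition_facts[OF d]
  have q: "(z, t) \<in> ?O" using z t by simp
  have im: "?h ` ?O \<subseteq> cimg d' \<times> {0<..T}" using chart_facts(3)[OF Y d(1)] by auto
  have "(fst has_derivative fst) (at (z, t) within ?O)" by (intro has_derivative_fst has_derivative_ident)
  moreover have "(transition d d' has_derivative pd (overlap d d') (transition d d') z)
      (at (fst (z, t)) within fst ` ?O)"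
    by (rule has_derivative_subset[of _ _ _ "overlap d d'"]) (use pd_works[OF tf(2) z] in auto)
  ultimately have "((\<lambda>q. transition d d' (fst q)) has_derivative
      (\<lambda>w. pd (overlap d d') (transition d d') z (fst w))) (at (z, t) within ?O)"
    by (rule has_derivative_in_compose)
  then have "(?h has_derivative (\<lambda>w. (pd (overlap d d') (transition d d') z (fst w), snd w)))
      (at (z, t) within ?O)"
    by (intro has_derivative_Pair has_derivative_snd has_derivative_ident)
  moreover have "(Rc d' has_derivative dRc d' (?h (z, t))) (at (?h (z, t)) within ?h ` ?O)"
    by (rule has_derivative_subset[OF Rc_has_derivative[OF d(2)] im]) (use im q in blast)
  ultimately have "((\<lambda>q. Rc d' (?h q)) has_derivative
      (\<lambda>w. dRc d' (?h (z, t)) (pd (overlap d d') (transition d d') z (fst w), snd w))) (at (z, t) within ?O)"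
    by (rule has_derivative_in_compose)
  then have "(Rc d has_derivative
      (\<lambda>w. dRc d' (?h (z, t)) (pd (overlap d d') (transition d d') z (fst w), snd w))) (at (z, t) within ?O)"
  proof (rule has_derivative_transform[OF q, rotated])
    show "Rc d y = Rc d' (?h y)" if "y \<in> ?O" for y
      using Rc_transition[OF d, of "snd y" "fst y"] that by auto
  qed
  moreover have "(Rc d has_derivative dRc d (z, t)) (at (z, t) within ?O)"
    by (rule has_derivative_subset[OF Rc_has_derivative[OF d(1)]]) (use q in auto)
  moreover have u: "udom ?O" using relopen_udom[OF relopen_Times[OF tf(1)]] .
  ultimately have "dRc d (z, t)
      = (\<lambda>w. dRc d' (?h (z, t)) (pd (overlap d d') (transition d d') z (fst w), snd w))"
    by (intro trans[OF pd_unique[OF u q, symmetric] pd_unique[OF u q]])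
  then show ?thesis by simp
qed

text \<open>Both sides are read off the velocity of the curve \<open>s \<mapsto> F p s\<close>, which is \<open>-H\<nu>\<close> in every chart.\<close>

lemma Hc_transition:
  assumes a: "at_charts c d p t" "at_charts c' d' p t"
  shows "Hc c d p t = Hc c' d' p t"
proof -
  have ch: "c \<in> A" "d \<in> B" "c' \<in> A" "d' \<in> B" and t: "t \<in> {0<..T}" and a': "at_charts c d' p t"
    using a by (auto simp: at_charts_def)
  have v: "((\<lambda>s. cmap d (F p s)) has_vector_derivative - (Hc c d p t *\<^sub>R nu d p t)) (at t within {0<..T})"
    if "at_charts c d p t" for c d
  proof -
    have "c \<in> A" "d \<in> B" using that by (auto simp: at_charts_def)
    then have "\<forall>(x, t)\<in>ld c d. ((\<lambda>s. local_map F c d s x) has_vector_derivative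
        - (slice_mean_curv {0<..T} g F nu c d t x *\<^sub>R nu d (cinv c x) t)) (at t within {0<..T})"
      using mcf unfolding mean_curvature_flow_def by blast
    from bspec[OF this at_charts_ld[OF that]] show ?thesis by (simp add: local_map_def at_charts_cinv[OF that] Hc_def)
  qed
  obtain e where e: "e > 0" "\<And>s. s \<in> {0<..T} \<Longrightarrow> \<bar>s - t\<bar> < e \<Longrightarrow> at_charts c d p s"
    using at_charts_nearby[OF a(1)] by blast
  obtain e' where e': "e' > 0" "\<And>s. s \<in> {0<..T} \<Longrightarrow> \<bar>s - t\<bar> < e' \<Longrightarrow> at_charts c' d' p s"
    using at_charts_nearby[OF a(2)] by blast
  let ?S = "{0<..T} \<inter> ball t (min e e')"
  let ?L = "pd (overlap d d') (transition d d') (cmap d (F p t))"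
  have F2: "F p s \<in> cdom d \<inter> cdom d'" if "s \<in> ?S" for s
    using e(2)[of s] e'(2)[of s] that by (auto simp: at_charts_def dist_real_def abs_minus_commute)
  have tS: "t \<in> ?S" using t e e' by simp
  have nhd: "at t within ?S = at t within {0<..T}"
    by (rule at_within_nhd[of t "ball t (min e e')"]) (use e(1) e'(1) in simp, simp, blast)
  have L: "(transition d d' has_derivative ?L) (at (cmap d (F p t)) within overlap d d')"
    using pd_works[OF transition_facts(2)[OF ch(2,4)]] F2[OF tS] by blast
  have "((\<lambda>s. cmap d (F p s)) has_derivative (\<lambda>h. h *\<^sub>R - (Hc c d p t *\<^sub>R nu d p t))) (at t within ?S)"
    using v[OF a(1)] unfolding nhd has_vector_derivative_def .
  moreover have "(transition d d' has_derivative ?L) (at (cmap d (F p t)) within (\<lambda>s. cmap d (F p s)) ` ?S)"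
    using F2 by (intro has_derivative_subset[OF L]) blast
  ultimately have D1: "((\<lambda>s. transition d d' (cmap d (F p s))) has_derivative
      (\<lambda>h. ?L (h *\<^sub>R - (Hc c d p t *\<^sub>R nu d p t)))) (at t within ?S)"
    by (rule has_derivative_in_compose)
  have "((\<lambda>s. cmap d' (F p s)) has_derivative
      (\<lambda>h. ?L (h *\<^sub>R - (Hc c d p t *\<^sub>R nu d p t)))) (at t within ?S)"
  proof (rule has_derivative_transform[OF tS _ D1])
    show "cmap d' (F p s) = transition d d' (cmap d (F p s))" if "s \<in> ?S" for s
      using F2[OF that] chart_facts(3)[OF Y ch(2)] by simp
  qed
  then have "((\<lambda>s. cmap d' (F p s)) has_derivative (\<lambda>h. h *\<^sub>R - (Hc c d p t *\<^sub>R nu d' p t)))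
      (at t within ?S)"
  proof (rule has_derivative_eq_rhs, intro ext)
    fix h
    note lin = has_derivative_linear[OF L]
    show "?L (h *\<^sub>R - (Hc c d p t *\<^sub>R nu d p t)) = h *\<^sub>R - (Hc c d p t *\<^sub>R nu d' p t)"
      by (simp only: linear_scale[OF lin] linear_neg[OF lin] nu_transition[OF a(1) a'])
  qed
  then have "((\<lambda>s. cmap d' (F p s)) has_vector_derivative - (Hc c d p t *\<^sub>R nu d' p t))
      (at t within {0<..T})"
    unfolding has_vector_derivative_def nhd .
  with v[OF a(2)] have eq: "Hc c d p t *\<^sub>R nu d' p t = Hc c' d' p t *\<^sub>R nu d' p t"
    using time_derivative_unique[OF t] by fastforce
  interpret L: local_flow "cimg d'" T "ld c' d'" "g d'" "local_map F c' d'" "\<lambda>x t. nu d' (cinv c' x) t"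
    by (rule local_flow_charts[OF ch(3,4)])
  have "nu d' p t \<noteq> 0"
    using L.nn_unit[OF at_charts_ld[OF a(2)]] bilinear_lzero[OF L.gg_bl[OF L.st_E[OF at_charts_ld[OF a(2)]]]]
    by (auto simp: L.nn_def at_charts_cinv[OF a(2)])
  then show ?thesis using eq by simp
qed

lemma Hd_transition:
  assumes a: "at_charts c d p t" "at_charts c' d' p t"
  shows "Hd c d p t = Hd c' d' p t"
proof -
  have t: "t \<in> {0<..T}" using a by (simp add: at_charts_def)
  obtain e where e: "e > 0" "\<And>s. s \<in> {0<..T} \<Longrightarrow> \<bar>s - t\<bar> < e \<Longrightarrow> at_charts c d p s"
    using at_charts_nearby[OF a(1)] by blast
  obtain e' where e': "e' > 0" "\<And>s. s \<in> {0<..T} \<Longrightarrow> \<bar>s - t\<bar> < e' \<Longrightarrow> at_charts c' d' p s"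
    using at_charts_nearby[OF a(2)] by blast
  have "((\<lambda>s. Hc c d p s) has_vector_derivative Hd c' d' p t) (at t within {0<..T})"
  proof (rule has_vector_derivative_transform_within[OF Hc_deriv[OF a(2)]])
    show "min e e' > 0" using e e' by simp
    show "Hc c' d' p s = Hc c d p s" if "s \<in> {0<..T}" "dist s t < min e e'" for s
      by (rule Hc_transition) (use e(2)[of s] e'(2)[of s] that in \<open>simp_all add: dist_real_def\<close>)
  qed (rule t)
  with Hc_deriv[OF a(1)] show ?thesis by (rule time_derivative_unique[OF t])
qed

lemma curvature_transition:
  assumes a: "at_charts c d p t" "at_charts c' d' p t"
  shows "Rc d (cmap d (F p t), t) = Rc d' (cmap d' (F p t), t)"
    "Rcn d p t = Rcn d' p t"
    "dRc d (cmap d (F p t), t) (nu d p t, 0) = dRc d' (cmap d' (F p t), t) (nu d' p t, 0)"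
    "dRc d (cmap d (F p t), t) (0, 1) = dRc d' (cmap d' (F p t), t) (0, 1)"
proof -
  have d: "d \<in> B" "d' \<in> B" and t: "t \<in> {0<..T}" and a': "at_charts c d' p t"
    and z: "cmap d (F p t) \<in> overlap d d'" and tr: "transition d d' (cmap d (F p t)) = cmap d' (F p t)"
    using a chart_facts(3)[OF Y, of d] by (auto simp: at_charts_def)
  have "linear (pd (overlap d d') (transition d d') (cmap d (F p t)))"
    by (rule pd_linear[OF transition_facts(2)[OF d] z])
  then have l0: "pd (overlap d d') (transition d d') (cmap d (F p t)) 0 = 0" by (rule linear_0)
  show "Rc d (cmap d (F p t), t) = Rc d' (cmap d' (F p t), t)"
    using Rc_transition[OF d t z] by (simp only: tr)
  show "Rcn d p t = Rcn d' p t"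
    using ricci_transition[OF d t z, of "nu d p t" "nu d p t"]
    by (simp only: tr Rcn_def nu_transition[OF a(1) a'])
  show "dRc d (cmap d (F p t), t) (nu d p t, 0) = dRc d' (cmap d' (F p t), t) (nu d' p t, 0)"
    using dRc_transition[OF d t z, of "nu d p t" 0] by (simp only: tr nu_transition[OF a(1) a'])
  show "dRc d (cmap d (F p t), t) (0, 1) = dRc d' (cmap d' (F p t), t) (0, 1)"
    using dRc_transition[OF d t z, of 0 1] by (simp only: tr l0)
qed

end

context ricci_mcf
begin

section \<open>Uniform bounds\<close>

lemma Rc_bounded:
  assumes b: "bounded_curvature B {0<..T} g"
  obtains C where "C \<ge> 0" "\<And>d y. d \<in> B \<Longrightarrow> y \<in> cimg d \<times> {0<..T} \<Longrightarrow> \<bar>Rc d y\<bar> \<le> C"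
proof -
  obtain C where C: "\<And>d t z u v w y. d \<in> B \<Longrightarrow> t \<in> {0<..T} \<Longrightarrow> z \<in> cimg d \<Longrightarrow>
       \<bar>g d t z (riemann (cimg d) (g d t) z u v w) y\<bar> \<le>
         C * sqrt (g d t z u u) * sqrt (g d t z v v) * sqrt (g d t z w w) * sqrt (g d t z y y)"
    using b unfolding bounded_curvature_def by blast
  let ?C = "real CARD('k) * real CARD('k) * C"
  have R: "\<bar>Rc d y\<bar> \<le> ?C" if d: "d \<in> B" and y: "y \<in> cimg d \<times> {0<..T}" for d y
  proof -
    interpret L0: local_flow "cimg d" T "{} :: ((real^'n) \<times> real) set" "g d" "\<lambda>_ _. 0" "\<lambda>_ _. 0"
      by (rule local_flow_empty[OF d])
    have y': "snd y \<in> {0<..T}" "fst y \<in> cimg d" using y by auto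
    show ?thesis
      unfolding Rc_def
    proof (rule scalar_curv_bound)
      show "dmetric (cimg d) (g d (snd y))" by (rule L0.slice_dmetric[OF y'(1)])
      show "fst y \<in> cimg d" by (rule y'(2))
      show "Ck_on 2 (cimg d) (\<lambda>z. g d (snd y) z u v)" for u v by (rule L0.slice_Ck[OF y'(1)])
      show "bilinear (ricci (cimg d) (g d (snd y)) (fst y))" by (rule ricci_bilinear(2)[OF d y'])
    qed (rule C[OF d y'])
  qed
  show ?thesis
  \<comment> \<open>The given constant may be negative when no chart supplies a point, hence the
    absolute value.\<close>
  proof (rule that[of "\<bar>?C\<bar>"])
    show "\<bar>Rc d y\<bar> \<le> \<bar>?C\<bar>" if "d \<in> B" "y \<in> cimg d \<times> {0<..T}" for d y
      by (rule order_trans[OF R[OF that] abs_ge_self])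
  qed (rule abs_ge_zero)
qed

text \<open>Positivity is required on the whole coordinate domain because the connection is handled
  through \<open>dmetric\<close>, which asks for an inner product at every point.\<close>

lemma soliton_defect_formula:
  assumes a: "at_charts c d p t"
    and pos: "\<And>y. y \<in> cimg d \<times> {0<..T} \<Longrightarrow>
      N / (2 * snd y ^ 3) + Rc d y / snd y - real CARD('k) / (2 * snd y ^ 2) > 0"
  shows "soliton_defect {0<..T} g F nu N c d (cmap c p, t)
    = defect_fn N (real CARD('k)) t (Hc c d p t) (Hd c d p t) (Rcn d p t) (Rc d (cmap d (F p t), t))
        (dRc d (cmap d (F p t), t) (nu d p t, 0)) (dRc d (cmap d (F p t), t) (0, 1))"
proof -
  have cd: "c \<in> A" "d \<in> B" and t: "t \<in> {0<..T}" using a by (auto simp: at_charts_def)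
  interpret L: local_flow "cimg d" T "ld c d" "g d" "local_map F c d" "\<lambda>x t. nu d (cinv c x) t"
    by (rule local_flow_charts[OF cd])
  have Rs: "L.Rs = Rc d" by (simp add: L.Rs_def[abs_def] Rc_def[abs_def])
  interpret LN: track_flow "cimg d" T "ld c d" "g d" "local_map F c d" "\<lambda>x t. nu d (cinv c x) t" N
    by unfold_locales (use pos in \<open>simp add: L.Phi_def L.E_def Rs\<close>)
  note q = at_charts_ld[OF a] and inv = at_charts_cinv[OF a]
  let ?q = "(cmap c p, t)"
  have H: "L.HH (cmap c p, s) = Hc c d p s" for s
    by (simp add: L.HH_def L.nn_def Hc_def slice_mean_curv_def slice_dom_def)
  have nn: "L.nn ?q = nu d p t" by (simp add: L.nn_def inv)
  have st: "L.st ?q = (cmap d (F p t), t)" by (simp add: L.st_def L.pp_def local_map_def inv)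
  have "((\<lambda>s. Hc c d p s) has_vector_derivative L.hdot ?q) (at t within {0<..T})"
    using L.HH_time_deriv[OF q] by (simp add: H)
  from time_derivative_unique[OF t this Hc_deriv[OF a]] have hd: "L.hdot ?q = Hd c d p t" .
  have met: "st_metric g N d = L.gh N"
    by (simp add: fun_eq_iff st_metric_def L.gh_def L.Phi_def L.gg_def Rs Rc_def)
  have tr: "track F c d = L.st" by (auto simp: track_def L.st_def L.pp_def fun_eq_iff)
  have normal: "track_normal {0<..T} g F nu N c d ?q = LN.ww ?q"
    using LN.track_normal_ww[OF q] by (simp add: track_normal_def met tr nn inv)
  have "soliton_defect {0<..T} g F nu N c d ?q
    = mean_curv (ld c d) L.st L.E (L.gh N) (LN.ww ?q) ?q + pd L.E (st_potential N) (L.st ?q) (LN.ww ?q)"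
    by (simp add: soliton_defect_def track_mean_curv_def normal met tr L.E_def)
  also note LN.defect_formula[OF q]
  finally show ?thesis
    by (simp add: H[of t] hd nn st Rs L.Ric_def Rcn_def dRc_def L.E_def)
qed

text \<open>An arbitrary choice of charts, with no continuity in the point. It turns chart
  expressions into functions on space-time, and chart independence makes them locally
  bounded.\<close>

definition "ch p t = (SOME cd. at_charts (fst cd) (snd cd) p t)"

lemma ch_at_charts:
  assumes p: "p \<in> topspace X" and t: "t \<in> {0<..T}"
  shows "at_charts (fst (ch p t)) (snd (ch p t)) p t"
proof -
  have "(p, t) \<in> topspace Z" using p t by simp
  then have "F p t \<in> topspace Y"
    using continuous_map_image_subset_topspace[OF F_continuous] by force
  then obtain d where d: "d \<in> B" "F p t \<in> cdom d" using Y unfolding smooth_manifold_def by blast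
  obtain c where c: "c \<in> A" "p \<in> cdom c" using X p unfolding smooth_manifold_def by blast
  have "at_charts (fst (c, d)) (snd (c, d)) p t" using c d t by (simp add: at_charts_def)
  then show ?thesis unfolding ch_def by (rule someI)
qed

lemma chart_locally_bounded:
  assumes a: "at_charts c d p0 t0" and h: "continuous_on (ld c d) h"
    and f: "\<And>p t. at_charts c d p t \<Longrightarrow> f (p, t) = h (cmap c p, t)"
  shows "\<exists>V. openin Z V \<and> (p0, t0) \<in> V \<and> bdd_on V f"
proof -
  have cd: "c \<in> A" "d \<in> B" "p0 \<in> cdom c" "t0 \<in> {0<..T}" using a by (auto simp: at_charts_def)
  note cf = chart_facts[OF X cd(1)]
  note q = at_charts_ld[OF a]
  let ?h0 = "h (cmap c p0, t0)"
  have "\<forall>U. open U \<longrightarrow> ?h0 \<in> U \<longrightarrow> (\<exists>W. open W \<and> (cmap c p0, t0) \<in> W \<and> (\<forall>y\<in>ld c d. y \<in> W \<longrightarrow> h y \<in> U))"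
    using h q unfolding continuous_on_topological by blast
  \<comment> \<open>Continuity at the single point is enough: radius 1 bounds h by
    \<open>\<bar>?h0\<bar> + 1\<close> nearby.\<close>
  from this[rule_format, of "ball ?h0 1"] obtain W where W: "open W" "(cmap c p0, t0) \<in> W"
    "\<And>y. y \<in> ld c d \<Longrightarrow> y \<in> W \<Longrightarrow> h y \<in> ball ?h0 1" by auto
  obtain W' where W': "open W'" "ld c d = W' \<inter> UNIV \<times> {0<..T}"
    using relopen_ld[OF cd(1,2)] unfolding relopen_def by blast
  let ?P = "prod_topology (subtopology X (cdom c)) (top_of_set {0<..T})"
  have tP: "topspace ?P = cdom c \<times> {0<..T}" using cf(4) by auto
  have c1: "continuous_map ?P euclidean (\<lambda>r. cmap c (fst r))"
    using continuous_map_compose[OF continuous_map_fst cf(5)] by (simp add: o_def)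
  have "continuous_map (top_of_set {0<..T}) euclidean (\<lambda>s. s)" by simp
  then have c2: "continuous_map ?P euclidean (\<lambda>r. snd r)"
    using continuous_map_compose[OF continuous_map_snd, of "top_of_set {0<..T}" euclidean "\<lambda>s. s"]
    by (simp add: o_def)
  have "continuous_map ?P (prod_topology euclidean euclidean) (\<lambda>r. (cmap c (fst r), snd r))"
    using c1 c2 by (simp only: continuous_map_pairwise o_def fst_conv snd_conv)
  then have "openin ?P {r \<in> topspace ?P. (cmap c (fst r), snd r) \<in> W \<inter> W'}"
    using W(1) W'(1) by (intro openin_continuous_map_preimage) auto
  moreover have "?P = subtopology Z (cdom c \<times> {0<..T})"
    by (simp only: prod_topology_subtopology(1) topspace_euclidean_subtopology)
  moreover have "openin Z (cdom c \<times> {0<..T})"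
    using cf(1) by (simp add: openin_prod_Times_iff)
  ultimately have "openin Z {r \<in> topspace ?P. (cmap c (fst r), snd r) \<in> W \<inter> W'}"
    by (simp only: openin_trans_full)
  moreover have "(p0, t0) \<in> {r \<in> topspace ?P. (cmap c (fst r), snd r) \<in> W \<inter> W'}"
    unfolding tP using cd W(2) q W'(2) by simp
  moreover have "bdd_on {r \<in> topspace ?P. (cmap c (fst r), snd r) \<in> W \<inter> W'} f"
  proof (rule bdd_onI[of _ _ "\<bar>?h0\<bar> + 1"])
    fix r assume "r \<in> {r \<in> topspace ?P. (cmap c (fst r), snd r) \<in> W \<inter> W'}"
    then obtain p t where r: "r = (p, t)" "p \<in> cdom c" "t \<in> {0<..T}" "(cmap c p, t) \<in> W" "(cmap c p, t) \<in> W'"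
      unfolding tP by (cases r) auto
    then have m: "(cmap c p, t) \<in> ld c d" using W'(2) by auto
    then have "at_charts c d p t" using cd r cf(3) by (auto simp: at_charts_def local_dom_def)
    then have "f r = h (cmap c p, t)" using f r by simp
    moreover have "\<bar>?h0 - h (cmap c p, t)\<bar> < 1" using W(3)[OF m r(4)] by (simp add: dist_real_def)
    ultimately show "\<bar>f r\<bar> \<le> \<bar>?h0\<bar> + 1" by linarith
  qed
  ultimately show ?thesis by blast
qed

text \<open>Near a given point, \<open>inv\<close> replaces the varying choice of charts by the one
  made at that point, where a continuous representative exists.\<close>

lemma compact_bounded:
  assumes K: "compactin Z K"
    and h: "\<And>c d. c \<in> A \<Longrightarrow> d \<in> B \<Longrightarrow>
      \<exists>h. continuous_on (ld c d) h \<and> (\<forall>p t. at_charts c d p t \<longrightarrow> \<phi> c d p t = h (cmap c p, t))"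
    and inv: "\<And>c d c' d' p t. at_charts c d p t \<Longrightarrow> at_charts c' d' p t \<Longrightarrow> \<phi> c d p t = \<phi> c' d' p t"
  shows "bdd_on K (\<lambda>r. \<phi> (fst (ch (fst r) (snd r))) (snd (ch (fst r) (snd r))) (fst r) (snd r))"
proof (rule compactin_bdd_on[OF K])
  fix z assume "z \<in> topspace Z"
  then obtain p0 t0 where z: "z = (p0, t0)" "p0 \<in> topspace X" "t0 \<in> {0<..T}" by (cases z) auto
  note a = ch_at_charts[OF z(2,3)]
  let ?c = "fst (ch p0 t0)" and ?d = "snd (ch p0 t0)"
  have cd: "?c \<in> A" "?d \<in> B" using a by (auto simp: at_charts_def)
  obtain h where h: "continuous_on (ld ?c ?d) h"
    "\<And>p t. at_charts ?c ?d p t \<Longrightarrow> \<phi> ?c ?d p t = h (cmap ?c p, t)"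
    using h[OF cd] by blast
  show "\<exists>V. openin Z V \<and> z \<in> V \<and>
      bdd_on V (\<lambda>r. \<phi> (fst (ch (fst r) (snd r))) (snd (ch (fst r) (snd r))) (fst r) (snd r))"
    unfolding z(1)
  proof (rule chart_locally_bounded[OF a h(1)])
    fix p t assume b: "at_charts ?c ?d p t"
    then have "p \<in> topspace X" "t \<in> {0<..T}"
      using chart_facts(4)[OF X cd(1)] by (auto simp: at_charts_def)
    from inv[OF ch_at_charts[OF this] b] h(2)[OF b]
    show "\<phi> (fst (ch (fst (p, t)) (snd (p, t)))) (snd (ch (fst (p, t)) (snd (p, t)))) (fst (p, t)) (snd (p, t))
      = h (cmap ?c p, t)" by simp
  qed
qed

text \<open>Time and its inverse are treated like the curvature data: boundedness of 1/t is how
  compactness keeps the times of K away from 0.\<close>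

lemma data_continuous:
  assumes c: "c \<in> A" and d: "d \<in> B"
  shows "\<exists>h. continuous_on (ld c d) h \<and> (\<forall>p t. at_charts c d p t \<longrightarrow> Hc c d p t = h (cmap c p, t))"
    "\<exists>h. continuous_on (ld c d) h \<and> (\<forall>p t. at_charts c d p t \<longrightarrow> Hd c d p t = h (cmap c p, t))"
    "\<exists>h. continuous_on (ld c d) h \<and> (\<forall>p t. at_charts c d p t \<longrightarrow> Rcn d p t = h (cmap c p, t))"
    "\<exists>h. continuous_on (ld c d) h \<and> (\<forall>p t. at_charts c d p t \<longrightarrow> Rc d (cmap d (F p t), t) = h (cmap c p, t))"
    "\<exists>h. continuous_on (ld c d) h \<and> (\<forall>p t. at_charts c d p t \<longrightarrow>
        dRc d (cmap d (F p t), t) (nu d p t, 0) = h (cmap c p, t))"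
    "\<exists>h. continuous_on (ld c d) h \<and> (\<forall>p t. at_charts c d p t \<longrightarrow>
        dRc d (cmap d (F p t), t) (0, 1) = h (cmap c p, t))"
    "\<exists>h. continuous_on (ld c d) h \<and> (\<forall>p t. at_charts c d p t \<longrightarrow> t = h (cmap c p, t))"
    "\<exists>h. continuous_on (ld c d) h \<and> (\<forall>p t. at_charts c d p t \<longrightarrow> 1 / t = h (cmap c p, t))"
proof -
  interpret L: local_flow "cimg d" T "ld c d" "g d" "local_map F c d" "\<lambda>x t. nu d (cinv c x) t"
    by (rule local_flow_charts[OF c d])
  have Rs: "L.Rs = Rc d" by (simp add: L.Rs_def[abs_def] Rc_def[abs_def])
  have H: "L.HH (cmap c p, s) = Hc c d p s" for p s
    by (simp add: L.HH_def L.nn_def Hc_def slice_mean_curv_def slice_dom_def)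
  have nn: "L.nn (cmap c p, t) = nu d p t" if "at_charts c d p t" for p t
    by (simp add: L.nn_def at_charts_cinv[OF that])
  have st: "L.st (cmap c p, t) = (cmap d (F p t), t)" if "at_charts c d p t" for p t
    by (simp add: L.st_def L.pp_def local_map_def at_charts_cinv[OF that])
  have hd: "L.hdot (cmap c p, t) = Hd c d p t" if a: "at_charts c d p t" for p t
  proof (rule time_derivative_unique[OF _ _ Hc_deriv[OF a]])
    show "t \<in> {0<..T}" using a by (simp add: at_charts_def)
    show "((\<lambda>s. Hc c d p s) has_vector_derivative L.hdot (cmap c p, t)) (at t within {0<..T})"
      using L.HH_time_deriv[OF at_charts_ld[OF a]] by (simp add: H)
  qed
  show "\<exists>h. continuous_on (ld c d) h \<and> (\<forall>p t. at_charts c d p t \<longrightarrow> Hc c d p t = h (cmap c p, t))"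
    using L.HH_cont H by metis
  show "\<exists>h. continuous_on (ld c d) h \<and> (\<forall>p t. at_charts c d p t \<longrightarrow> Hd c d p t = h (cmap c p, t))"
    using L.hdot_cont hd by metis
  show "\<exists>h. continuous_on (ld c d) h \<and> (\<forall>p t. at_charts c d p t \<longrightarrow> Rcn d p t = h (cmap c p, t))"
    by (intro exI conjI, rule L.Ric_cont) (simp add: nn st L.Ric_def Rcn_def)
  show "\<exists>h. continuous_on (ld c d) h \<and> (\<forall>p t. at_charts c d p t \<longrightarrow> Rc d (cmap d (F p t), t) = h (cmap c p, t))"
    by (intro exI conjI, rule L.Rs_cont) (simp add: st Rs)
  have w: "continuous_on (ld c d) (\<lambda>q. (L.nn q, 0::real))"
    by (intro continuous_on_Pair L.nn_cont continuous_on_const)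
  show "\<exists>h. continuous_on (ld c d) h \<and> (\<forall>p t. at_charts c d p t \<longrightarrow>
        dRc d (cmap d (F p t), t) (nu d p t, 0) = h (cmap c p, t))"
    by (intro exI conjI, rule L.dRs_cont[OF w]) (simp add: st Rs nn L.E_def dRc_def)
  show "\<exists>h. continuous_on (ld c d) h \<and> (\<forall>p t. at_charts c d p t \<longrightarrow>
        dRc d (cmap d (F p t), t) (0, 1) = h (cmap c p, t))"
    by (intro exI conjI, rule L.dRs_cont[OF continuous_on_const[of _ "(0, 1)"]])
      (simp add: st Rs L.E_def dRc_def)
  have s: "continuous_on (ld c d) snd" by (intro continuous_on_snd continuous_on_id)
  then show "\<exists>h. continuous_on (ld c d) h \<and> (\<forall>p t. at_charts c d p t \<longrightarrow> t = h (cmap c p, t))"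
    by (intro exI[of _ snd]) simp
  have "continuous_on (ld c d) (\<lambda>q. 1 / snd q)"
    by (intro continuous_on_divide continuous_on_const s) (auto simp: local_dom_def)
  then show "\<exists>h. continuous_on (ld c d) h \<and> (\<forall>p t. at_charts c d p t \<longrightarrow> 1 / t = h (cmap c p, t))"
    by (intro exI[of _ "\<lambda>q. 1 / snd q"]) simp
qed

text \<open>The difference of the two sides is
  \<open>(N + 4 * R * t ^ 2 - 2 * m * t) / (4 * t ^ 3)\<close>, and the threshold on N is the worst
  case of that numerator. Half of the leading coefficient N/(2t^3) is kept as a lower bound.\<close>

lemma lapse_lower_bound:
  fixes t C R N m :: real
  assumes t: "0 < t" "t \<le> T" and R: "\<bar>R\<bar> \<le> C" and m: "m \<ge> 0"
    and N: "N \<ge> 4 * C * T ^ 2 + 2 * m * T + 1"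
  shows "N / (2 * t ^ 3) + R / t - m / (2 * t ^ 2) \<ge> N / (4 * t ^ 3)"
proof -
  have "- R * t ^ 2 \<le> C * T ^ 2"
  proof -
    have "- R * t ^ 2 \<le> C * t ^ 2" using R by (intro mult_right_mono) auto
    also have "\<dots> \<le> C * T ^ 2" using R t by (intro mult_left_mono power_mono) auto
    finally show ?thesis .
  qed
  moreover have "m * t \<le> m * T" using t m by (intro mult_left_mono) auto
  ultimately have "N + 4 * R * t ^ 2 - 2 * m * t \<ge> 0" using N by simp
  then have "(N + 4 * R * t ^ 2 - 2 * m * t) / (4 * t ^ 3) \<ge> 0" using t by simp
  moreover have "N / (2 * t ^ 3) + R / t - m / (2 * t ^ 2) - N / (4 * t ^ 3)
      = (N + 4 * R * t ^ 2 - 2 * m * t) / (4 * t ^ 3)"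
    using t by (simp add: field_simps eval_nat_numeral)
  ultimately show ?thesis by linarith
qed

theorem approximate_soliton:
  assumes b: "bounded_curvature B {0<..T} g"
  shows "\<exists>N0>0.
    (\<forall>N\<ge>N0. \<forall>d\<in>B. \<forall>q\<in>cimg d \<times> {0<..T}. inner_form (st_metric g N d q)) \<and>
    (\<forall>K. compactin Z K \<longrightarrow>
      (\<exists>C. \<forall>N\<ge>N0. \<forall>(p, t)\<in>K. \<forall>c\<in>A. \<forall>d\<in>B. p \<in> cdom c \<longrightarrow> F p t \<in> cdom d \<longrightarrow>
        N * \<bar>soliton_defect {0<..T} g F nu N c d (cmap c p, t)\<bar> \<le> C))"
proof -
  obtain CR where CR: "CR \<ge> 0" "\<And>d y. d \<in> B \<Longrightarrow> y \<in> cimg d \<times> {0<..T} \<Longrightarrow> \<bar>Rc d y\<bar> \<le> CR"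
    using Rc_bounded[OF b] by blast
  define m where "m = real CARD('k)"
  \<comment> \<open>The summand 1 ensures that N is at least 1.\<close>
  define N0 where "N0 = 4 * CR * T ^ 2 + 2 * m * T + 1"
  have N0: "N0 \<ge> 1" using CR(1) T by (simp add: N0_def m_def)
  have low: "N / (2 * snd y ^ 3) + Rc d y / snd y - m / (2 * snd y ^ 2) \<ge> N / (4 * snd y ^ 3)"
    if "N \<ge> N0" "d \<in> B" "y \<in> cimg d \<times> {0<..T}" for N d y
    using that CR(2)[OF that(2,3)] unfolding N0_def
    by (intro lapse_lower_bound[where C=CR]) (auto simp: m_def)
  have pos: "N / (2 * snd y ^ 3) + Rc d y / snd y - m / (2 * snd y ^ 2) > 0"
    if "N \<ge> N0" "d \<in> B" "y \<in> cimg d \<times> {0<..T}" for N d y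
  proof -
    have "N / (4 * snd y ^ 3) > 0" using that N0 by auto
    then show ?thesis using low[OF that] by linarith
  qed
  have form: "inner_form (st_metric g N d y)"
    if "N \<ge> N0" "d \<in> B" "y \<in> cimg d \<times> {0<..T}" for N d y
  proof -
    interpret L0: local_flow "cimg d" T "{} :: ((real^'n) \<times> real) set" "g d" "\<lambda>_ _. 0" "\<lambda>_ _. 0"
      by (rule local_flow_empty[OF that(2)])
    have "st_metric g N d = L0.gh N"
      by (simp add: fun_eq_iff st_metric_def L0.gh_def L0.Phi_def L0.gg_def L0.Rs_def)
    moreover have "L0.Phi N y > 0"
      using pos[OF that] by (simp add: L0.Phi_def L0.Rs_def Rc_def m_def)
    ultimately show ?thesis using L0.gh_form that(3) by (simp add: L0.E_def)
  qed
  have bound: "\<exists>C. \<forall>N\<ge>N0. \<forall>(p, t)\<in>K. \<forall>c\<in>A. \<forall>d\<in>B. p \<in> cdom c \<longrightarrow> F p t \<in> cdom d \<longrightarrow>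
        N * \<bar>soliton_defect {0<..T} g F nu N c d (cmap c p, t)\<bar> \<le> C"
    if K: "compactin Z K" for K
  proof -
    define cc where "cc r = fst (ch (fst r) (snd r))" for r
    define dd where "dd r = snd (ch (fst r) (snd r))" for r
    let ?y = "\<lambda>r. (cmap (dd r) (F (fst r) (snd r)), snd r)"
    let ?fn = "\<lambda>N r. defect_fn N m (snd r) (Hc (cc r) (dd r) (fst r) (snd r))
      (Hd (cc r) (dd r) (fst r) (snd r)) (Rcn (dd r) (fst r) (snd r)) (Rc (dd r) (?y r))
      (dRc (dd r) (?y r) (nu (dd r) (fst r) (snd r), 0)) (dRc (dd r) (?y r) (0, 1))"
    \<comment> \<open>N belongs to the index set, so the constant obtained is independent of
      N.\<close>
    let ?J = "{N0..} \<times> K"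
    have KZ: "fst r \<in> topspace X" "snd r \<in> {0<..T}" if "r \<in> K" for r
      using compactin_subset_topspace[OF K] that by auto
    have a: "at_charts (cc r) (dd r) (fst r) (snd r)" if "r \<in> K" for r
      using ch_at_charts[OF KZ[OF that]] by (simp add: cc_def dd_def)
    have lift: "bdd_on ?J (\<lambda>j. f (snd j))" if "bdd_on K f" for f :: "'m \<times> real \<Rightarrow> real"
      using that unfolding bdd_on_def by auto
    note bd = compact_bounded[OF K, folded cc_def dd_def]
    have "bdd_on ?J (\<lambda>j. fst j * ?fn (fst j) (snd j))"
    proof (rule defect_bounded)
      show "bdd_on ?J (\<lambda>j. snd (snd j))"
        by (rule lift[of "\<lambda>r. snd r"], rule bd[of "\<lambda>c d p t. t"]) (use data_continuous(7) in auto)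
      show "bdd_on ?J (\<lambda>j. 1 / snd (snd j))"
        by (rule lift[of "\<lambda>r. 1 / snd r"], rule bd[of "\<lambda>c d p t. 1 / t"]) (use data_continuous(8) in auto)
      show "bdd_on ?J (\<lambda>j. Hc (cc (snd j)) (dd (snd j)) (fst (snd j)) (snd (snd j)))"
        by (rule lift, rule bd[of Hc]) (fact data_continuous(1), fact Hc_transition)
      show "bdd_on ?J (\<lambda>j. Hd (cc (snd j)) (dd (snd j)) (fst (snd j)) (snd (snd j)))"
        by (rule lift, rule bd[of Hd]) (fact data_continuous(2), fact Hd_transition)
      show "bdd_on ?J (\<lambda>j. Rcn (dd (snd j)) (fst (snd j)) (snd (snd j)))"
        by (rule lift, rule bd[of "\<lambda>c d p t. Rcn d p t"]) (fact data_continuous(3), fact curvature_transition(2))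
      show "bdd_on ?J (\<lambda>j. Rc (dd (snd j)) (?y (snd j)))"
        by (rule lift, rule bd[of "\<lambda>c d p t. Rc d (cmap d (F p t), t)"])
          (fact data_continuous(4), fact curvature_transition(1))
      show "bdd_on ?J (\<lambda>j. dRc (dd (snd j)) (?y (snd j)) (nu (dd (snd j)) (fst (snd j)) (snd (snd j)), 0))"
        by (rule lift, rule bd[of "\<lambda>c d p t. dRc d (cmap d (F p t), t) (nu d p t, 0)"])
          (fact data_continuous(5), fact curvature_transition(3))
      show "bdd_on ?J (\<lambda>j. dRc (dd (snd j)) (?y (snd j)) (0, 1))"
        by (rule lift, rule bd[of "\<lambda>c d p t. dRc d (cmap d (F p t), t) (0, 1)"])
          (fact data_continuous(6), fact curvature_transition(4))
    next
      fix j assume j: "j \<in> ?J"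
      then have jK: "snd j \<in> K" "fst j \<ge> N0" by auto
      show "snd (snd j) > 0" using KZ[OF jK(1)] by simp
      show "fst j \<ge> 1" using jK N0 by simp
      have "dd (snd j) \<in> B" "?y (snd j) \<in> cimg (dd (snd j)) \<times> {0<..T}"
        using a[OF jK(1)] by (auto simp: at_charts_def)
      from low[OF jK(2) this]
      show "fst j / (2 * snd (snd j) ^ 3) + Rc (dd (snd j)) (?y (snd j)) / snd (snd j)
          - m / (2 * snd (snd j) ^ 2) \<ge> fst j / (4 * snd (snd j) ^ 3)" by simp
    qed
    then obtain C where C': "\<forall>j\<in>?J. \<bar>fst j * ?fn (fst j) (snd j)\<bar> \<le> C"
      unfolding bdd_on_def by blast
    have C: "\<bar>N * ?fn N r\<bar> \<le> C" if "N \<ge> N0" "r \<in> K" for N r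
      using bspec[OF C', of "(N, r)"] that by simp
    have "N * \<bar>soliton_defect {0<..T} g F nu N c d (cmap c p, t)\<bar> \<le> C"
      if N: "N \<ge> N0" and r: "(p, t) \<in> K" and cd: "c \<in> A" "d \<in> B" "p \<in> cdom c" "F p t \<in> cdom d" for N p t c d
    proof -
      have b: "at_charts c d p t" using cd KZ[OF r] by (simp add: at_charts_def)
      note a' = a[OF r, simplified]
      have "soliton_defect {0<..T} g F nu N c d (cmap c p, t)
        = defect_fn N (real CARD('k)) t (Hc c d p t) (Hd c d p t) (Rcn d p t) (Rc d (cmap d (F p t), t))
            (dRc d (cmap d (F p t), t) (nu d p t, 0)) (dRc d (cmap d (F p t), t) (0, 1))"
        by (rule soliton_defect_formula[OF b]) (use pos[OF N cd(2)] in \<open>simp add: m_def\<close>)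
      \<comment> \<open>All arguments of \<open>defect_fn\<close> agree with their values in the
        chosen charts, so a single constant serves every pair \<open>c\<close>,
        \<open>d\<close>.\<close>
      then have "soliton_defect {0<..T} g F nu N c d (cmap c p, t) = ?fn N (p, t)"
        using Hc_transition[OF b a'] Hd_transition[OF b a'] curvature_transition[OF b a']
        by (simp add: m_def)
      then show ?thesis using C[OF N r] N N0 by (simp add: abs_mult)
    qed
    then show ?thesis by (intro exI[of _ C]) auto
  qed
  show ?thesis using N0 form bound by (intro exI[of _ N0]) auto
qed

end

theorem theorem3p3:
  fixes X :: "'m topology" and A :: "('m, real^'n) chart set"
    and Y :: "'p topology" and B :: "('p, real^'k) chart set"
    and T :: real
    and g :: "('p, real^'k) chart \<Rightarrow> real \<Rightarrow> real^'k \<Rightarrow> real^'k \<Rightarrow> real^'k \<Rightarrow> real"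
    and F :: "'m \<Rightarrow> real \<Rightarrow> 'p"
    and nu :: "('p, real^'k) chart \<Rightarrow> 'm \<Rightarrow> real \<Rightarrow> real^'k"
  assumes "smooth_manifold X A" and "smooth_manifold Y B"
    and "CARD('k) = CARD('n) + 1"
    and "T > 0"
    and "smooth_metric_family B {0<..T} g"
    and "smooth_immersion_family X A Y B {0<..T} F"
    and "smooth_unit_normal A B {0<..T} g F nu"
    and "mean_curvature_flow A B {0<..T} g F nu"
    and "backwards_ricci_flow B {0<..T} g"
    and "bounded_curvature B {0<..T} g"
    and "bounded_second_ff A B {0<..T} g F nu"
  shows "\<exists>N0>0.
    (\<forall>N\<ge>N0. \<forall>d\<in>B. \<forall>q\<in>cimg d \<times> {0<..T}. inner_form (st_metric g N d q)) \<and>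
    (\<forall>K. compactin (prod_topology X (top_of_set {0<..T})) K \<longrightarrow>
      (\<exists>C. \<forall>N\<ge>N0. \<forall>(p, t)\<in>K. \<forall>c\<in>A. \<forall>d\<in>B. p \<in> cdom c \<longrightarrow> F p t \<in> cdom d \<longrightarrow>
        N * \<bar>soliton_defect {0<..T} g F nu N c d (cmap c p, t)\<bar> \<le> C))"
  using ricci_mcf.approximate_soliton[OF ricci_mcf.intro[OF assms(1-9)] assms(10)] .

end
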